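(* Let $n\ge1$ be an integer, $\nu>0$, and assume that there is $a\in\mathbb{R}\setminus\{0\}$ such that $a_i=a$ for all $i\in\{1,\dots,n\}$. Then the density $$p_\infty(z^1,\dots,z^n)=\frac{1}{(4\pi\nu)^n}e^{-\frac{1}{4\nu}\sum_{i=1}^n|z^i|^2}$$ of the normal law $\mathcal{N}_{2n}(0,2\nu I_{2n})$ is invariant for the SDE $$Z^i_t=X^i_0+\sqrt{2\nu}\,B^i_t+\int_0^t\Big(\sum_{j\neq i}a_jK(Z^i_s-Z^j_s)-\frac{Z^i_s}{2}\Big)ds,\qquad 1\le i\le n.$$ Moreover, if $(X^1_0,\dots,X^n_0)$ has a density $p_0$ with respect to the Lebesgue measure on $\mathbb{R}^{2n}$ such that the relative entropy $\int_{\mathbb{R}^{2n}}p_0\ln\left(\frac{p_0}{p_\infty}\right)$ is finite, then, denoting by $p_t$ the density of $Z_t=(Z^1_t,\dots,Z^n_t)$, $$\forall t\ge0,\quad\int_{\mathbb{R}^{2n}}p_t\ln\left(\frac{p_t}{p_\infty}\right)\le e^{-t}\int_{\mathbb{R}^{2n}}p_0\ln\left(\frac{p_0}{p_\infty}\right).$$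
   Context: $K:\mathbb{R}^2\setminus\{0\}\to\mathbb{R}^2$ is the Biot and Savart kernel $K(x)=\frac{x^\perp}{2\pi|x|^2}$, where $x^\perp=(-x_2,x_1)$. $B^1,\dots,B^n$ are independent two-dimensional standard Brownian motions, independent of the initial vector $(X^1_0,\dots,X^n_0)\in(\mathbb{R}^2)^n$, which satisfies $\mathbb{P}(\exists i\neq j:\ X^i_0=X^j_0)=0$. It is known that the SDE then has a unique strong solution (the particles almost surely never collide), and that for $t>0$ the vector $Z_t$ has a density with respect to the Lebesgue measure on $\mathbb{R}^{2n}$. *)

theory Defs
  imports "HOL-Probability.Probability"
begin

section \<open>The Biot--Savart kernel\<close>

definition perp :: "real ^ 2 \<Rightarrow> real ^ 2" where
  "perp x = vector [- (x $ 2), x $ 1]"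

text \<open>The kernel is only meant on nonzero vectors; the value at 0 is the artefact 0 of
  division by zero. It is never used below, since solutions do not collide.\<close>

definition biot_savart :: "real ^ 2 \<Rightarrow> real ^ 2" where
  "biot_savart x = (1 / (2 * pi * (norm x)\<^sup>2)) *\<^sub>R perp x"

section \<open>Brownian motions and the driving data\<close>

definition standard_brownian_motion ::
  "'w measure \<Rightarrow> (real \<Rightarrow> 'w \<Rightarrow> real ^ 'd::finite) \<Rightarrow> bool" where
  "standard_brownian_motion M W \<longleftrightarrow>
     (\<forall>t\<ge>0. W t \<in> borel_measurable M) \<and>
     (AE \<omega> in M. W 0 \<omega> = 0) \<and>
     (AE \<omega> in M. continuous_on {0..} (\<lambda>t. W t \<omega>)) \<and>
     (\<forall>s t. 0 \<le> s \<longrightarrow> s < t \<longrightarrow>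
        distributed M lborel (\<lambda>\<omega>. W t \<omega> - W s \<omega>)
          (\<lambda>x. ennreal (\<Prod>k\<in>UNIV. normal_density 0 (sqrt (t - s)) (x $ k)))) \<and>
     (\<forall>(m::nat) (u::nat \<Rightarrow> real). 0 \<le> u 0 \<longrightarrow> (\<forall>k<m. u k \<le> u (Suc k)) \<longrightarrow>
        prob_space.indep_vars M (\<lambda>_. borel) (\<lambda>k \<omega>. W (u (Suc k)) \<omega> - W (u k) \<omega>) {..<m})"

text \<open>The $\sigma$-algebra generated by the random variables \<open>W t\<close>, $t \in T$.\<close>

definition generated_events ::
  "'w measure \<Rightarrow> 't set \<Rightarrow> ('t \<Rightarrow> 'w \<Rightarrow> 'b::topological_space) \<Rightarrow> 'w set set" where
  "generated_events M T W =
     sigma_sets (space M) {W t -` A \<inter> space M | t A. t \<in> T \<and> A \<in> sets borel}"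

text \<open>The index \<open>None\<close> stands for the initial vector and \<open>Some i\<close> for the $i$-th Brownian
  motion, so that the last conjunct says that the Brownian motions are mutually independent
  and jointly independent of the initial vector.\<close>

definition driving_data ::
  "'w measure \<Rightarrow> ('w \<Rightarrow> (real ^ 2) ^ 'n::finite) \<Rightarrow> ('n \<Rightarrow> real \<Rightarrow> 'w \<Rightarrow> real ^ 2) \<Rightarrow> bool" where
  "driving_data M X0 B \<longleftrightarrow>
     prob_space M \<and>
     X0 \<in> borel_measurable M \<and>
     (AE \<omega> in M. \<forall>i j. i \<noteq> j \<longrightarrow> X0 \<omega> $ i \<noteq> X0 \<omega> $ j) \<and>
     (\<forall>i. standard_brownian_motion M (B i)) \<and>
     prob_space.indep_sets M
       (\<lambda>k. case k of None \<Rightarrow> generated_events M {()} (\<lambda>_. X0)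
                    | Some i \<Rightarrow> generated_events M {0..} (B i)) UNIV"

section \<open>The stochastic differential equation\<close>

definition vortex_drift ::
  "('n::finite \<Rightarrow> real) \<Rightarrow> (real ^ 2) ^ 'n \<Rightarrow> 'n \<Rightarrow> real ^ 2" where
  "vortex_drift a z i =
     (\<Sum>j\<in>UNIV - {i}. a j *\<^sub>R biot_savart (z $ i - z $ j)) - (1 / 2) *\<^sub>R (z $ i)"

text \<open>The noise is additive, so the equation is a pathwise integral equation. Because the
  kernel is defined only off the origin, a solution is required to stay almost surely in the
  set of collision-free configurations; the integrand is then continuous on $[0,t]$ and the
  integral exists. The drift is locally Lipschitz on that set, so almost every path of a
  solution is determined by the paths of the data. Hence adaptedness to the filtration of
  the data holds automatically, up to completion, and is not imposed.\<close>

definition vortex_solution ::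
  "real \<Rightarrow> ('n::finite \<Rightarrow> real) \<Rightarrow> 'w measure \<Rightarrow> ('w \<Rightarrow> (real ^ 2) ^ 'n) \<Rightarrow>
    ('n \<Rightarrow> real \<Rightarrow> 'w \<Rightarrow> real ^ 2) \<Rightarrow> (real \<Rightarrow> 'w \<Rightarrow> (real ^ 2) ^ 'n) \<Rightarrow> bool" where
  "vortex_solution \<nu> a M X0 B Z \<longleftrightarrow>
     driving_data M X0 B \<and>
     (\<forall>t\<ge>0. Z t \<in> borel_measurable M) \<and>
     (AE \<omega> in M. continuous_on {0..} (\<lambda>t. Z t \<omega>)) \<and>
     (AE \<omega> in M. \<forall>t\<ge>0. \<forall>i j. i \<noteq> j \<longrightarrow> Z t \<omega> $ i \<noteq> Z t \<omega> $ j) \<and>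
     (AE \<omega> in M. \<forall>t\<ge>0. \<forall>i.
        Z t \<omega> $ i = X0 \<omega> $ i + sqrt (2 * \<nu>) *\<^sub>R B i t \<omega>
          + integral {0..t} (\<lambda>s. vortex_drift a (Z s \<omega>) i))"

section \<open>Densities, invariance and relative entropy\<close>

definition has_density ::
  "'w measure \<Rightarrow> ('w \<Rightarrow> 'b::euclidean_space) \<Rightarrow> ('b \<Rightarrow> real) \<Rightarrow> bool" where
  "has_density M X p \<longleftrightarrow> (\<forall>z. 0 \<le> p z) \<and> distributed M lborel X (\<lambda>z. ennreal (p z))"

text \<open>Since HOL cannot quantify over types inside a formula, the type of the sample points is
  a parameter; a theorem about \<open>TYPE('w)\<close> with \<open>'w\<close> a type variable concerns solutions on
  all probability spaces.\<close>

definition invariant_density ::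
  "'w itself \<Rightarrow> real \<Rightarrow> ('n::finite \<Rightarrow> real) \<Rightarrow> ((real ^ 2) ^ 'n \<Rightarrow> real) \<Rightarrow> bool" where
  "invariant_density (_ :: 'w itself) \<nu> a q \<longleftrightarrow>
     (\<forall>(M :: 'w measure) X0 B Z. vortex_solution \<nu> a M X0 B Z \<longrightarrow> has_density M X0 q \<longrightarrow>
        (\<forall>t\<ge>0. has_density M (Z t) q))"

definition p_infty :: "real \<Rightarrow> (real ^ 2) ^ 'n::finite \<Rightarrow> real" where
  "p_infty \<nu> z = 1 / (4 * pi * \<nu>) ^ CARD('n)
     * exp (- (1 / (4 * \<nu>)) * (\<Sum>i\<in>UNIV. (norm (z $ i))\<^sup>2))"

lemma p_infty_eq_prod_normal_density:
  fixes z :: "(real ^ 2) ^ 'n::finite"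
  assumes "\<nu> > 0"
  shows "p_infty \<nu> z = (\<Prod>i\<in>UNIV. \<Prod>k\<in>UNIV. normal_density 0 (sqrt (2 * \<nu>)) (z $ i $ k))"
proof -
  have "(\<Prod>k\<in>UNIV. normal_density 0 (sqrt (2 * \<nu>)) (x $ k))
      = 1 / (4 * pi * \<nu>) * exp (- (1 / (4 * \<nu>)) * (norm x)\<^sup>2)" for x :: "real ^ 2"
  proof -
    have "norm x ^ 2 = (x $ 1)\<^sup>2 + (x $ 2)\<^sup>2"
      by (simp only: power2_norm_eq_inner inner_vec_def sum_2) (simp add: power2_eq_square)
    then show ?thesis
      using assms
      by (simp add: UNIV_2 normal_density_def exp_add [symmetric] field_simps
          real_sqrt_mult [symmetric] power2_eq_square)
  qed
  then show ?thesis
    by (simp add: p_infty_def prod.distrib exp_sum [symmetric] sum_distrib_left power_divide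
        prod_dividef sum_negf sum_divide_distrib)
qed

text \<open>The integrand vanishes where \<open>p z = 0\<close>, as it should. Its negative part is integrable
  for all probability densities, so that finiteness of the relative entropy is
  integrability of the integrand.\<close>

definition entropy_integrand :: "('b \<Rightarrow> real) \<Rightarrow> ('b \<Rightarrow> real) \<Rightarrow> 'b \<Rightarrow> real" where
  "entropy_integrand p q z = p z * ln (p z / q z)"

definition finite_relative_entropy ::
  "('b::euclidean_space \<Rightarrow> real) \<Rightarrow> ('b \<Rightarrow> real) \<Rightarrow> bool" where
  "finite_relative_entropy p q \<longleftrightarrow> integrable lborel (entropy_integrand p q)"

definition relative_entropy ::
  "('b::euclidean_space \<Rightarrow> real) \<Rightarrow> ('b \<Rightarrow> real) \<Rightarrow> real" where
  "relative_entropy p q = (\<integral>z. entropy_integrand p q z \<partial>lborel)"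

end

theory Submission
  imports Defs
begin

text \<open>No stochastic calculus is needed. The vortex interaction of two particles \<open>i\<close>, \<open>j\<close>
  rotates \<open>z i - z j\<close> and fixes \<open>z i + z j\<close>; such rotations preserve the Gaussian law
  \<open>\<gamma>\<close> with density \<open>p_infty\<close>, hence relative entropy with respect to it. The solution is
  therefore approximated by the splitting scheme that, in each time step \<open>h\<close>, performs
  all pair rotations, multiplies by \<open>sqrt (1 - h)\<close> and adds \<open>sqrt (2 * \<nu>)\<close> times the
  Brownian increments. The last two operations are an Ornstein--Uhlenbeck step for \<open>\<gamma>\<close>, which
  contracts the relative entropy by the factor \<open>1 - h\<close>. Since the noise is additive and the path
  of a solution on a compact time interval stays away from collisions, the scheme converges
  almost surely, and the bound passes to the limit because relative entropy is lower
  semicontinuous.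

  The contraction is used in its Donsker--Varadhan dual form, an inequality for logarithmic
  moment generating functions that tensorises by Jensen's inequality. In dimension one it is
  proved by Rioul's argument for the entropy power inequality: transport the Gaussian to the
  extremal density by a monotone map, rotate the plane, and use the concavity of \<open>ln\<close>.\<close>

section \<open>Lebesgue measure and monotone transport\<close>

text \<open>Equality of the intensities is what makes a pair interaction a rotation: the kernel is
  odd, so two vortices of the same strength move with opposite velocities. For different strengths
  the strength-weighted sum of the two positions would be conserved instead, and the motion of the
  pair would not be orthogonal. Relative entropy is not continuous under convergence in law, and a
  test function that is merely measurable does not pass through an almost sure limit. Every bound is
  therefore kept in dual form; only the limit is restricted to continuous test functions, and
  measurable ones are recovered afterwards from the density of \<open>Z t\<close>. The
  Ornstein-Uhlenbeck step and the rotations leave the Gaussian exactly invariant, so the entropy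
  estimate carries no discretisation error: \<open>m\<close> steps of length \<open>t / m\<close>
  give the factor \<open>(1 - t / m) ^ m\<close>, which is at most \<open>exp (- t)\<close> once
  \<open>t < m\<close>. Consistency of the scheme matters only for the convergence of the paths.
  Invariance is the case of zero initial entropy.\<close>

lemma nn_integral_lborel_translate:
  fixes F :: "'a::euclidean_space \<Rightarrow> ennreal"
  assumes "F \<in> borel_measurable borel"
  shows "(\<integral>\<^sup>+x. F (x + v) \<partial>lborel) = (\<integral>\<^sup>+x. F x \<partial>lborel)"
proof -
  have "(\<integral>\<^sup>+x. F x \<partial>lborel) = (\<integral>\<^sup>+x. F x \<partial>distr lborel borel ((+) v))"
    by (simp add: lborel_distr_plus)
  also have "\<dots> = (\<integral>\<^sup>+x. F (v + x) \<partial>lborel)"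
    using assms by (subst nn_integral_distr) auto
  finally show ?thesis by (simp add: add.commute)
qed

text \<open>Uniqueness of Haar measure, by Fubini: with \<open>A\<close> the unit ball, both
  \<open>vol A * vol (f -` B)\<close> and \<open>vol A * vol B\<close> equal the integral over \<open>(x, y)\<close> of
  the indicator of \<open>f x \<in> B \<and> y - f x \<in> A\<close>.\<close>

lemma lborel_distr_orthogonal:
  fixes f :: "'a::euclidean_space \<Rightarrow> 'a"
  assumes "orthogonal_transformation f"
  shows "distr lborel borel f = lborel"
proof (rule measure_eqI)
  fix B assume "B \<in> sets (distr lborel borel f)"
  then have [measurable]: "B \<in> sets borel" by simp
  have lin: "linear f" using assms by (rule orthogonal_transformation_linear)
  have [measurable]: "f \<in> borel_measurable borel"
    using lin by (intro borel_measurable_continuous_onI linear_continuous_on)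
      (simp add: linear_conv_bounded_linear)
  define A :: "'a set" where "A = ball 0 1"
  have [measurable]: "A \<in> sets borel" by (simp add: A_def)
  have A: "emeasure lborel A \<noteq> 0" "emeasure lborel A \<noteq> \<infinity>"
    by (simp_all add: A_def emeasure_ball unit_ball_vol_pos less_imp_neq[symmetric])
  let ?J = "\<lambda>x y. indicator B (f x) * indicator A (y - f x) :: ennreal"
  have "emeasure lborel A * emeasure (distr lborel borel f) B
      = (\<integral>\<^sup>+x. indicator B (f x) * (\<integral>\<^sup>+y. indicator A y \<partial>lborel) \<partial>lborel)"
  proof -
    have "emeasure (distr lborel borel f) B = (\<integral>\<^sup>+x. indicator B x \<partial>distr lborel borel f)"
      by simp
    also have "\<dots> = (\<integral>\<^sup>+x. indicator B (f x) \<partial>lborel)"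
      by (subst nn_integral_distr) auto
    finally show ?thesis by (simp add: nn_integral_multc mult.commute nn_integral_cmult)
  qed
  also have "\<dots> = (\<integral>\<^sup>+x. \<integral>\<^sup>+y. ?J x y \<partial>lborel \<partial>lborel)"
  proof (intro nn_integral_cong)
    fix x
    have "(\<integral>\<^sup>+y. indicator A y \<partial>lborel) = (\<integral>\<^sup>+y. indicator A (y + - f x) \<partial>lborel)"
      by (rule nn_integral_lborel_translate[symmetric]) measurable
    then show "indicator B (f x) * (\<integral>\<^sup>+y. indicator A y \<partial>lborel) = (\<integral>\<^sup>+y. ?J x y \<partial>lborel)"
      by (subst nn_integral_cmult) auto
  qed
  also have "\<dots> = (\<integral>\<^sup>+y. \<integral>\<^sup>+x. ?J x y \<partial>lborel \<partial>lborel)"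
    by (rule lborel_pair.Fubini'[symmetric]) measurable
  also have "\<dots> = (\<integral>\<^sup>+y. \<integral>\<^sup>+x. indicator B (f x + y) * indicator A x \<partial>lborel \<partial>lborel)"
  proof (rule nn_integral_cong)
    fix y
    \<comment> \<open>Shifting by a preimage \<open>w\<close> of \<open>y\<close> turns
      \<open>y - f x\<close> into \<open>- f x\<close>, which lies in the unit ball exactly when
      \<open>x\<close> does. Norm preservation enters here.\<close>
    obtain w where w: "f w = y"
      using orthogonal_transformation_surj[OF assms] by (metis surjD)
    have "(\<integral>\<^sup>+x. ?J x y \<partial>lborel) = (\<integral>\<^sup>+x. ?J (x + w) y \<partial>lborel)"
      by (rule nn_integral_lborel_translate[symmetric]) measurable
    also have "\<dots> = (\<integral>\<^sup>+x. indicator B (f x + y) * indicator A x \<partial>lborel)"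
      using orthogonal_transformation_norm[OF assms]
      by (intro nn_integral_cong) (simp add: linear_add[OF lin] w A_def indicator_def)
    finally show "(\<integral>\<^sup>+x. ?J x y \<partial>lborel) = \<dots>" .
  qed
  also have "\<dots> = (\<integral>\<^sup>+x. \<integral>\<^sup>+y. indicator B (f x + y) * indicator A x \<partial>lborel \<partial>lborel)"
    by (rule lborel_pair.Fubini') measurable
  also have "\<dots> = (\<integral>\<^sup>+x. emeasure lborel B * indicator A x \<partial>lborel)"
  proof (intro nn_integral_cong)
    fix x
    have "(\<integral>\<^sup>+y. indicator B (f x + y) * indicator A x \<partial>lborel)
      = (\<integral>\<^sup>+y. indicator B (y + f x) \<partial>lborel) * indicator A x"
      by (subst nn_integral_multc) (auto simp: add.commute)
    then show "(\<integral>\<^sup>+y. indicator B (f x + y) * indicator A x \<partial>lborel) = emeasure lborel B * indicator A x"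
      by (subst (asm) nn_integral_lborel_translate) auto
  qed
  also have "\<dots> = emeasure lborel A * emeasure lborel B"
    by (subst nn_integral_cmult) (auto simp: mult.commute)
  finally show "emeasure (distr lborel borel f) B = emeasure lborel B"
    using A by (simp add: ennreal_mult_cancel_left)
qed simp

text \<open>On \<open>[-n, n]\<close> substitution is an equality with the integral over
  \<open>[g (-n), g n]\<close>; these intervals need not exhaust the line, hence the inequality. Its
  direction is the one that the upper bound in \<open>std_normal_contraction\<close> uses.\<close>

lemma nn_integral_substitution_le:
  fixes f g g' :: "real \<Rightarrow> real"
  assumes [measurable]: "f \<in> borel_measurable borel" and f: "\<And>x. 0 \<le> f x"
    and g: "\<And>x. (g has_real_derivative g' x) (at x)"
    and g': "continuous_on UNIV g'" "\<And>x. 0 \<le> g' x"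
  shows "(\<integral>\<^sup>+x. f (g x) * g' x \<partial>lborel) \<le> (\<integral>\<^sup>+x. f x \<partial>lborel)"
proof -
  have [measurable]: "g' \<in> borel_measurable borel"
    by (rule borel_measurable_continuous_onI) fact
  have [measurable]: "g \<in> borel_measurable borel"
    using DERIV_isCont[OF g] by (intro borel_measurable_continuous_onI continuous_at_imp_continuous_on) auto
  let ?F = "\<lambda>n x. ennreal (f (g x) * g' x * indicator {-real n..real n} x)"
  have "(\<integral>\<^sup>+x. f (g x) * g' x \<partial>lborel) = (\<integral>\<^sup>+x. (SUP n. ?F n x) \<partial>lborel)"
  proof (intro nn_integral_cong antisym)
    fix x
    obtain n where "\<bar>x\<bar> \<le> real n" using real_arch_simple by blast
    then have "ennreal (f (g x) * g' x) = ?F n x" by (auto simp: indicator_def)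
    also have "\<dots> \<le> (SUP n. ?F n x)" by (rule SUP_upper) simp
    finally show "ennreal (f (g x) * g' x) \<le> (SUP n. ?F n x)" .
    show "(SUP n. ?F n x) \<le> ennreal (f (g x) * g' x)"
      using f g' by (intro SUP_least) (auto simp: indicator_def)
  qed
  also have "\<dots> = (SUP n. \<integral>\<^sup>+x. ?F n x \<partial>lborel)"
  proof (rule nn_integral_monotone_convergence_SUP)
    show "incseq ?F"
      using f g'(2) by (intro incseq_SucI le_funI ennreal_leI mult_left_mono)
        (auto simp: indicator_def)
  qed measurable
  also have "\<dots> \<le> (\<integral>\<^sup>+x. f x \<partial>lborel)"
  proof (rule SUP_least)
    fix n :: nat
    have "(\<integral>\<^sup>+x. ?F n x \<partial>lborel) = (\<integral>\<^sup>+x. f x * indicator {g (-real n)..g (real n)} x \<partial>lborel)"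
      using g g' by (intro nn_integral_substitution[symmetric])
        (auto intro: continuous_on_subset simp: set_borel_measurable_def)
    also have "\<dots> \<le> (\<integral>\<^sup>+x. f x \<partial>lborel)"
      using f by (intro nn_integral_mono) (auto simp: indicator_def)
    finally show "(\<integral>\<^sup>+x. ?F n x \<partial>lborel) \<le> (\<integral>\<^sup>+x. f x \<partial>lborel)" .
  qed
  finally show ?thesis .
qed

text \<open>Jensen's inequality, from the tangent of \<open>exp\<close> at the mean. The right side
  is a nonnegative integral, so that applications do not owe the integrability of the
  exponential.\<close>

lemma (in prob_space) exp_expectation_le:
  assumes "integrable M u"
  shows "ennreal (exp (expectation u)) \<le> (\<integral>\<^sup>+x. exp (u x) \<partial>M)"
proof (cases "integrable M (\<lambda>x. exp (u x))")
  case True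
  define l where "l = expectation u"
  have "exp l = expectation (\<lambda>x. exp l * (1 + (u x - l)))"
    using assms by (simp add: l_def prob_space)
  also have "\<dots> \<le> expectation (\<lambda>x. exp (u x))"
  proof (intro integral_mono)
    fix x
    have "exp l * (1 + (u x - l)) \<le> exp l * exp (u x - l)"
      by (intro mult_left_mono exp_ge_add_one_self) auto
    then show "exp l * (1 + (u x - l)) \<le> exp (u x)" by (simp add: exp_diff)
  qed (use assms True in auto)
  finally show ?thesis
    using True by (subst nn_integral_eq_integral) (auto simp: l_def)
next
  case False
  then have "(\<integral>\<^sup>+x. exp (u x) \<partial>M) = \<infinity>"
    using assms by (auto simp: integrable_iff_bounded less_top[symmetric])
  then show ?thesis by simp
qed

section \<open>Monotone transport between positive densities on the line\<close>

lemma positive_density_cdf: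
  fixes f :: "real \<Rightarrow> real"
  assumes f: "continuous_on UNIV f" "\<And>x. 0 < f x" "(\<integral>\<^sup>+x. f x \<partial>lborel) = 1"
  obtains F where "\<And>x. (F has_real_derivative f x) (at x)" "range F = {0<..<1}" "strict_mono F"
proof -
  have [measurable]: "f \<in> borel_measurable borel" by (rule borel_measurable_continuous_onI) fact
  let ?M = "density lborel f"
  interpret prob_space ?M
    by (rule prob_spaceI) (simp add: emeasure_density f(3))
  interpret real_distribution ?M
    by standard simp_all
  have diff: "cdf ?M y - cdf ?M x = integral {x..y} f" if "x < y" for x y
  proof -
    have i: "f integrable_on {x..y}"
      by (intro integrable_continuous_real continuous_on_subset[OF f(1)]) auto
    have "emeasure ?M {x<..y} = (\<integral>\<^sup>+z\<in>{x..y}. f z \<partial>lborel)"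
      using AE_lborel_singleton[of x]
      by (subst emeasure_density) (auto intro!: nn_integral_cong_AE elim!: eventually_mono simp: indicator_def)
    also have "\<dots> = integral {x..y} f"
      using f(2) i by (intro nn_integral_has_integral_lebesgue') (auto intro: less_imp_le)
    finally show ?thesis
      using that f(2) by (simp add: cdf_diff_eq measure_def integral_nonneg[OF i] less_imp_le)
  qed
  have D: "(cdf ?M has_real_derivative f x) (at x)" for x
  proof -
    have "((\<lambda>u. integral {x - 1..u} f) has_real_derivative f x) (at x within {x - 1..x + 1})"
      by (intro integral_has_real_derivative continuous_on_subset[OF f(1)]) auto
    then have "((\<lambda>u. integral {x - 1..u} f) has_real_derivative f x) (at x)"
      by (subst (asm) at_within_Icc_at) auto
    then have "((\<lambda>u. cdf ?M (x - 1) + integral {x - 1..u} f) has_real_derivative f x) (at x)"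
      by (auto intro!: derivative_eq_intros)
    then show ?thesis
    proof (rule has_field_derivative_transform_within_open[where S = "{x - 1<..}"])
      fix y assume "y \<in> {x - 1<..}"
      then show "cdf ?M (x - 1) + integral {x - 1..y} f = cdf ?M y"
        using diff[of "x - 1" y] by simp
    qed auto
  qed
  have mono: "strict_mono (cdf ?M)"
    using DERIV_pos_imp_increasing[of _ _ "cdf ?M"] D f(2) by (metis strict_monoI)
  have "range (cdf ?M) = {0<..<1}"
  proof
    show "range (cdf ?M) \<subseteq> {0<..<1}"
    proof safe
      fix x
      have "cdf ?M (x - 1) < cdf ?M x" "cdf ?M x < cdf ?M (x + 1)"
        using mono by (simp_all add: strict_mono_def)
      then show "cdf ?M x \<in> {0<..<1}"
        using cdf_nonneg[of "x - 1"] cdf_bounded_prob[of "x + 1"] by simp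
    qed
    show "{0<..<1} \<subseteq> range (cdf ?M)"
    proof
      fix u :: real assume u: "u \<in> {0<..<1}"
      obtain a where "cdf ?M a < u"
        using order_tendstoD(2)[OF cdf_lim_at_bot, of u] u
        by (auto dest: eventually_happens)
      moreover obtain b where "u < cdf ?M b"
        using order_tendstoD(1)[OF cdf_lim_at_top_prob, of u] u
        by (auto dest: eventually_happens)
      moreover have "a \<le> b"
        using calculation mono by (meson leI less_trans not_less_iff_gr_or_eq strict_monoD)
      ultimately show "u \<in> range (cdf ?M)"
        using IVT'[of "cdf ?M" a u b] D DERIV_isCont
        by (metis continuous_at_imp_continuous_on less_imp_le rangeI)
    qed
  qed
  then show ?thesis using that D mono by blast
qed

text \<open>\<open>T\<close> is the quantile map \<open>inv F o G\<close>, which carries the law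
  with density \<open>g\<close> to the law with density \<open>f\<close>. The formula for its
  derivative, the Monge-Ampere equation in dimension one, is all that the contraction needs of the
  transport.\<close>

lemma monotone_transport:
  fixes f g :: "real \<Rightarrow> real"
  assumes f: "continuous_on UNIV f" "\<And>x. 0 < f x" "(\<integral>\<^sup>+x. f x \<partial>lborel) = 1"
    and g: "continuous_on UNIV g" "\<And>x. 0 < g x" "(\<integral>\<^sup>+x. g x \<partial>lborel) = 1"
  obtains T where "\<And>x. (T has_real_derivative g x / f (T x)) (at x)"
proof -
  obtain F where F: "\<And>x. (F has_real_derivative f x) (at x)" "range F = {0<..<1}" "strict_mono F"
    using positive_density_cdf[OF f] by metis
  obtain G where G: "\<And>x. (G has_real_derivative g x) (at x)" "range G = {0<..<1}"
    using positive_density_cdf[OF g] by metis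
  have inj: "inv F (F x) = x" for x using F(3) by (simp add: strict_mono_imp_inj_on)
  have contF: "continuous_on UNIV F"
    by (rule continuous_at_imp_continuous_on) (blast intro: DERIV_isCont F(1))
  have DI: "(inv F has_real_derivative inverse (f x)) (at (F x))" for x
  proof -
    have "(inv F has_derivative (\<lambda>h. inverse (f x) * h)) (at (F x))"
    proof (rule has_derivative_inverse_strong[OF open_UNIV UNIV_I contF])
      show "(F has_derivative (\<lambda>h. f x * h)) (at x)"
        using F(1)[of x] by (simp add: has_field_derivative_def)
      show "(\<lambda>h. f x * h) \<circ> (\<lambda>h. inverse (f x) * h) = id"
        using f(2)[of x] by (auto simp: fun_eq_iff field_simps)
    qed (rule inj)
    then show ?thesis by (simp add: has_field_derivative_def)
  qed
  show ?thesis
  proof (rule that)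
    fix x
    obtain y where y: "G x = F y" using F(2) G(2) by (metis rangeE rangeI)
    show "((\<lambda>x. inv F (G x)) has_real_derivative g x / f (inv F (G x))) (at x)"
      using DERIV_chain2[of "inv F" "inverse (f y)" G x "g x" UNIV, OF _ G(1)] DI[of y]
      by (simp add: y inj divide_inverse mult.commute)
  qed
qed

section \<open>Entropy contraction for the one-dimensional Mehler kernel\<close>

abbreviation std_normal :: "real measure" where
  "std_normal \<equiv> density lborel (\<lambda>x. ennreal (std_normal_density x))"

lemma std_normal_density_shift:
  "std_normal_density (w - m) = std_normal_density w * exp (m * w - m\<^sup>2 / 2)"
proof -
  have "- (w - m)\<^sup>2 / 2 = - w\<^sup>2 / 2 + (m * w - m\<^sup>2 / 2)"
    by (simp add: power2_eq_square field_simps)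
  then show ?thesis
    unfolding std_normal_density_def by (simp only: exp_add mult.assoc)
qed

text \<open>The shift is carried by the density, which is continuous, so that \<open>f\<close> may
  be merely measurable and dominated convergence applies.\<close>

lemma continuous_on_std_normal_convolution:
  fixes f :: "real \<Rightarrow> real"
  assumes [measurable]: "f \<in> borel_measurable borel" and f: "\<And>x. \<bar>f x\<bar> \<le> C"
  shows "continuous_on UNIV (\<lambda>m. \<integral>w. f w * std_normal_density (w - m) \<partial>lborel)"
proof (rule continuous_on_sequentiallyI)
  fix X :: "nat \<Rightarrow> real" and m assume X: "X \<longlonglongrightarrow> m"
  then obtain B where B: "\<And>n. \<bar>X n\<bar> \<le> B"
    using Bseq_def convergentI convergent_imp_Bseq real_norm_def by metis
  \<comment> \<open>For |m| at most \<open>B\<close>, exp(m w - m^2/2) is at most exp(B |w|), hence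
    at most exp(B w) + exp(-B w). So all the shifted densities lie below the sum of the two extreme
    ones times exp(B^2/2).\<close>
  let ?D = "\<lambda>w. C * (exp (B\<^sup>2 / 2) * (normal_density B 1 w + normal_density (-B) 1 w))"
  have C: "0 \<le> C" using f[of 0] by simp
  show "(\<lambda>n. \<integral>w. f w * std_normal_density (w - X n) \<partial>lborel)
      \<longlonglongrightarrow> (\<integral>w. f w * std_normal_density (w - m) \<partial>lborel)"
  proof (rule integral_dominated_convergence[where w = ?D])
    show "integrable lborel ?D"
      by (intro integrable_mult_right Bochner_Integration.integrable_add) simp_all
    show "AE w in lborel. (\<lambda>n. f w * std_normal_density (w - X n)) \<longlonglongrightarrow> f w * std_normal_density (w - m)"
      unfolding std_normal_density_def by (intro AE_I2 tendsto_intros X) auto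
    show "AE w in lborel. norm (f w * std_normal_density (w - X n)) \<le> ?D w" for n
    proof (rule AE_I2)
      fix w
      have "X n * w - (X n)\<^sup>2 / 2 \<le> \<bar>X n\<bar> * \<bar>w\<bar>"
        using abs_ge_self[of "X n * w"] zero_le_power2[of "X n"] unfolding abs_mult by linarith
      also have "\<dots> \<le> B * \<bar>w\<bar>" using B by (intro mult_right_mono) auto
      finally have "exp (X n * w - (X n)\<^sup>2 / 2) \<le> exp (B * \<bar>w\<bar>)" by simp
      also have "\<dots> \<le> exp (B * w) + exp (- B * w)"
        by (cases "w \<ge> 0") auto
      also have "\<dots> = exp (B\<^sup>2 / 2) * (exp (B * w - B\<^sup>2 / 2) + exp (- B * w - (- B)\<^sup>2 / 2))"
        by (simp add: distrib_left flip: exp_add)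
      finally have "std_normal_density w * exp (X n * w - (X n)\<^sup>2 / 2) \<le> std_normal_density w *
          (exp (B\<^sup>2 / 2) * (exp (B * w - B\<^sup>2 / 2) + exp (- B * w - (- B)\<^sup>2 / 2)))"
        by (intro mult_left_mono) simp_all
      also have "\<dots> = exp (B\<^sup>2 / 2) * (std_normal_density (w - B) + std_normal_density (w - - B))"
        unfolding std_normal_density_shift by (simp add: algebra_simps)
      also have "\<dots> = exp (B\<^sup>2 / 2) * (normal_density B 1 w + normal_density (-B) 1 w)"
        by (simp add: normal_density_def std_normal_density_def)
      finally have "std_normal_density (w - X n) \<le> exp (B\<^sup>2 / 2) * (normal_density B 1 w + normal_density (-B) 1 w)"
        unfolding std_normal_density_shift .
      then show "norm (f w * std_normal_density (w - X n)) \<le> ?D w"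
        unfolding real_norm_def abs_mult using f C by (intro mult_mono) auto
    qed
  qed measurable
qed

text \<open>Gaussian averaging smooths a measurable function; this supplies the continuous density
  that \<open>monotone_transport\<close> requires.\<close>

lemma continuous_on_mehler:
  fixes f :: "real \<Rightarrow> real"
  assumes [measurable]: "f \<in> borel_measurable borel" and f: "\<And>x. \<bar>f x\<bar> \<le> C" and "\<sigma> > 0"
  shows "continuous_on UNIV (\<lambda>x. \<integral>y. f (\<rho> * x + \<sigma> * y) \<partial>std_normal)"
proof -
  have "(\<integral>y. f (\<rho> * x + \<sigma> * y) \<partial>std_normal)
      = (\<integral>w. f (\<sigma> * w) * std_normal_density (w - \<rho> * x / \<sigma>) \<partial>lborel)" for x
  proof -
    have "(\<integral>w. f (\<sigma> * w) * std_normal_density (w - \<rho> * x / \<sigma>) \<partial>lborel)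
        = (\<integral>y. f (\<sigma> * (\<rho> * x / \<sigma> + 1 * y)) * std_normal_density (\<rho> * x / \<sigma> + 1 * y - \<rho> * x / \<sigma>) \<partial>lborel)"
      by (subst lborel_integral_real_affine[where c = 1 and t = "\<rho> * x / \<sigma>"]) simp_all
    then show ?thesis
      using \<open>\<sigma> > 0\<close> by (simp add: integral_density algebra_simps)
  qed
  moreover have "continuous_on UNIV (\<lambda>x. \<integral>w. f (\<sigma> * w) * std_normal_density (w - \<rho> * x / \<sigma>) \<partial>lborel)"
  proof (rule continuous_on_compose2[OF continuous_on_std_normal_convolution])
    show "continuous_on UNIV (\<lambda>x. \<rho> * x / \<sigma>)"
      using \<open>\<sigma> > 0\<close> by (intro continuous_intros) auto
  qed (use f in auto)
  ultimately show ?thesis by simp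
qed

lemma orthogonal_transformation_plane_rotation:
  assumes "\<rho>\<^sup>2 + \<sigma>\<^sup>2 = (1::real)"
  shows "orthogonal_transformation (\<lambda>(x, y). (\<rho> * x - \<sigma> * y, \<sigma> * x + \<rho> * y))"
proof -
  have "linear (\<lambda>(x, y). (\<rho> * x - \<sigma> * y, \<sigma> * x + \<rho> * y))"
    by (rule linearI) (auto simp: algebra_simps)
  moreover have "(\<rho> * a - \<sigma> * b) * (\<rho> * c - \<sigma> * d) + (\<sigma> * a + \<rho> * b) * (\<sigma> * c + \<rho> * d)
      = (\<rho>\<^sup>2 + \<sigma>\<^sup>2) * (a * c + b * d)" for a b c d
    by (simp add: algebra_simps power2_eq_square)
  ultimately show ?thesis
    using assms by (auto simp: orthogonal_transformation_def)
qed

text \<open>The weighted arithmetic-geometric mean inequality for \<open>t\<close> and 1; in this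
  form the concavity of \<open>ln\<close> enters the contraction.\<close>

lemma powr_le_weighted_mean:
  assumes "0 < (t::real)" "0 \<le> a" "a \<le> 1"
  shows "t powr a \<le> a * t + (1 - a)"
  using Youngs_inequality_0[of a "1 - a" t 1] assms by simp

lemma (in prob_space) abs_expectation_le:
  fixes \<phi> :: "'a \<Rightarrow> real"
  assumes "\<phi> \<in> borel_measurable M" "\<And>x. x \<in> space M \<Longrightarrow> \<bar>\<phi> x\<bar> \<le> C"
  shows "\<bar>expectation \<phi>\<bar> \<le> C"
proof -
  have i: "integrable M \<phi>"
    using assms by (intro integrable_const_bound[where B = C]) auto
  have "\<bar>expectation \<phi>\<bar> \<le> expectation (\<lambda>x. \<bar>\<phi> x\<bar>)" by (rule integral_abs_bound)
  also have "\<dots> \<le> expectation (\<lambda>x. C)" using assms i by (intro integral_mono) auto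
  finally show ?thesis by (simp add: prob_space)
qed

text \<open>With \<open>P\<close> the Gaussian average of \<phi>, the left side is the maximum over
  laws Q of the integral of \<open>P\<close> against Q minus \<rho>^2 times the entropy of Q
  relative to the Gaussian. The inequality thus says that \<rho> X + \<sigma> Y, with Y standard
  normal and independent of X, has at most \<rho>^2 times the entropy of X.\<close>

lemma std_normal_contraction:
  fixes \<phi> :: "real \<Rightarrow> real"
  assumes [measurable]: "\<phi> \<in> borel_measurable borel" and C: "\<And>x. \<bar>\<phi> x\<bar> \<le> C"
    and "\<rho> > 0" "\<sigma> > 0" and circle: "\<rho>\<^sup>2 + \<sigma>\<^sup>2 = 1"
  shows "\<rho>\<^sup>2 * ln (\<integral>x. exp ((\<integral>y. \<phi> (\<rho> * x + \<sigma> * y) \<partial>std_normal) / \<rho>\<^sup>2) \<partial>std_normal)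
    \<le> ln (\<integral>x. exp (\<phi> x) \<partial>std_normal)"
proof -
  interpret N: prob_space std_normal by (rule prob_space_normal_density) simp
  let ?g = std_normal_density
  have g_pos: "?g x > 0" for x by (rule normal_density_pos) simp
  have g_cont: "continuous_on UNIV ?g"
    unfolding std_normal_density_def by (intro continuous_intros) auto
  define P where "P x = (\<integral>y. \<phi> (\<rho> * x + \<sigma> * y) \<partial>std_normal)" for x
  define \<psi> where "\<psi> x = P x / \<rho>\<^sup>2" for x
  have \<phi>_int: "integrable std_normal (\<lambda>y. \<phi> (a + b * y))" for a b
    using C by (intro N.integrable_const_bound[where B = C]) auto
  have P_bound: "\<bar>P x\<bar> \<le> C" for x
    unfolding P_def using C by (intro N.abs_expectation_le) auto
  have \<psi>_cont: "continuous_on UNIV \<psi>"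
    unfolding \<psi>_def P_def using \<open>\<rho> > 0\<close> C \<open>\<sigma> > 0\<close>
    by (intro continuous_on_divide continuous_on_mehler continuous_intros) auto
  then have [measurable]: "\<psi> \<in> borel_measurable borel"
    by (rule borel_measurable_continuous_onI)
  have \<psi>_bound: "\<bar>\<psi> x\<bar> \<le> C / \<rho>\<^sup>2" for x
    using P_bound[of x] by (simp add: \<psi>_def divide_right_mono)
  have e\<psi>_int: "integrable std_normal (\<lambda>x. exp (\<psi> x))"
    using \<psi>_bound by (intro N.integrable_const_bound[where B = "exp (C / \<rho>\<^sup>2)"]) (auto simp: abs_le_iff)
  define Z where "Z = (\<integral>x. exp (\<psi> x) \<partial>std_normal)"
  have "Z > 0" unfolding Z_def using e\<psi>_int by (rule N.expectation_greater) simp_all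
  \<comment> \<open>The law at which the maximum is attained; the maximum is \<rho>^2 ln Z.\<close>
  define f where "f z = exp (\<psi> z) / Z * ?g z" for z
  have f_cont: "continuous_on UNIV f"
    unfolding f_def using \<open>Z > 0\<close> by (intro continuous_intros \<psi>_cont g_cont) auto
  have f_pos: "f z > 0" for z
    unfolding f_def using \<open>Z > 0\<close> by (intro mult_pos_pos divide_pos_pos) (auto simp: g_pos)
  have f_one: "(\<integral>\<^sup>+z. f z \<partial>lborel) = 1"
  proof -
    have "(\<integral>\<^sup>+z. f z \<partial>lborel) = (\<integral>\<^sup>+z. exp (\<psi> z) / Z \<partial>std_normal)"
      using \<open>Z > 0\<close> by (subst nn_integral_density) (auto simp: f_def mult.commute simp flip: ennreal_mult')
    also have "\<dots> = ennreal (\<integral>z. exp (\<psi> z) / Z \<partial>std_normal)"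
      using e\<psi>_int \<open>Z > 0\<close> by (intro nn_integral_eq_integral) auto
    finally show ?thesis using \<open>Z > 0\<close> by (simp flip: Z_def)
  qed
  have g_one: "(\<integral>\<^sup>+z. ?g z \<partial>lborel) = 1"
    using N.emeasure_space_1 by (simp add: emeasure_density)
  obtain T where T: "\<And>x. (T has_real_derivative ?g x / f (T x)) (at x)"
    using monotone_transport[OF f_cont f_pos f_one g_cont _ g_one] by (metis normal_density_pos zero_less_one)
  have T_cont: "continuous_on A T" for A
    using T DERIV_isCont continuous_at_imp_continuous_on by blast
  have [measurable]: "T \<in> borel_measurable borel"
    by (rule borel_measurable_continuous_onI) (rule T_cont)
  define T' where "T' x = ?g x / f (T x)" for x
  have T'_cont: "continuous_on A T'" for A
    unfolding T'_def using f_pos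
    by (intro continuous_on_divide continuous_on_compose2[OF f_cont T_cont]
        continuous_on_subset[OF g_cont]) (auto simp: less_imp_neq[symmetric])
  have T'_pos: "T' x > 0" for x
    unfolding T'_def by (intro divide_pos_pos g_pos f_pos)
  \<comment> \<open>Without its last term, \<open>u x\<close> already has mean \<rho>^2 ln Z in
    \<open>y\<close>, for each \<open>x\<close>. The last term has mean zero and completes a square:
    by the formula for T', \<open>u x y\<close> equals \<phi>(q) + \<rho>^2 ln T'(x) + (p^2 - q^2)/2
    with p = \<rho> x + \<sigma> y and q = \<rho> T(x) + \<sigma> y. The square turns the Gaussian
    density at p into that at q.\<close>
  define u where "u x y = \<phi> (\<rho> * T x + \<sigma> * y) - \<rho>\<^sup>2 * (\<psi> (T x) - ln Z) + \<rho> * \<sigma> * y * (x - T x)" for x y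
  have [measurable]: "case_prod u \<in> borel_measurable (borel \<Otimes>\<^sub>M borel)"
    unfolding u_def by measurable
  define h where "h = (\<lambda>(x, y). exp (u x y) * (?g x * ?g y))"
  have [measurable]: "h \<in> borel_measurable (borel \<Otimes>\<^sub>M borel)"
    unfolding h_def by measurable
  then have [measurable]: "h \<in> borel_measurable borel"
    by (simp add: borel_prod)
  have id_int: "integrable std_normal (\<lambda>y. y)" "(\<integral>y. y \<partial>std_normal) = 0"
    using std_normal_moment_odd[of 0]
    by (auto simp: has_bochner_integral_iff integrable_density integral_density)
  define I where "I = (\<integral>x. exp (\<phi> x) \<partial>std_normal)"
  have e\<phi>_int: "integrable std_normal (\<lambda>x. exp (\<phi> x))"
    using C by (intro N.integrable_const_bound[where B = "exp C"]) (auto simp: abs_le_iff)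
  have "I > 0" unfolding I_def using e\<phi>_int by (rule N.expectation_greater) simp_all

  have "ennreal (exp (\<rho>\<^sup>2 * ln Z)) = (\<integral>\<^sup>+x. exp (\<rho>\<^sup>2 * ln Z) \<partial>std_normal)"
    using N.emeasure_space_1 by simp
  \<comment> \<open>Jensen's inequality in \<open>y\<close> only; \<open>x\<close> plays the part of
    a parameter.\<close>
  also have "\<dots> \<le> (\<integral>\<^sup>+x. \<integral>\<^sup>+y. exp (u x y) \<partial>std_normal \<partial>std_normal)"
  proof (rule nn_integral_mono)
    fix x
    have i: "integrable std_normal (u x)"
      unfolding u_def using id_int \<phi>_int
      by (intro Bochner_Integration.integrable_add Bochner_Integration.integrable_diff
          integrable_mult_left integrable_mult_right) auto
    have "(\<integral>y. u x y \<partial>std_normal) = P (T x) - \<rho>\<^sup>2 * (\<psi> (T x) - ln Z)"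
      unfolding u_def P_def using id_int \<phi>_int N.prob_space by simp
    also have "\<dots> = \<rho>\<^sup>2 * ln Z" using \<open>\<rho> > 0\<close> by (simp add: \<psi>_def right_diff_distrib)
    finally show "ennreal (exp (\<rho>\<^sup>2 * ln Z)) \<le> (\<integral>\<^sup>+y. exp (u x y) \<partial>std_normal)"
      using N.exp_expectation_le[OF i] by simp
  qed
  also have "\<dots> = (\<integral>\<^sup>+x. \<integral>\<^sup>+y. h (x, y) \<partial>lborel \<partial>lborel)"
    by (simp add: nn_integral_density h_def ennreal_mult' nn_integral_cmult[symmetric] mult_ac
        cong: nn_integral_cong)
  also have "\<dots> = (\<integral>\<^sup>+w. h w \<partial>lborel)"
    by (subst lborel.nn_integral_fst) (auto simp: lborel_prod)
  also have "\<dots> = (\<integral>\<^sup>+w. h w \<partial>distr lborel borel (\<lambda>(x, y). (\<rho> * x - \<sigma> * y, \<sigma> * x + \<rho> * y)))"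
    using lborel_distr_orthogonal[OF orthogonal_transformation_plane_rotation[OF circle]] by simp
  also have "\<dots> = (\<integral>\<^sup>+w. h (case w of (x, y) \<Rightarrow> (\<rho> * x - \<sigma> * y, \<sigma> * x + \<rho> * y)) \<partial>lborel)"
    by (subst nn_integral_distr) (auto simp: borel_prod[symmetric])
  also have "\<dots> = (\<integral>\<^sup>+y. \<integral>\<^sup>+x. h (\<rho> * x - \<sigma> * y, \<sigma> * x + \<rho> * y) \<partial>lborel \<partial>lborel)"
    unfolding lborel_prod[symmetric] by (subst lborel_pair.nn_integral_snd[symmetric]) auto
  also have "\<dots> \<le> (\<integral>\<^sup>+y. ennreal (?g y) * (\<integral>\<^sup>+x. exp (\<phi> x) * ?g x \<partial>lborel) \<partial>lborel)"
  proof (rule nn_integral_mono)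
    fix y
    \<comment> \<open>After the rotation, the argument of \<phi> is a function of \<open>x\<close>
      for each fixed \<open>y\<close>. Its derivative is \<rho>^2 T' + \<sigma>^2, because the two
      rotated coordinates have the derivatives \<rho> and \<sigma> in \<open>x\<close>. So it serves
      as a change of variables on the line.\<close>
    define \<Theta> where "\<Theta> x = \<rho> * T (\<rho> * x - \<sigma> * y) + \<sigma> * (\<sigma> * x + \<rho> * y)" for x
    define \<Theta>' where "\<Theta>' x = \<rho>\<^sup>2 * T' (\<rho> * x - \<sigma> * y) + \<sigma>\<^sup>2" for x
    have "(\<integral>\<^sup>+x. h (\<rho> * x - \<sigma> * y, \<sigma> * x + \<rho> * y) \<partial>lborel)
        \<le> (\<integral>\<^sup>+x. ennreal (?g y) * ennreal (exp (\<phi> (\<Theta> x)) * ?g (\<Theta> x) * \<Theta>' x) \<partial>lborel)"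
    proof (rule nn_integral_mono)
      fix x
      define a b where "a = \<rho> * x - \<sigma> * y" and "b = \<sigma> * x + \<rho> * y"
      have \<Theta>: "\<Theta> x = \<rho> * T a + \<sigma> * b" by (simp add: \<Theta>_def a_def b_def)
      have lnT': "ln (T' a) = - a\<^sup>2 / 2 + (T a)\<^sup>2 / 2 - (\<psi> (T a) - ln Z)"
        using \<open>Z > 0\<close> unfolding T'_def f_def std_normal_density_def
        by (simp add: ln_div ln_mult)
      have x: "x = \<rho> * a + \<sigma> * b"
      proof -
        have "\<rho> * a + \<sigma> * b = (\<rho>\<^sup>2 + \<sigma>\<^sup>2) * x"
          by (simp add: a_def b_def algebra_simps power2_eq_square)
        then show ?thesis using circle by simp
      qed
      have "a\<^sup>2 + b\<^sup>2 = (\<rho>\<^sup>2 + \<sigma>\<^sup>2) * (x\<^sup>2 + y\<^sup>2)"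
        by (simp add: a_def b_def algebra_simps power2_eq_square)
      then have ab: "a\<^sup>2 + b\<^sup>2 = x\<^sup>2 + y\<^sup>2" using circle by simp
      have gg: "?g a * ?g b = ?g x * ?g y"
        using ab by (simp add: std_normal_density_def mult_exp_exp add_divide_distrib[symmetric])
      have "x\<^sup>2 - (\<Theta> x)\<^sup>2 = \<rho>\<^sup>2 * (a\<^sup>2 - (T a)\<^sup>2) + 2 * \<rho> * \<sigma> * b * (a - T a)"
        unfolding \<Theta> by (subst x) (simp add: algebra_simps power2_eq_square)
      then have half: "(x\<^sup>2 - (\<Theta> x)\<^sup>2) / 2 = \<rho>\<^sup>2 * (a\<^sup>2 - (T a)\<^sup>2) / 2 + \<rho> * \<sigma> * b * (a - T a)"
        by simp
      have "u a b = \<phi> (\<Theta> x) + \<rho>\<^sup>2 * ln (T' a) + (x\<^sup>2 - (\<Theta> x)\<^sup>2) / 2"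
        unfolding u_def lnT' half by (simp add: \<Theta> field_simps)
      then have "exp (u a b) * ?g x = exp (\<phi> (\<Theta> x)) * (T' a powr \<rho>\<^sup>2) * (exp ((x\<^sup>2 - (\<Theta> x)\<^sup>2) / 2) * ?g x)"
        using T'_pos[of a] by (simp add: exp_add powr_def)
      also have "exp ((x\<^sup>2 - (\<Theta> x)\<^sup>2) / 2) * ?g x = ?g (\<Theta> x)"
        by (simp add: std_normal_density_def mult_exp_exp diff_divide_distrib)
      finally have "exp (u a b) * ?g x = exp (\<phi> (\<Theta> x)) * ?g (\<Theta> x) * (T' a powr \<rho>\<^sup>2)"
        by (simp add: mult_ac)
      \<comment> \<open>The transport produced the geometric mean of T' and 1 with weights \<rho>^2
        and \<sigma>^2; the Jacobian is their arithmetic mean.\<close>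
      also have "\<dots> \<le> exp (\<phi> (\<Theta> x)) * ?g (\<Theta> x) * \<Theta>' x"
      proof (rule mult_left_mono)
        have "\<rho>\<^sup>2 \<le> 1" using circle by (metis le_add_same_cancel1 zero_le_power2)
        then have "T' a powr \<rho>\<^sup>2 \<le> \<rho>\<^sup>2 * T' a + (1 - \<rho>\<^sup>2)"
          by (intro powr_le_weighted_mean T'_pos) auto
        then show "T' a powr \<rho>\<^sup>2 \<le> \<Theta>' x" using circle by (simp add: \<Theta>'_def a_def)
      qed simp
      finally have le: "exp (u a b) * ?g x \<le> exp (\<phi> (\<Theta> x)) * ?g (\<Theta> x) * \<Theta>' x" .
      have "h (a, b) \<le> ?g y * (exp (\<phi> (\<Theta> x)) * ?g (\<Theta> x) * \<Theta>' x)"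
        using mult_left_mono[OF le, of "?g y"] unfolding h_def prod.case gg by (simp add: mult_ac)
      then show "ennreal (h (\<rho> * x - \<sigma> * y, \<sigma> * x + \<rho> * y))
          \<le> ennreal (?g y) * ennreal (exp (\<phi> (\<Theta> x)) * ?g (\<Theta> x) * \<Theta>' x)"
        by (simp add: a_def b_def ennreal_mult'[symmetric] ennreal_leI)
    qed
    also have "\<dots> = ennreal (?g y) * (\<integral>\<^sup>+x. exp (\<phi> (\<Theta> x)) * ?g (\<Theta> x) * \<Theta>' x \<partial>lborel)"
    proof (rule nn_integral_cmult)
      have "continuous_on UNIV \<Theta>" "continuous_on UNIV \<Theta>'"
        unfolding \<Theta>_def \<Theta>'_def
        by (intro continuous_intros continuous_on_compose2[OF T_cont[of UNIV]]
            continuous_on_compose2[OF T'_cont[of UNIV]]; simp)+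
      then have [measurable]: "\<Theta> \<in> borel_measurable borel" "\<Theta>' \<in> borel_measurable borel"
        by (auto intro: borel_measurable_continuous_onI)
      show "(\<lambda>x. ennreal (exp (\<phi> (\<Theta> x)) * ?g (\<Theta> x) * \<Theta>' x)) \<in> borel_measurable lborel"
        by measurable
    qed
    also have "\<dots> \<le> ennreal (?g y) * (\<integral>\<^sup>+x. exp (\<phi> x) * ?g x \<partial>lborel)"
    proof (intro mult_left_mono nn_integral_substitution_le[where f = "\<lambda>x. exp (\<phi> x) * ?g x"])
      show "(\<Theta> has_real_derivative \<Theta>' x) (at x)" for x
        unfolding \<Theta>_def \<Theta>'_def T'_def
        by (auto intro!: derivative_eq_intros DERIV_chain2[OF T] simp: power2_eq_square)
      show "continuous_on UNIV \<Theta>'"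
        unfolding \<Theta>'_def
        by (intro continuous_intros continuous_on_compose2[OF T'_cont[of UNIV]]) auto
      show "0 \<le> \<Theta>' x" for x
        using T'_pos by (auto simp: \<Theta>'_def less_imp_le)
    qed auto
    finally show "(\<integral>\<^sup>+x. h (\<rho> * x - \<sigma> * y, \<sigma> * x + \<rho> * y) \<partial>lborel)
        \<le> ennreal (?g y) * (\<integral>\<^sup>+x. exp (\<phi> x) * ?g x \<partial>lborel)" .
  qed
  also have "\<dots> = (\<integral>\<^sup>+x. exp (\<phi> x) * ?g x \<partial>lborel)"
    by (subst nn_integral_multc) (simp_all add: g_one)
  also have "\<dots> = (\<integral>\<^sup>+x. exp (\<phi> x) \<partial>std_normal)"
    by (subst nn_integral_density) (auto simp: mult.commute ennreal_mult')
  also have "\<dots> = ennreal I"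
    unfolding I_def using e\<phi>_int by (intro nn_integral_eq_integral) auto
  finally have "exp (\<rho>\<^sup>2 * ln Z) \<le> I" using \<open>I > 0\<close> by simp
  then have "\<rho>\<^sup>2 * ln Z \<le> ln I" using \<open>I > 0\<close> by (simp add: ln_ge_iff)
  then show ?thesis by (simp add: Z_def I_def \<psi>_def P_def)
qed

section \<open>Tensorisation\<close>

text \<open>The bound is required on the space only, because on products \<open>Pi\<^sub>M\<close>
  the values at functions that are not extensional are arbitrary. Boundedness makes all exponential
  moments finite and positive.\<close>

definition bdd_measurable :: "'a measure \<Rightarrow> ('a \<Rightarrow> real) set" where
  "bdd_measurable M = {\<phi> \<in> borel_measurable M. \<exists>C. \<forall>x\<in>space M. \<bar>\<phi> x\<bar> \<le> C}"

lemma bdd_measurableI: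
  "\<phi> \<in> borel_measurable M \<Longrightarrow> (\<And>x. x \<in> space M \<Longrightarrow> \<bar>\<phi> x\<bar> \<le> C) \<Longrightarrow> \<phi> \<in> bdd_measurable M"
  by (auto simp: bdd_measurable_def)

lemma bdd_measurableE:
  assumes "\<phi> \<in> bdd_measurable M"
  obtains C where "\<And>x. x \<in> space M \<Longrightarrow> \<bar>\<phi> x\<bar> \<le> C"
  using assms by (auto simp: bdd_measurable_def)

lemma bdd_measurableD [measurable_dest]: "\<phi> \<in> bdd_measurable M \<Longrightarrow> \<phi> \<in> borel_measurable M"
  by (simp add: bdd_measurable_def)

lemma bdd_measurable_compose:
  assumes "\<phi> \<in> bdd_measurable M" "h \<in> N \<rightarrow>\<^sub>M M"
  shows "(\<lambda>x. \<phi> (h x)) \<in> bdd_measurable N"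
proof -
  obtain C where "\<And>x. x \<in> space M \<Longrightarrow> \<bar>\<phi> x\<bar> \<le> C"
    using bdd_measurableE[OF assms(1)] by blast
  moreover have "(\<lambda>x. \<phi> (h x)) \<in> borel_measurable N"
    using assms by (auto dest!: bdd_measurableD)
  ultimately show ?thesis
    using measurable_space[OF assms(2)] by (intro bdd_measurableI[where C = C]) auto
qed

lemma bdd_measurable_cdiv:
  assumes "\<phi> \<in> bdd_measurable M"
  shows "(\<lambda>x. \<phi> x / (c::real)) \<in> bdd_measurable M"
proof -
  obtain C where "\<And>x. x \<in> space M \<Longrightarrow> \<bar>\<phi> x\<bar> \<le> C" using bdd_measurableE[OF assms] by blast
  then show ?thesis
    using assms by (intro bdd_measurableI[where C = "C / \<bar>c\<bar>"]) (auto dest: bdd_measurableD intro: divide_right_mono)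
qed

lemma bdd_measurable_exp:
  assumes "\<phi> \<in> bdd_measurable M"
  shows "(\<lambda>x. exp (\<phi> x)) \<in> bdd_measurable M"
proof -
  obtain C where "\<And>x. x \<in> space M \<Longrightarrow> \<bar>\<phi> x\<bar> \<le> C" using bdd_measurableE[OF assms] by blast
  then show ?thesis
    using assms by (intro bdd_measurableI[where C = "exp C"]) (auto dest: bdd_measurableD simp: abs_le_iff)
qed

lemma (in prob_space) integrable_bdd_measurable:
  assumes "\<phi> \<in> bdd_measurable M"
  shows "integrable M \<phi>"
proof -
  obtain C where "\<And>x. x \<in> space M \<Longrightarrow> \<bar>\<phi> x\<bar> \<le> C" using bdd_measurableE[OF assms] by blast
  then show ?thesis
    using assms by (intro integrable_const_bound[where B = C]) (auto dest: bdd_measurableD)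
qed

lemma (in prob_space) bdd_measurable_integral:
  assumes "case_prod \<phi> \<in> bdd_measurable (N \<Otimes>\<^sub>M M)"
  shows "(\<lambda>x. \<integral>y. \<phi> x y \<partial>M) \<in> bdd_measurable N"
proof -
  obtain C where C: "\<And>z. z \<in> space (N \<Otimes>\<^sub>M M) \<Longrightarrow> \<bar>case_prod \<phi> z\<bar> \<le> C"
    using assms by (metis bdd_measurableE)
  have [measurable]: "case_prod \<phi> \<in> borel_measurable (N \<Otimes>\<^sub>M M)"
    using assms by (rule bdd_measurableD)
  show ?thesis
  proof (rule bdd_measurableI)
    fix x assume x: "x \<in> space N"
    show "\<bar>\<integral>y. \<phi> x y \<partial>M\<bar> \<le> C"
      using C[of "(x, _)"] x by (intro abs_expectation_le) (auto simp: space_pair_measure)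
  qed measurable
qed

section \<open>Logarithmic moment generating functions\<close>

definition log_mgf :: "'a measure \<Rightarrow> ('a \<Rightarrow> real) \<Rightarrow> real" where
  "log_mgf M \<phi> = ln (\<integral>x. exp (\<phi> x) \<partial>M)"

lemma (in prob_space)
  assumes "\<phi> \<in> bdd_measurable M"
  shows expectation_exp_pos: "0 < expectation (\<lambda>x. exp (\<phi> x))"
    and exp_log_mgf: "exp (log_mgf M \<phi>) = expectation (\<lambda>x. exp (\<phi> x))"
proof -
  have "integrable M (\<lambda>x. exp (\<phi> x))"
    using assms by (intro integrable_bdd_measurable bdd_measurable_exp)
  then show *: "0 < expectation (\<lambda>x. exp (\<phi> x))"
    by (rule expectation_greater) simp
  show "exp (log_mgf M \<phi>) = expectation (\<lambda>x. exp (\<phi> x))"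
    using * by (simp add: log_mgf_def)
qed

lemma (in prob_space) log_mgf_mono:
  assumes "\<phi> \<in> bdd_measurable M" "\<psi> \<in> bdd_measurable M" "\<And>x. x \<in> space M \<Longrightarrow> \<phi> x \<le> \<psi> x"
  shows "log_mgf M \<phi> \<le> log_mgf M \<psi>"
  unfolding log_mgf_def using assms
  by (subst ln_le_cancel_iff)
    (auto intro!: integral_mono integrable_bdd_measurable bdd_measurable_exp expectation_exp_pos)

lemma (in prob_space) log_mgf_bound:
  assumes "\<phi> \<in> borel_measurable M" "\<And>x. x \<in> space M \<Longrightarrow> \<bar>\<phi> x\<bar> \<le> C"
  shows "\<bar>log_mgf M \<phi>\<bar> \<le> C"
proof -
  have C: "log_mgf M (\<lambda>_. c) = c" for c by (simp add: log_mgf_def prob_space)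
  have b: "\<phi> \<in> bdd_measurable M" "(\<lambda>_. c) \<in> bdd_measurable M" for c
    using assms by (auto intro: bdd_measurableI)
  have "log_mgf M \<phi> \<le> log_mgf M (\<lambda>_. C)" "log_mgf M (\<lambda>_. - C) \<le> log_mgf M \<phi>"
    using assms(2) by (intro log_mgf_mono b; simp add: abs_le_iff minus_le_iff)+
  then show ?thesis by (simp add: C)
qed

lemma (in prob_space) bdd_measurable_log_mgf:
  assumes "case_prod \<phi> \<in> bdd_measurable (N \<Otimes>\<^sub>M M)"
  shows "(\<lambda>x. log_mgf M (\<phi> x)) \<in> bdd_measurable N"
proof -
  obtain C where C: "\<And>z. z \<in> space (N \<Otimes>\<^sub>M M) \<Longrightarrow> \<bar>case_prod \<phi> z\<bar> \<le> C"
    using assms by (metis bdd_measurableE)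
  have [measurable]: "case_prod \<phi> \<in> borel_measurable (N \<Otimes>\<^sub>M M)"
    using assms by (rule bdd_measurableD)
  show ?thesis
  proof (rule bdd_measurableI)
    fix x assume x: "x \<in> space N"
    show "\<bar>log_mgf M (\<phi> x)\<bar> \<le> C"
      using C[of "(x, _)"] x by (intro log_mgf_bound) (auto simp: space_pair_measure)
  qed (unfold log_mgf_def, measurable)
qed

lemma bdd_measurable_section:
  assumes "case_prod \<phi> \<in> bdd_measurable (N \<Otimes>\<^sub>M M)" "x \<in> space N"
  shows "\<phi> x \<in> bdd_measurable M"
  using bdd_measurable_compose[OF assms(1), of "\<lambda>y. (x, y)" M] assms(2) by simp

lemma log_mgf_distr:
  assumes "h \<in> M \<rightarrow>\<^sub>M N" "\<phi> \<in> borel_measurable N"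
  shows "log_mgf (distr M N h) \<phi> = log_mgf M (\<lambda>x. \<phi> (h x))"
  unfolding log_mgf_def using assms by (subst integral_distr) auto

lemma log_mgf_cong: "(\<And>x. x \<in> space M \<Longrightarrow> \<phi> x = \<psi> x) \<Longrightarrow> log_mgf M \<phi> = log_mgf M \<psi>"
  unfolding log_mgf_def by (intro arg_cong[where f = ln] Bochner_Integration.integral_cong) auto

lemma log_mgf_pair:
  assumes "prob_space M" "prob_space N" "case_prod \<phi> \<in> bdd_measurable (M \<Otimes>\<^sub>M N)"
  shows "log_mgf (M \<Otimes>\<^sub>M N) (case_prod \<phi>) = log_mgf M (\<lambda>x. log_mgf N (\<phi> x))"
proof -
  interpret M: prob_space M by fact
  interpret N: prob_space N by fact
  interpret MN: pair_prob_space M N ..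
  have "(\<integral>z. exp (case_prod \<phi> z) \<partial>(M \<Otimes>\<^sub>M N)) = (\<integral>x. (\<integral>y. exp (\<phi> x y) \<partial>N) \<partial>M)"
    using MN.integral_fst'[OF MN.integrable_bdd_measurable[OF bdd_measurable_exp[OF assms(3)]]] by simp
  also have "\<dots> = (\<integral>x. exp (log_mgf N (\<phi> x)) \<partial>M)"
    using bdd_measurable_section[OF assms(3)] by (intro Bochner_Integration.integral_cong) (simp_all add: N.exp_log_mgf)
  finally show ?thesis by (simp add: log_mgf_def)
qed

text \<open>Convexity of \<open>log_mgf\<close>, that is, Hoelder's inequality for a continuous
  family. Once each function is normalised by its own \<open>log_mgf\<close>, Jensen's inequality in
  \<open>y\<close> and Fubini bound the exponential integral by 1.\<close>

lemma log_mgf_integral_le: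
  assumes "prob_space M" "prob_space N" and \<phi>: "case_prod \<phi> \<in> bdd_measurable (N \<Otimes>\<^sub>M M)"
  shows "log_mgf M (\<lambda>x. \<integral>y. \<phi> y x \<partial>N) \<le> (\<integral>y. log_mgf M (\<phi> y) \<partial>N)"
proof -
  interpret M: prob_space M by fact
  interpret N: prob_space N by fact
  interpret NM: pair_prob_space N M ..
  have [measurable]: "case_prod \<phi> \<in> borel_measurable (N \<Otimes>\<^sub>M M)"
    using \<phi> by (rule bdd_measurableD)
  have swap: "(\<lambda>(x, y). \<phi> y x) \<in> bdd_measurable (M \<Otimes>\<^sub>M N)"
    using bdd_measurable_compose[OF \<phi>, of "\<lambda>(x, y). (y, x)" "M \<Otimes>\<^sub>M N"] by (simp add: case_prod_beta')
  define w where "w y = log_mgf M (\<phi> y)" for y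
  define D where "D = (\<integral>y. w y \<partial>N)"
  define F where "F x = (\<integral>y. \<phi> y x \<partial>N)" for x
  have w: "w \<in> bdd_measurable N"
    unfolding w_def using \<phi> by (rule M.bdd_measurable_log_mgf)
  then have [measurable]: "w \<in> borel_measurable N" by (rule bdd_measurableD)
  have F: "F \<in> bdd_measurable M"
    unfolding F_def using N.bdd_measurable_integral[OF swap] .
  have "(\<integral>\<^sup>+x. exp (F x - D) \<partial>M) \<le> (\<integral>\<^sup>+x. \<integral>\<^sup>+y. exp (\<phi> y x - w y) \<partial>N \<partial>M)"
  proof (rule nn_integral_mono)
    fix x assume x: "x \<in> space M"
    have i: "integrable N w" "integrable N (\<lambda>y. \<phi> y x)"
      using w bdd_measurable_section[OF swap x] by (auto intro: N.integrable_bdd_measurable)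
    then have "(\<integral>y. \<phi> y x - w y \<partial>N) = F x - D" by (simp add: F_def D_def)
    then show "ennreal (exp (F x - D)) \<le> (\<integral>\<^sup>+y. exp (\<phi> y x - w y) \<partial>N)"
      using N.exp_expectation_le[of "\<lambda>y. \<phi> y x - w y"] i by simp
  qed
  also have "\<dots> = (\<integral>\<^sup>+y. \<integral>\<^sup>+x. exp (\<phi> y x - w y) \<partial>M \<partial>N)"
    by (rule NM.Fubini') simp
  also have "\<dots> = (\<integral>\<^sup>+y. 1 \<partial>N)"
  proof (rule nn_integral_cong)
    fix y assume y: "y \<in> space N"
    have s: "\<phi> y \<in> bdd_measurable M" using \<phi> y by (rule bdd_measurable_section)
    have i: "integrable M (\<lambda>x. exp (\<phi> y x))"
      using s by (intro M.integrable_bdd_measurable bdd_measurable_exp)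
    have "(\<integral>\<^sup>+x. exp (\<phi> y x - w y) \<partial>M) = ennreal (\<integral>x. exp (\<phi> y x) / exp (w y) \<partial>M)"
      unfolding exp_diff using i by (intro nn_integral_eq_integral) auto
    also have "\<dots> = 1"
      using M.expectation_exp_pos[OF s] by (simp add: w_def M.exp_log_mgf[OF s])
    finally show "(\<integral>\<^sup>+x. exp (\<phi> y x - w y) \<partial>M) = 1" .
  qed
  also have "\<dots> = 1" by (simp add: N.emeasure_space_1)
  also have "(\<integral>\<^sup>+x. exp (F x - D) \<partial>M) = ennreal (\<integral>x. exp (F x) / exp D \<partial>M)"
    unfolding exp_diff using F
    by (intro nn_integral_eq_integral) (auto intro!: M.integrable_bdd_measurable bdd_measurable_exp bdd_measurable_cdiv)
  finally have "(\<integral>x. exp (F x) \<partial>M) / exp D \<le> 1"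
    by (simp add: ennreal_le_1)
  then have "(\<integral>x. exp (F x) \<partial>M) \<le> exp D" by simp
  then have "log_mgf M F \<le> D"
    unfolding log_mgf_def using M.expectation_exp_pos[OF F] ln_le_cancel_iff[of "\<integral>x. exp (F x) \<partial>M" "exp D"] by simp
  then show ?thesis by (simp add: D_def F_def[abs_def] w_def[abs_def])
qed

text \<open>If \<open>X\<close> has law \<open>\<mu>\<close> and \<open>Y\<close> is independent with law \<open>N\<close>, then by duality this
  condition says that the relative entropy with respect to \<open>M\<close> of the law of \<open>f X Y\<close> is at
  most \<open>r\<close> times that of \<open>\<mu>\<close>.\<close>

definition entropy_contracting :: "'a measure \<Rightarrow> 'b measure \<Rightarrow> ('a \<Rightarrow> 'b \<Rightarrow> 'a) \<Rightarrow> real \<Rightarrow> bool" where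
  "entropy_contracting M N f r \<longleftrightarrow> prob_space M \<and> prob_space N \<and> case_prod f \<in> M \<Otimes>\<^sub>M N \<rightarrow>\<^sub>M M \<and>
     (\<forall>\<phi>\<in>bdd_measurable M. r * log_mgf M (\<lambda>x. (\<integral>y. \<phi> (f x y) \<partial>N) / r) \<le> log_mgf M \<phi>)"

lemma entropy_contractingD:
  "entropy_contracting M N f r \<Longrightarrow> \<phi> \<in> bdd_measurable M \<Longrightarrow>
    r * log_mgf M (\<lambda>x. (\<integral>y. \<phi> (f x y) \<partial>N) / r) \<le> log_mgf M \<phi>"
  by (simp add: entropy_contracting_def)

text \<open>Pulling a test function back along \<open>h\<close> preserves both sides, since
  \<open>h\<close> and \<open>k\<close> carry the measures along and intertwine the two operations.
  This serves three times: for scaling Gaussians, for adding a factor to a product, and for passing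
  from functions to vectors.\<close>

lemma entropy_contracting_distr:
  assumes EC: "entropy_contracting M N f r"
    and h: "h \<in> M \<rightarrow>\<^sub>M M'" and k: "k \<in> N \<rightarrow>\<^sub>M N'"
    and f': "case_prod f' \<in> M' \<Otimes>\<^sub>M N' \<rightarrow>\<^sub>M M'"
    and M': "distr M M' h = M'" and N': "distr N N' k = N'"
    and eq: "\<And>x y. x \<in> space M \<Longrightarrow> y \<in> space N \<Longrightarrow> f' (h x) (k y) = h (f x y)"
  shows "entropy_contracting M' N' f' r"
  unfolding entropy_contracting_def
proof (intro conjI ballI f')
  have M: "prob_space M" and N: "prob_space N" and f [measurable]: "case_prod f \<in> M \<Otimes>\<^sub>M N \<rightarrow>\<^sub>M M"
    using EC by (auto simp: entropy_contracting_def)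
  show pM': "prob_space M'" using prob_space.prob_space_distr[OF M h] by (simp add: M')
  show pN': "prob_space N'" using prob_space.prob_space_distr[OF N k] by (simp add: N')
  interpret N': prob_space N' by fact
  fix \<phi> assume \<phi>: "\<phi> \<in> bdd_measurable M'"
  have "(\<lambda>z. \<phi> (case_prod f' z)) \<in> bdd_measurable (M' \<Otimes>\<^sub>M N')"
    using bdd_measurable_compose[OF \<phi> f'] .
  then have P: "case_prod (\<lambda>x y. \<phi> (f' x y)) \<in> bdd_measurable (M' \<Otimes>\<^sub>M N')"
    by (simp add: case_prod_beta')
  have "log_mgf M' (\<lambda>x. (\<integral>y. \<phi> (f' x y) \<partial>N') / r) = log_mgf (distr M M' h) (\<lambda>x. (\<integral>y. \<phi> (f' x y) \<partial>N') / r)"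
    by (simp add: M')
  also have "\<dots> = log_mgf M (\<lambda>x. (\<integral>y. \<phi> (f' (h x) y) \<partial>N') / r)"
    using h by (intro log_mgf_distr bdd_measurableD bdd_measurable_cdiv N'.bdd_measurable_integral[OF P])
  also have "\<dots> = log_mgf M (\<lambda>x. (\<integral>y. \<phi> (h (f x y)) \<partial>N) / r)"
  proof (rule log_mgf_cong)
    fix x assume x: "x \<in> space M"
    have "(\<integral>y. \<phi> (f' (h x) y) \<partial>N') = (\<integral>y. \<phi> (f' (h x) y) \<partial>distr N N' k)" by (simp add: N')
    also have "\<dots> = (\<integral>y. \<phi> (f' (h x) (k y)) \<partial>N)"
      using k bdd_measurable_section[OF P measurable_space[OF h x]]
      by (intro integral_distr) (auto dest: bdd_measurableD)
    also have "\<dots> = (\<integral>y. \<phi> (h (f x y)) \<partial>N)"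
      using eq x by (intro Bochner_Integration.integral_cong) auto
    finally show "(\<integral>y. \<phi> (f' (h x) y) \<partial>N') / r = (\<integral>y. \<phi> (h (f x y)) \<partial>N) / r" by simp
  qed
  finally have "r * log_mgf M' (\<lambda>x. (\<integral>y. \<phi> (f' x y) \<partial>N') / r) \<le> log_mgf M (\<lambda>x. \<phi> (h x))"
    using entropy_contractingD[OF EC bdd_measurable_compose[OF \<phi> h]] by simp
  also have "\<dots> = log_mgf M' \<phi>"
    using log_mgf_distr[OF h bdd_measurableD[OF \<phi>]] by (simp add: M')
  finally show "r * log_mgf M' (\<lambda>x. (\<integral>y. \<phi> (f' x y) \<partial>N') / r) \<le> log_mgf M' \<phi>" .
qed

text \<open>The rate does not deteriorate with the dimension. For fixed \<open>x1\<close> the second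
  contraction is applied to the average of \<phi> over \<open>y1\<close>;
  \<open>log_mgf_integral_le\<close> then pulls this average out of the logarithm. What remains is
  the first contraction for the partial function \<open>w\<close>.\<close>

lemma entropy_contracting_pair:
  assumes "entropy_contracting M1 N1 f1 r" "entropy_contracting M2 N2 f2 r" "r > 0"
  shows "entropy_contracting (M1 \<Otimes>\<^sub>M M2) (N1 \<Otimes>\<^sub>M N2) (\<lambda>(x1, x2) (y1, y2). (f1 x1 y1, f2 x2 y2)) r"
    (is "entropy_contracting ?M ?N ?f r")
proof -
  note [measurable_dest] = bdd_measurableD
  interpret M1: prob_space M1 using assms(1) by (simp add: entropy_contracting_def)
  interpret M2: prob_space M2 using assms(2) by (simp add: entropy_contracting_def)
  interpret N1: prob_space N1 using assms(1) by (simp add: entropy_contracting_def)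
  interpret N2: prob_space N2 using assms(2) by (simp add: entropy_contracting_def)
  interpret M: pair_prob_space M1 M2 ..
  interpret N: pair_prob_space N1 N2 ..
  have [measurable]: "case_prod f1 \<in> M1 \<Otimes>\<^sub>M N1 \<rightarrow>\<^sub>M M1" "case_prod f2 \<in> M2 \<Otimes>\<^sub>M N2 \<rightarrow>\<^sub>M M2"
    using assms by (auto simp: entropy_contracting_def)
  have f1_space: "f1 x y \<in> space M1" if "x \<in> space M1" "y \<in> space N1" for x y
    using measurable_space[of "case_prod f1" "M1 \<Otimes>\<^sub>M N1" M1 "(x, y)"] that by (simp add: space_pair_measure)
  have f_meas: "case_prod ?f \<in> ?M \<Otimes>\<^sub>M ?N \<rightarrow>\<^sub>M ?M"
    by (simp add: case_prod_beta')
  have "r * log_mgf ?M (\<lambda>x. (\<integral>y. \<phi> (?f x y) \<partial>?N) / r) \<le> log_mgf ?M \<phi>"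
    if \<phi>: "\<phi> \<in> bdd_measurable ?M" for \<phi>
  proof -
    define w where "w x1 = log_mgf M2 (\<lambda>x2. \<phi> (x1, x2))" for x1
    have w: "w \<in> bdd_measurable M1"
      unfolding w_def by (rule M2.bdd_measurable_log_mgf) (simp add: \<phi>)
    define A where "A x1 x2 = (\<integral>y1. \<phi> (f1 x1 y1, x2) \<partial>N1)" for x1 x2
    define B where "B x1 x2 = (\<integral>y2. A x1 (f2 x2 y2) \<partial>N2)" for x1 x2
    have A: "A x1 \<in> bdd_measurable M2" if "x1 \<in> space M1" for x1
      unfolding A_def using that
      by (intro N1.bdd_measurable_integral)
        (simp add: case_prod_beta' bdd_measurable_compose[OF \<phi>])
    have B2: "case_prod B \<in> bdd_measurable ?M"
    proof -
      have "(\<lambda>(z, y2). A (fst z) (f2 (snd z) y2)) \<in> bdd_measurable (?M \<Otimes>\<^sub>M N2)"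
        unfolding A_def case_prod_beta'
        by (intro N1.bdd_measurable_integral)
          (simp add: case_prod_beta' bdd_measurable_compose[OF \<phi>])
      from N2.bdd_measurable_integral[OF this] show ?thesis
        by (simp add: B_def case_prod_beta')
    qed
    have B: "(\<integral>y. \<phi> (?f (x1, x2) y) \<partial>?N) = B x1 x2" if "x1 \<in> space M1" "x2 \<in> space M2" for x1 x2
    proof -
      have b: "(\<lambda>(y1, y2). \<phi> (f1 x1 y1, f2 x2 y2)) \<in> bdd_measurable ?N"
        using that by (simp add: case_prod_beta' bdd_measurable_compose[OF \<phi>])
      have "(\<integral>y. \<phi> (?f (x1, x2) y) \<partial>?N) = (\<integral>(y1, y2). \<phi> (f1 x1 y1, f2 x2 y2) \<partial>?N)"
        by (simp add: case_prod_beta')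
      also have "\<dots> = B x1 x2"
        unfolding B_def A_def
        using N.integral_snd[OF N.integrable_bdd_measurable[OF b]] by simp
      finally show ?thesis .
    qed
    have "log_mgf ?M (\<lambda>x. (\<integral>y. \<phi> (?f x y) \<partial>?N) / r) = log_mgf ?M (case_prod (\<lambda>x1 x2. B x1 x2 / r))"
      using B by (intro log_mgf_cong) (auto simp: space_pair_measure)
    also have "\<dots> = log_mgf M1 (\<lambda>x1. log_mgf M2 (\<lambda>x2. B x1 x2 / r))"
      using bdd_measurable_cdiv[OF B2, of r]
      by (intro log_mgf_pair M1.prob_space_axioms M2.prob_space_axioms) (simp add: case_prod_beta')
    also have "\<dots> \<le> log_mgf M1 (\<lambda>x1. (\<integral>y1. w (f1 x1 y1) \<partial>N1) / r)"
    proof (rule M1.log_mgf_mono)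
      show "(\<lambda>x1. log_mgf M2 (\<lambda>x2. B x1 x2 / r)) \<in> bdd_measurable M1"
        using bdd_measurable_cdiv[OF B2, of r]
        by (intro M2.bdd_measurable_log_mgf) (simp add: case_prod_beta')
      show "(\<lambda>x1. (\<integral>y1. w (f1 x1 y1) \<partial>N1) / r) \<in> bdd_measurable M1"
        by (intro bdd_measurable_cdiv N1.bdd_measurable_integral)
          (simp add: case_prod_beta' bdd_measurable_compose[OF w])
      fix x1 assume x1: "x1 \<in> space M1"
      have "r * log_mgf M2 (\<lambda>x2. B x1 x2 / r) \<le> log_mgf M2 (A x1)"
        using entropy_contractingD[OF assms(2) A[OF x1]] by (simp add: B_def)
      also have "\<dots> \<le> (\<integral>y1. log_mgf M2 (\<lambda>x2. \<phi> (f1 x1 y1, x2)) \<partial>N1)"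
        unfolding A_def
        by (rule log_mgf_integral_le[OF M2.prob_space_axioms N1.prob_space_axioms])
          (use x1 in \<open>simp add: case_prod_beta' bdd_measurable_compose[OF \<phi>]\<close>)
      finally show "log_mgf M2 (\<lambda>x2. B x1 x2 / r) \<le> (\<integral>y1. w (f1 x1 y1) \<partial>N1) / r"
        using \<open>r > 0\<close> by (simp add: w_def field_simps)
    qed
    finally have "r * log_mgf ?M (\<lambda>x. (\<integral>y. \<phi> (?f x y) \<partial>?N) / r)
        \<le> r * log_mgf M1 (\<lambda>x1. (\<integral>y1. w (f1 x1 y1) \<partial>N1) / r)"
      using \<open>r > 0\<close> by simp
    also have "\<dots> \<le> log_mgf M1 w"
      using entropy_contractingD[OF assms(1) w] .
    also have "\<dots> = log_mgf ?M \<phi>"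
      using log_mgf_pair[OF M1.prob_space_axioms M2.prob_space_axioms, of "\<lambda>x1 x2. \<phi> (x1, x2)"] \<phi>
      by (simp add: w_def[abs_def])
    finally show ?thesis .
  qed
  then show ?thesis
    unfolding entropy_contracting_def
    using f_meas M.prob_space_axioms N.prob_space_axioms by blast
qed

lemma entropy_contracting_PiM:
  fixes I :: "'i set"
  assumes "entropy_contracting M N f r" "r > 0" "finite I"
  shows "entropy_contracting (Pi\<^sub>M I (\<lambda>_. M)) (Pi\<^sub>M I (\<lambda>_. N)) (\<lambda>x y. \<lambda>i\<in>I. f (x i) (y i)) r"
  using \<open>finite I\<close>
proof induction
  case empty
  have M: "prob_space M" and N: "prob_space N" using assms(1) by (auto simp: entropy_contracting_def)
  interpret PM: prob_space "Pi\<^sub>M ({} :: 'i set) (\<lambda>_. M)" by (rule prob_space_PiM) simp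
  interpret PN: prob_space "Pi\<^sub>M ({} :: 'i set) (\<lambda>_. N)" by (rule prob_space_PiM) simp
  \<comment> \<open>The empty product is a one-point space, where \<open>log_mgf\<close> is
    evaluation; both sides of the contraction are then the value of \<phi> there.\<close>
  have "log_mgf (Pi\<^sub>M ({} :: 'i set) (\<lambda>_. M)) \<phi> = \<phi> (\<lambda>_. undefined)" for \<phi>
  proof -
    have "PM.expectation (\<lambda>x. exp (\<phi> x)) = PM.expectation (\<lambda>_. exp (\<phi> (\<lambda>_. undefined)))"
      by (rule Bochner_Integration.integral_cong) (auto simp: space_PiM)
    then show ?thesis by (simp add: log_mgf_def PM.prob_space)
  qed
  then show ?case
    using \<open>r > 0\<close> PM.prob_space_axioms PN.prob_space_axioms PN.prob_space
    by (simp add: entropy_contracting_def restrict_def)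
next
  case (insert i I)
  have M: "prob_space M" and N: "prob_space N" and [measurable]: "case_prod f \<in> M \<Otimes>\<^sub>M N \<rightarrow>\<^sub>M M"
    using assms(1) by (auto simp: entropy_contracting_def)
  show ?case
  proof (rule entropy_contracting_distr[OF entropy_contracting_pair[OF assms(1) insert.IH \<open>r > 0\<close>]])
    show "distr (M \<Otimes>\<^sub>M Pi\<^sub>M I (\<lambda>_. M)) (Pi\<^sub>M (insert i I) (\<lambda>_. M)) (\<lambda>(x, X). X(i := x)) = Pi\<^sub>M (insert i I) (\<lambda>_. M)"
      by (rule distr_pair_PiM_eq_PiM) (rule M)+
    show "distr (N \<Otimes>\<^sub>M Pi\<^sub>M I (\<lambda>_. N)) (Pi\<^sub>M (insert i I) (\<lambda>_. N)) (\<lambda>(x, X). X(i := x)) = Pi\<^sub>M (insert i I) (\<lambda>_. N)"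
      by (rule distr_pair_PiM_eq_PiM) (rule N)+
    show "(\<lambda>(x, y). \<lambda>j\<in>insert i I. f (x j) (y j))
        \<in> Pi\<^sub>M (insert i I) (\<lambda>_. M) \<Otimes>\<^sub>M Pi\<^sub>M (insert i I) (\<lambda>_. N) \<rightarrow>\<^sub>M Pi\<^sub>M (insert i I) (\<lambda>_. M)"
      unfolding case_prod_beta'
    proof (rule measurable_restrict)
      fix j assume j: "j \<in> insert i I"
      let ?P = "Pi\<^sub>M (insert i I) (\<lambda>_. M) \<Otimes>\<^sub>M Pi\<^sub>M (insert i I) (\<lambda>_. N)"
      have "(\<lambda>z. (fst z j, snd z j)) \<in> ?P \<rightarrow>\<^sub>M M \<Otimes>\<^sub>M N"
        using j by (intro measurable_Pair measurable_compose[OF measurable_fst]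
            measurable_compose[OF measurable_snd] measurable_component_singleton)
      from measurable_compose[OF this, of "case_prod f" M]
      show "(\<lambda>z. f (fst z j) (snd z j)) \<in> ?P \<rightarrow>\<^sub>M M" by simp
    qed
  qed (use insert.hyps in \<open>auto simp: fun_eq_iff\<close>)
qed

section \<open>Gaussian measures on vectors\<close>

text \<open>The bridge between \<open>Pi\<^sub>M\<close>, where tensorisation is proved, and the
  vector types of the equation. Applied twice, it handles planar particles without flattening them
  to 2n coordinates.\<close>

definition vec_measure :: "'a::euclidean_space measure \<Rightarrow> ('a ^ 'n::finite) measure" where
  "vec_measure M = distr (Pi\<^sub>M UNIV (\<lambda>_. M)) borel vec_lambda"

lemma sets_vec_measure [simp, measurable_cong]: "sets (vec_measure M) = sets borel"
  by (simp add: vec_measure_def)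

lemma measurable_vec_lambda:
  assumes "sets M = sets (borel :: 'a::euclidean_space measure)"
  shows "(vec_lambda :: ('n::finite \<Rightarrow> 'a) \<Rightarrow> 'a ^ 'n) \<in> Pi\<^sub>M UNIV (\<lambda>_. M) \<rightarrow>\<^sub>M borel"
proof (subst borel_measurable_euclidean_space, rule ballI)
  note [measurable_cong] = assms
  fix b :: "'a ^ 'n" assume "b \<in> Basis"
  then obtain i u where "b = axis i u" by (auto simp: Basis_vec_def)
  then show "(\<lambda>x. vec_lambda x \<bullet> b) \<in> borel_measurable (Pi\<^sub>M UNIV (\<lambda>_. M))"
    by (simp add: inner_axis) measurable
qed

lemma prod_Basis_vec:
  "(\<Prod>b\<in>(Basis :: ('a::euclidean_space ^ 'n::finite) set). F b) = (\<Prod>i\<in>UNIV. \<Prod>u\<in>Basis. F (axis i u))"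
proof -
  have "inj_on (\<lambda>(i, u). axis i u) ((UNIV :: 'n set) \<times> (Basis :: 'a set))"
    by (auto simp: inj_on_def axis_eq_axis nonzero_Basis)
  moreover have "(Basis :: ('a ^ 'n) set) = (\<lambda>(i, u). axis i u) ` (UNIV \<times> Basis)"
    by (auto simp: Basis_vec_def)
  ultimately have "(\<Prod>b\<in>(Basis :: ('a ^ 'n) set). F b) = (\<Prod>z\<in>UNIV \<times> Basis. F (case z of (i, u) \<Rightarrow> axis i u))"
    by (rule prod.reindex_cong) simp
  then show ?thesis
    by (simp add: prod.cartesian_product case_prod_beta')
qed

lemma vec_measure_lborel: "vec_measure (lborel :: 'a::euclidean_space measure) = (lborel :: ('a ^ 'n::finite) measure)"
proof (rule lborel_eqI[symmetric])
  interpret product_sigma_finite "\<lambda>_::'n. lborel :: 'a measure" ..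
  fix l u :: "'a ^ 'n" assume le: "\<And>b. b \<in> Basis \<Longrightarrow> l \<bullet> b \<le> u \<bullet> b"
  have le': "l $ i \<bullet> c \<le> u $ i \<bullet> c" if "c \<in> Basis" for i c
    using le[of "axis i c"] that by (auto simp: inner_axis Basis_vec_def)
  have "emeasure (vec_measure lborel) (box l u)
      = emeasure (Pi\<^sub>M UNIV (\<lambda>_::'n. lborel :: 'a measure)) (vec_lambda -` box l u \<inter> space (Pi\<^sub>M UNIV (\<lambda>_::'n. lborel :: 'a measure)))"
    unfolding vec_measure_def by (rule emeasure_distr) (auto intro: measurable_vec_lambda)
  also have "vec_lambda -` box l u \<inter> space (Pi\<^sub>M UNIV (\<lambda>_::'n. lborel :: 'a measure))
      = Pi\<^sub>E UNIV (\<lambda>i. box (l $ i) (u $ i))"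
    by (auto simp: space_PiM mem_box Basis_vec_def inner_axis PiE_def Pi_def)
  also have "emeasure (Pi\<^sub>M UNIV (\<lambda>_::'n. lborel :: 'a measure)) \<dots> = (\<Prod>i\<in>UNIV. emeasure lborel (box (l $ i) (u $ i)))"
    by (rule emeasure_PiM) auto
  also have "\<dots> = (\<Prod>i\<in>UNIV. ennreal (\<Prod>c\<in>Basis. (u $ i - l $ i) \<bullet> c))"
    using le' by (simp add: emeasure_lborel_box)
  also have "\<dots> = ennreal (\<Prod>b\<in>Basis. (u - l) \<bullet> b)"
    using le' by (simp add: prod_Basis_vec inner_axis prod_ennreal prod_nonneg inner_diff_left)
  finally show "emeasure (vec_measure lborel) (box l u) = ennreal (\<Prod>b\<in>Basis. (u - l) \<bullet> b)" .
qed simp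

lemma vec_measure_density:
  fixes f :: "'a::euclidean_space \<Rightarrow> ennreal"
  assumes [measurable]: "f \<in> borel_measurable borel" and "prob_space (density lborel f)"
  shows "vec_measure (density lborel f) = density lborel (\<lambda>x :: 'a ^ 'n::finite. \<Prod>i\<in>UNIV. f (x $ i))"
proof -
  interpret L: product_sigma_finite "\<lambda>_::'n. lborel :: 'a measure" ..
  interpret D: prob_space "density lborel f" by fact
  interpret D: product_sigma_finite "\<lambda>_::'n. density lborel f" ..
  let ?D = "density lborel (\<lambda>x :: 'a ^ 'n. \<Prod>i\<in>UNIV. f (x $ i))"
  let ?B = "Pi\<^sub>M UNIV (\<lambda>_::'n. borel :: 'a measure)"
  have [measurable]: "(\<lambda>x. x $ i) \<in> borel_measurable borel" for i :: 'n
    by (intro borel_measurable_continuous_onI continuous_intros)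
  have nth: "vec_nth \<in> borel \<rightarrow>\<^sub>M ?B"
    by (rule measurable_PiM_single') (auto simp: space_PiM)
  \<comment> \<open>The identity is proved on the function side, where agreement on rectangles
    determines a product measure, and is carried back by \<open>vec_lambda\<close>.\<close>
  have "distr ?D ?B vec_nth = Pi\<^sub>M UNIV (\<lambda>_::'n. density lborel f)"
  proof (rule D.PiM_eqI)
    show "sets (distr ?D ?B vec_nth) = sets (Pi\<^sub>M UNIV (\<lambda>_::'n. density lborel f))"
      by (simp cong: sets_PiM_cong)
    fix A :: "'n \<Rightarrow> 'a set" assume "\<And>i. i \<in> UNIV \<Longrightarrow> A i \<in> sets (density lborel f)"
    then have [measurable]: "A i \<in> sets borel" for i by simp
    have "emeasure (distr ?D ?B vec_nth) (Pi\<^sub>E UNIV A) = emeasure ?D (vec_nth -` Pi\<^sub>E UNIV A)"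
      using nth by (subst emeasure_distr) auto
    also have "\<dots> = (\<integral>\<^sup>+x. (\<Prod>i\<in>UNIV. f (x $ i)) * indicator (vec_nth -` Pi\<^sub>E UNIV A) x \<partial>lborel)"
      using measurable_sets[OF nth, of "Pi\<^sub>E UNIV A"]
      by (intro emeasure_density) auto
    also have "\<dots> = (\<integral>\<^sup>+x. (\<Prod>i\<in>UNIV. f (x $ i) * indicator (A i) (x $ i)) \<partial>lborel)"
    proof (rule nn_integral_cong)
      fix x :: "'a ^ 'n"
      have "indicator (vec_nth -` Pi\<^sub>E UNIV A) x = (\<Prod>i\<in>UNIV. indicator (A i) (x $ i) :: ennreal)"
        by (auto simp: indicator_def PiE_def Pi_def)
      then show "(\<Prod>i\<in>UNIV. f (x $ i)) * indicator (vec_nth -` Pi\<^sub>E UNIV A) x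
          = (\<Prod>i\<in>UNIV. f (x $ i) * indicator (A i) (x $ i))"
        by (simp add: prod.distrib)
    qed
    also have "\<dots> = (\<integral>\<^sup>+x. (\<Prod>i\<in>UNIV. f (x i) * indicator (A i) (x i)) \<partial>Pi\<^sub>M UNIV (\<lambda>_::'n. lborel))"
      unfolding vec_measure_lborel[symmetric] vec_measure_def
      by (subst nn_integral_distr) (auto intro: measurable_vec_lambda)
    also have "\<dots> = (\<Prod>i\<in>UNIV. \<integral>\<^sup>+x. f x * indicator (A i) x \<partial>lborel)"
      by (rule L.product_nn_integral_prod) auto
    also have "\<dots> = (\<Prod>i\<in>UNIV. emeasure (density lborel f) (A i))"
      by (simp add: emeasure_density)
    finally show "emeasure (distr ?D ?B vec_nth) (Pi\<^sub>E UNIV A) = (\<Prod>i\<in>UNIV. emeasure (density lborel f) (A i))" .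
  qed simp
  then have "vec_measure (density lborel f) = distr (distr ?D ?B vec_nth) borel vec_lambda"
    by (simp add: vec_measure_def)
  also have "\<dots> = distr ?D borel (vec_lambda \<circ> vec_nth)"
    using nth by (intro distr_distr measurable_vec_lambda) auto
  also have "\<dots> = ?D"
    by (rule distr_id2[unfolded id_def, THEN trans[rotated]])
       (auto simp: comp_def)
  finally show ?thesis .
qed

lemma entropy_contracting_vec:
  fixes M N :: "'a::euclidean_space measure"
  assumes "entropy_contracting M N (\<lambda>x y. \<rho> *\<^sub>R x + s *\<^sub>R y) r" "r > 0"
    and sets: "sets M = sets borel" "sets N = sets borel"
  shows "entropy_contracting (vec_measure M :: ('a ^ 'n::finite) measure) (vec_measure N)
    (\<lambda>x y. \<rho> *\<^sub>R x + s *\<^sub>R y) r"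
proof (rule entropy_contracting_distr[OF entropy_contracting_PiM[OF assms(1,2) finite]])
  show "vec_lambda \<in> Pi\<^sub>M UNIV (\<lambda>_::'n. M) \<rightarrow>\<^sub>M vec_measure M"
    "vec_lambda \<in> Pi\<^sub>M UNIV (\<lambda>_::'n. N) \<rightarrow>\<^sub>M vec_measure N"
    using measurable_vec_lambda[OF sets(1)] measurable_vec_lambda[OF sets(2)]
    by (simp_all cong: measurable_cong_sets)
  show "distr (Pi\<^sub>M UNIV (\<lambda>_::'n. M)) (vec_measure M) vec_lambda = vec_measure M"
    "distr (Pi\<^sub>M UNIV (\<lambda>_::'n. N)) (vec_measure N) vec_lambda = vec_measure N"
    by (simp_all add: vec_measure_def cong: distr_cong)
qed (auto simp: vec_eq_iff)

section \<open>Gaussian laws with the variances of the scheme\<close>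

abbreviation centered_normal :: "real \<Rightarrow> real measure" where
  "centered_normal s \<equiv> density lborel (\<lambda>x. ennreal (normal_density 0 s x))"

lemma distr_std_normal_scale:
  assumes "s > 0"
  shows "distr std_normal (centered_normal s) (\<lambda>x. s * x) = centered_normal s"
proof -
  interpret prob_space std_normal by (rule prob_space_normal_density) simp
  have "distributed std_normal lborel (\<lambda>x. x) std_normal_density"
    by (auto simp: distributed_def distr_id2)
  from normal_density_affine[OF this, of s 0]
  have "distributed std_normal lborel (\<lambda>x. s * x) (normal_density 0 s)"
    using assms by simp
  then have "distr std_normal lborel (\<lambda>x. s * x) = centered_normal s"
    by (simp add: distributed_def)
  then show ?thesis by (simp cong: distr_cong)
qed

text \<open>The state has standard deviation \<open>s\<close>, the noise \<sigma>, and
  \<open>s\<close> is also the coefficient of the noise, so a common factor \<open>s\<close> comes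
  out of the operation. In the scheme, \<open>s\<close> is \<open>sqrt (2 * \<nu>)\<close> and the
  noise is a Brownian increment over time \<sigma>^2.\<close>

lemma centered_normal_contraction:
  assumes "\<rho> > 0" "\<sigma> > 0" "\<rho>\<^sup>2 + \<sigma>\<^sup>2 = 1" "s > 0"
  shows "entropy_contracting (centered_normal s) (centered_normal \<sigma>) (\<lambda>x y. \<rho> *\<^sub>R x + s *\<^sub>R y) (\<rho>\<^sup>2)"
proof (rule entropy_contracting_distr)
  show "entropy_contracting std_normal std_normal (\<lambda>x y. \<rho> * x + \<sigma> * y) (\<rho>\<^sup>2)"
    unfolding entropy_contracting_def
  proof (intro conjI ballI)
    show "prob_space std_normal" "prob_space std_normal" by (auto intro: prob_space_normal_density)
    fix \<phi> assume \<phi>: "\<phi> \<in> bdd_measurable std_normal"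
    then obtain C where "\<And>x. \<bar>\<phi> x\<bar> \<le> C" using bdd_measurableE[OF \<phi>] by auto
    then show "\<rho>\<^sup>2 * log_mgf std_normal (\<lambda>x. (\<integral>y. \<phi> (\<rho> * x + \<sigma> * y) \<partial>std_normal) / \<rho>\<^sup>2) \<le> log_mgf std_normal \<phi>"
      unfolding log_mgf_def using bdd_measurableD[OF \<phi>] assms by (intro std_normal_contraction) auto
  qed simp
  show "distr std_normal (centered_normal s) (\<lambda>x. s * x) = centered_normal s"
    "distr std_normal (centered_normal \<sigma>) (\<lambda>x. \<sigma> * x) = centered_normal \<sigma>"
    using assms by (auto intro: distr_std_normal_scale)
qed (auto simp: algebra_simps)

lemma planar_normal_contraction:
  assumes "\<rho> > 0" "\<sigma> > 0" "\<rho>\<^sup>2 + \<sigma>\<^sup>2 = 1" "s > 0"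
  shows "entropy_contracting
    (vec_measure (vec_measure (centered_normal s)) :: ((real ^ 'd::finite) ^ 'n::finite) measure)
    (vec_measure (vec_measure (centered_normal \<sigma>))) (\<lambda>x y. \<rho> *\<^sub>R x + s *\<^sub>R y) (\<rho>\<^sup>2)"
  using assms by (intro entropy_contracting_vec centered_normal_contraction) auto

lemma vec_measure_centered_normal:
  assumes "s > 0"
  shows "vec_measure (centered_normal s)
    = density lborel (\<lambda>x :: real ^ 'd::finite. ennreal (\<Prod>k\<in>UNIV. normal_density 0 s (x $ k)))"
  using assms by (subst vec_measure_density) (auto intro: prob_space_normal_density simp: prod_ennreal)

section \<open>Rotations of pairs of particles\<close>

lemma inner_vec_2: "(x :: real ^ 2) \<bullet> y = x $ 1 * y $ 1 + x $ 2 * y $ 2"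
  by (simp add: inner_vec_def sum_2)

lemma perp_nth [simp]: "perp x $ 1 = - (x $ 2)" "perp x $ 2 = x $ 1"
  by (simp_all add: perp_def)

lemma bounded_linear_perp: "bounded_linear perp"
  unfolding linear_conv_bounded_linear[symmetric]
  by (rule linearI) (simp_all add: vec_eq_iff forall_2)

lemma perp_minus: "perp (- x) = - perp x"
  by (simp add: vec_eq_iff forall_2)

lemma norm_perp [simp]: "norm (perp x) = norm x"
  by (simp add: norm_eq_sqrt_inner inner_vec_2)

definition plane_rot :: "real \<Rightarrow> real ^ 2 \<Rightarrow> real ^ 2" where
  "plane_rot \<theta> x = cos \<theta> *\<^sub>R x + sin \<theta> *\<^sub>R perp x"

lemma norm_plane_rot [simp]: "norm (plane_rot \<theta> x) = norm x"
proof -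
  have "plane_rot \<theta> x \<bullet> plane_rot \<theta> x = ((cos \<theta>)\<^sup>2 + (sin \<theta>)\<^sup>2) * (x \<bullet> x)"
    unfolding plane_rot_def inner_vec_2
    by (simp add: algebra_simps power2_eq_square
        del: sin_cos_squared_add sin_cos_squared_add2 sin_cos_squared_add3)
  then show ?thesis by (simp add: norm_eq_sqrt_inner)
qed

lemma bounded_linear_plane_rot: "bounded_linear (plane_rot \<theta>)"
  unfolding plane_rot_def
  by (intro bounded_linear_add bounded_linear_const_scaleR bounded_linear_ident bounded_linear_perp)

text \<open>The displacement \<open>v\<close> enters the difference of the two positions twice,
  hence the factor 1/2; it cancels in their sum.\<close>

definition pair_rot :: "'n::finite \<Rightarrow> 'n \<Rightarrow> real \<Rightarrow> (real ^ 2) ^ 'n \<Rightarrow> (real ^ 2) ^ 'n" where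
  "pair_rot i j \<theta> z = (let v = (1 / 2) *\<^sub>R (plane_rot \<theta> (z $ i - z $ j) - (z $ i - z $ j))
     in z + (axis i v - axis j v))"

lemma pair_rot_diff:
  assumes "i \<noteq> j"
  shows "pair_rot i j \<theta> z $ i - pair_rot i j \<theta> z $ j = plane_rot \<theta> (z $ i - z $ j)"
proof -
  have "(2 :: real) *\<^sub>R ((1 / 2) *\<^sub>R v) = v" for v :: "real ^ 2" by simp
  then show ?thesis
    using assms by (simp add: pair_rot_def Let_def axis_def algebra_simps flip: scaleR_2)
qed

lemma orthogonal_transformation_pair_rot:
  fixes i j :: "'n::finite"
  assumes "i \<noteq> j"
  shows "orthogonal_transformation (pair_rot i j \<theta>)"
  unfolding orthogonal_transformation
proof
  interpret R: bounded_linear "plane_rot \<theta>" by (rule bounded_linear_plane_rot)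
  show "linear (pair_rot i j \<theta>)"
    by (rule linearI)
      (simp_all add: pair_rot_def Let_def vec_eq_iff axis_def R.add R.scaleR R.diff algebra_simps)
  show "\<forall>z. norm (pair_rot i j \<theta> z) = norm z"
  proof
    fix z :: "(real ^ 2) ^ 'n"
    define d where "d = z $ i - z $ j"
    define v where "v = (1 / 2) *\<^sub>R (plane_rot \<theta> d - d)"
    \<comment> \<open>Expanding |d + 2 v| = |d| shows that
      \<open>d \<bullet> v + v \<bullet> v\<close> vanishes; this is half of the increment of the
      squared norm of \<open>z\<close>.\<close>
    have "d \<bullet> d = plane_rot \<theta> d \<bullet> plane_rot \<theta> d"
      using norm_plane_rot[of \<theta> d] unfolding norm_eq_sqrt_inner by simp
    also have "plane_rot \<theta> d = d + 2 *\<^sub>R v" by (simp add: v_def)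
    finally have dv: "d \<bullet> v + v \<bullet> v = 0"
      by (simp add: inner_add_left inner_add_right inner_commute)
    have zu: "z \<bullet> (axis i v - axis j v) = d \<bullet> v"
      by (simp add: inner_diff_right inner_axis d_def inner_diff_left)
    have uu: "(axis i v - axis j v) \<bullet> (axis i v - axis j v) = 2 * (v \<bullet> v)"
      using assms by (simp add: inner_diff_right inner_diff_left inner_axis) (simp add: axis_def)
    have "pair_rot i j \<theta> z \<bullet> pair_rot i j \<theta> z = z \<bullet> z + 2 * (d \<bullet> v + v \<bullet> v)"
      unfolding pair_rot_def Let_def d_def[symmetric] v_def[symmetric]
      using zu uu by (simp add: inner_add_left inner_add_right inner_commute)
    then show "norm (pair_rot i j \<theta> z) = norm z"
      using dv by (simp add: norm_eq_sqrt_inner)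
  qed
qed

lemma distr_density_orthogonal:
  fixes F :: "'a::euclidean_space \<Rightarrow> ennreal"
  assumes f: "orthogonal_transformation f" and [measurable]: "F \<in> borel_measurable borel"
    and F: "\<And>x. F (f x) = F x"
  shows "distr (density lborel F) borel f = density lborel F"
proof (rule measure_eqI)
  have [measurable]: "f \<in> borel_measurable borel"
    using orthogonal_transformation_linear[OF f]
    by (intro borel_measurable_continuous_onI linear_continuous_on) (simp add: linear_conv_bounded_linear)
  fix B assume "B \<in> sets (distr (density lborel F) borel f)"
  then have [measurable]: "B \<in> sets borel" by simp
  have [measurable]: "f -` B \<in> sets borel"
    using measurable_sets[of f borel borel B] by simp
  have "emeasure (distr (density lborel F) borel f) B = (\<integral>\<^sup>+x. F (f x) * indicator B (f x) \<partial>lborel)"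
    by (subst emeasure_distr, simp, simp, subst emeasure_density)
      (auto intro!: nn_integral_cong simp: F indicator_def)
  also have "\<dots> = (\<integral>\<^sup>+x. F x * indicator B x \<partial>distr lborel borel f)"
    by (subst nn_integral_distr) auto
  also have "\<dots> = emeasure (density lborel F) B"
    by (simp add: lborel_distr_orthogonal[OF f] emeasure_density)
  finally show "emeasure (distr (density lborel F) borel f) B = emeasure (density lborel F) B" .
qed simp

text \<open>The preimage of a level set of \<open>N\<close> under \<open>R k\<close> is that level
  set, so on each level the map acts as a single measure-preserving one. There are countably many
  levels, so the pieces add up. This replaces the Jacobian of a rotation whose angle depends on the
  point.\<close>

lemma distr_piecewise_invariant:
  fixes R :: "int \<Rightarrow> 'a \<Rightarrow> 'a"
  assumes R: "\<And>k. R k \<in> M \<rightarrow>\<^sub>M M" "\<And>k. distr M M (R k) = M"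
    and N: "N \<in> M \<rightarrow>\<^sub>M count_space UNIV" "\<And>k x. x \<in> space M \<Longrightarrow> N (R k x) = N x"
  shows "(\<lambda>x. R (N x) x) \<in> M \<rightarrow>\<^sub>M M" "distr M M (\<lambda>x. R (N x) x) = M"
proof -
  note [measurable] = R(1) N(1)
  show meas [measurable]: "(\<lambda>x. R (N x) x) \<in> M \<rightarrow>\<^sub>M M"
    by (rule measurable_compose_countable[OF R(1) N(1)])
  show "distr M M (\<lambda>x. R (N x) x) = M"
  proof (rule measure_eqI)
    fix B assume "B \<in> sets (distr M M (\<lambda>x. R (N x) x))"
    then have [measurable]: "B \<in> sets M" by simp
    have sets: "{x \<in> space M. N x = k \<and> R k x \<in> B} \<in> sets M" "{x \<in> B. N x = k} \<in> sets M" for k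
    proof -
      have "{x \<in> B. N x = k} = B \<inter> {x \<in> space M. N x = k}"
        using sets.sets_into_space[of B M] by auto
      then show "{x \<in> B. N x = k} \<in> sets M" by simp
    qed measurable
    have "emeasure (distr M M (\<lambda>x. R (N x) x)) B = emeasure M (\<Union>k. {x \<in> space M. N x = k \<and> R k x \<in> B})"
      by (subst emeasure_distr) (auto intro!: arg_cong[where f = "emeasure M"])
    also have "\<dots> = (\<integral>\<^sup>+k. emeasure M {x \<in> space M. N x = k \<and> R k x \<in> B} \<partial>count_space UNIV)"
      using sets by (intro emeasure_UN_countable) (auto simp: disjoint_family_on_def)
    also have "\<dots> = (\<integral>\<^sup>+k. emeasure M {x \<in> B. N x = k} \<partial>count_space UNIV)"
    proof (rule nn_integral_cong)
      fix k
      have "emeasure M {x \<in> B. N x = k} = emeasure (distr M M (R k)) {x \<in> B. N x = k}"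
        by (simp add: R)
      also have "\<dots> = emeasure M {x \<in> space M. N x = k \<and> R k x \<in> B}"
        using sets N(2) by (subst emeasure_distr) (auto intro!: arg_cong[where f = "emeasure M"])
      finally show "emeasure M {x \<in> space M. N x = k \<and> R k x \<in> B} = emeasure M {x \<in> B. N x = k}" ..
    qed
    also have "\<dots> = emeasure M (\<Union>k. {x \<in> B. N x = k})"
      using sets by (intro emeasure_UN_countable[symmetric]) (auto simp: disjoint_family_on_def)
    also have "(\<Union>k. {x \<in> B. N x = k}) = B" by auto
    finally show "emeasure (distr M M (\<lambda>x. R (N x) x)) B = emeasure M B" .
  qed simp
qed

text \<open>Since all ordered pairs are visited, each of the two visits of a pair contributes half of
  its angular velocity \<open>c / (pi * r^2)\<close>. The angle is rounded to a multiple of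
  \<open>h^2\<close>, so that a step is piecewise a rotation by a constant angle and preserves radial
  densities by countable additivity.\<close>

definition vortex_angle :: "real \<Rightarrow> real \<Rightarrow> real \<Rightarrow> real" where
  "vortex_angle c h r = h\<^sup>2 * of_int \<lfloor>c / (2 * pi * r\<^sup>2) / h\<rfloor>"

definition pair_step :: "real \<Rightarrow> real \<Rightarrow> 'n::finite \<times> 'n \<Rightarrow> (real ^ 2) ^ 'n \<Rightarrow> (real ^ 2) ^ 'n" where
  "pair_step c h = (\<lambda>(i, j) z. pair_rot i j (vortex_angle c h (norm (z $ i - z $ j))) z)"

text \<open>The rounded angle depends only on the distance of the pair, which the rotation
  preserves; hence the level sets of the rounding are invariant.\<close>

lemma distr_pair_step:
  fixes F :: "real \<Rightarrow> ennreal"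
  assumes "i \<noteq> j" and [measurable]: "F \<in> borel_measurable borel"
  defines "M \<equiv> density lborel (\<lambda>z :: (real ^ 2) ^ 'n::finite. F (norm z))"
  shows "pair_step c h (i, j) \<in> M \<rightarrow>\<^sub>M M" "distr M M (pair_step c h (i, j)) = M"
proof -
  let ?R = "\<lambda>k. pair_rot i j (h\<^sup>2 * of_int k) :: (real ^ 2) ^ 'n \<Rightarrow> _"
  let ?N = "\<lambda>z :: (real ^ 2) ^ 'n. \<lfloor>c / (2 * pi * (norm (z $ i - z $ j))\<^sup>2) / h\<rfloor>"
  have orth: "orthogonal_transformation (?R k)" for k
    using assms by (intro orthogonal_transformation_pair_rot)
  have "?R k \<in> borel_measurable borel" for k
    using orthogonal_transformation_linear[OF orth]
    by (intro borel_measurable_continuous_onI linear_continuous_on) (simp add: linear_conv_bounded_linear)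
  then have R: "?R k \<in> M \<rightarrow>\<^sub>M M" for k by (simp add: M_def)
  have "distr M borel (?R k) = M" for k
    unfolding M_def using orth orthogonal_transformation_norm[OF orth]
    by (intro distr_density_orthogonal) auto
  then have RM: "distr M M (?R k) = M" for k
    by (metis M_def distr_cong sets_density sets_lborel)
  have [measurable]: "(\<lambda>z :: (real ^ 2) ^ 'n. z $ k) \<in> borel_measurable borel" for k
    by (intro borel_measurable_continuous_onI continuous_intros)
  have N: "?N \<in> M \<rightarrow>\<^sub>M count_space UNIV" unfolding M_def by measurable
  have NR: "?N (?R k z) = ?N z" for k z
    using assms by (simp add: pair_rot_diff)
  have "pair_step c h (i, j) = (\<lambda>z. ?R (?N z) z)"
    by (simp add: pair_step_def vortex_angle_def)
  then show "pair_step c h (i, j) \<in> M \<rightarrow>\<^sub>M M" "distr M M (pair_step c h (i, j)) = M"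
    using distr_piecewise_invariant[where R = ?R and N = ?N and M = M, OF R RM N NR] by simp_all
qed

lemma distr_fold_invariant:
  assumes "\<And>p. p \<in> set ps \<Longrightarrow> f p \<in> M \<rightarrow>\<^sub>M M" "\<And>p. p \<in> set ps \<Longrightarrow> distr M M (f p) = M"
  shows "fold f ps \<in> M \<rightarrow>\<^sub>M M \<and> distr M M (fold f ps) = M"
  using assms
proof (induction ps)
  case Nil
  then show ?case by (simp add: id_def distr_id2)
next
  case (Cons p ps)
  then have IH: "fold f ps \<in> M \<rightarrow>\<^sub>M M" "distr M M (fold f ps) = M" and p: "f p \<in> M \<rightarrow>\<^sub>M M" "distr M M (f p) = M"
    by auto
  then show ?case
    using distr_distr[OF IH(1) p(1)] measurable_comp[OF p(1) IH(1)] by (simp add: comp_def)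
qed

section \<open>The stationary Gaussian measure\<close>

lemma p_infty_radial:
  fixes z :: "(real ^ 2) ^ 'n::finite"
  shows "p_infty \<nu> z = 1 / (4 * pi * \<nu>) ^ CARD('n) * exp (- (1 / (4 * \<nu>)) * (norm z)\<^sup>2)"
  unfolding p_infty_def by (simp add: power2_norm_eq_inner inner_vec_def)

definition gauss_measure :: "real \<Rightarrow> ((real ^ 2) ^ 'n::finite) measure" where
  "gauss_measure \<nu> = density lborel (\<lambda>z. ennreal (p_infty \<nu> z))"

lemma gauss_measure_eq_vec_measure:
  assumes "\<nu> > 0"
  shows "gauss_measure \<nu> = vec_measure (vec_measure (centered_normal (sqrt (2 * \<nu>))))"
proof -
  have s: "sqrt (2 * \<nu>) > 0" using assms by simp
  define f where "f x = ennreal (\<Prod>k\<in>UNIV. normal_density 0 (sqrt (2 * \<nu>)) (x $ k))" for x :: "real ^ 2"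
  have f: "vec_measure (centered_normal (sqrt (2 * \<nu>))) = density lborel f"
    using vec_measure_centered_normal[OF s] by (simp add: f_def[abs_def])
  have "prob_space (vec_measure (centered_normal (sqrt (2 * \<nu>))) :: (real ^ 2) measure)"
    unfolding vec_measure_def using s
    by (intro prob_space.prob_space_distr prob_space_PiM measurable_vec_lambda prob_space_normal_density) auto
  moreover have "f \<in> borel_measurable borel"
    unfolding f_def by measurable
  ultimately have "vec_measure (density lborel f) = density lborel (\<lambda>x :: (real ^ 2) ^ 'n. \<Prod>i\<in>UNIV. f (x $ i))"
    unfolding f by (intro vec_measure_density)
  also have "\<dots> = gauss_measure \<nu>"
    using assms by (simp add: gauss_measure_def f_def p_infty_eq_prod_normal_density prod_ennreal prod_nonneg)
  finally show ?thesis unfolding f by (rule sym)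
qed

section \<open>Convergence of consistent schemes\<close>

text \<open>The limit is joint in \<open>h\<close> and \<open>x\<close>. It contains the local
  uniformity that compositions and compactness arguments need, and asks for no continuity of
  \<open>\<Psi> h\<close>, which the rounded angles would violate.\<close>

definition consistent :: "(real \<Rightarrow> 'a::real_normed_vector \<Rightarrow> 'a) \<Rightarrow> 'a \<Rightarrow> 'a \<Rightarrow> bool" where
  "consistent \<Psi> v z \<longleftrightarrow> ((\<lambda>(h, x). (\<Psi> h x - x) /\<^sub>R h) \<longlongrightarrow> v) (at_right 0 \<times>\<^sub>F nhds z)"

lemma eventually_fst_pos: "eventually (\<lambda>p. 0 < fst p) (at_right (0 :: real) \<times>\<^sub>F G)"
  using eventually_compose_filterlim[OF eventually_at_right_less filterlim_fst] .

lemma tendsto_fst_at_right: "(fst \<longlongrightarrow> 0) (at_right (0 :: real) \<times>\<^sub>F G)"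
  using filterlim_mono[OF filterlim_fst at_within_le_nhds order_refl] .

lemma tendsto_snd_nhds: "(snd \<longlongrightarrow> z) (F \<times>\<^sub>F nhds z)"
  using filterlim_snd .

lemma consistent_tendsto:
  assumes "consistent \<Psi> v z"
  shows "((\<lambda>(h, x). \<Psi> h x) \<longlongrightarrow> z) (at_right 0 \<times>\<^sub>F nhds z)"
proof -
  have "((\<lambda>p. snd p + fst p *\<^sub>R (case p of (h, x) \<Rightarrow> (\<Psi> h x - x) /\<^sub>R h)) \<longlongrightarrow> z + 0 *\<^sub>R v) (at_right 0 \<times>\<^sub>F nhds z)"
    using assms unfolding consistent_def
    by (intro tendsto_add tendsto_scaleR tendsto_fst_at_right tendsto_snd_nhds)
  then have "((\<lambda>p. snd p + fst p *\<^sub>R (case p of (h, x) \<Rightarrow> (\<Psi> h x - x) /\<^sub>R h)) \<longlongrightarrow> z) (at_right 0 \<times>\<^sub>F nhds z)"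
    by (simp only: scaleR_zero_left add_0_right)
  then show ?thesis
    by (rule Lim_transform_eventually) (auto intro: eventually_mono[OF eventually_fst_pos])
qed

text \<open>The additivity behind operator splitting. As \<open>(h, x)\<close> tends to
  \<open>(0, z)\<close>, so does \<open>(h, \<Psi>1 h x)\<close>, and the joint limit for the second
  map applies along it.\<close>

lemma consistent_compose:
  assumes 1: "consistent \<Psi>1 v1 z" and 2: "consistent \<Psi>2 v2 z"
  shows "consistent (\<lambda>h x. \<Psi>2 h (\<Psi>1 h x)) (v1 + v2) z"
proof -
  let ?F = "at_right 0 \<times>\<^sub>F nhds z"
  have "filterlim (\<lambda>p. (fst p, case p of (h, x) \<Rightarrow> \<Psi>1 h x)) ?F ?F"
    by (intro filterlim_Pair filterlim_fst consistent_tendsto[OF 1])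
  from filterlim_compose[OF 2[unfolded consistent_def] this]
  have "((\<lambda>(h, x). (\<Psi>2 h (\<Psi>1 h x) - \<Psi>1 h x) /\<^sub>R h) \<longlongrightarrow> v2) ?F"
    by (simp add: case_prod_beta')
  from tendsto_add[OF 1[unfolded consistent_def] this] show ?thesis
    unfolding consistent_def by (simp add: case_prod_beta' scaleR_diff_right)
qed

lemma consistent_fold:
  assumes "\<And>p. p \<in> set ps \<Longrightarrow> consistent (\<lambda>h. f h p) (v p) z"
  shows "consistent (\<lambda>h. fold (f h) ps) (\<Sum>p\<leftarrow>ps. v p) z"
  using assms
proof (induction ps)
  case Nil
  then show ?case by (simp add: consistent_def case_prod_beta')
next
  case (Cons p ps)
  then show ?case using consistent_compose[of "\<lambda>h. f h p" "v p" z] by simp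
qed

text \<open>The slope -1/2 of \<open>sqrt (1 - h)\<close> at 0 is the confining part of the
  drift.\<close>

lemma consistent_sqrt_scale:
  fixes z :: "'a::real_normed_vector"
  shows "consistent (\<lambda>h x. sqrt (1 - h) *\<^sub>R x) (- (1 / 2) *\<^sub>R z) z"
proof -
  have "((\<lambda>h. sqrt (1 - h)) has_real_derivative - (1 / 2)) (at 0 within {0<..})"
    by (auto intro!: derivative_eq_intros)
  then have "((\<lambda>h. (sqrt (1 - h) - 1) / h) \<longlongrightarrow> - (1 / 2)) (at_right 0)"
    by (simp add: has_field_derivative_iff)
  from filterlim_compose[OF this filterlim_fst]
  have "((\<lambda>p. ((sqrt (1 - fst p) - 1) / fst p) *\<^sub>R snd p) \<longlongrightarrow> - (1 / 2) *\<^sub>R z) (at_right 0 \<times>\<^sub>F nhds z)"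
    by (intro tendsto_scaleR tendsto_snd_nhds)
  moreover have "((sqrt (1 - h) - 1) / h) *\<^sub>R x = (sqrt (1 - h) *\<^sub>R x - x) /\<^sub>R h" for h and x :: 'a
    by (simp add: divide_inverse algebra_simps)
  ultimately show ?thesis
    by (simp add: consistent_def case_prod_beta')
qed

text \<open>A joint limit provides around each point of \<open>K\<close> a neighbourhood with one
  common range of step sizes; finitely many of them cover \<open>K\<close>. Continuity of
  \<open>b\<close> replaces the velocity at the centre by that at \<open>x\<close>.\<close>

lemma uniform_consistency:
  fixes b :: "'a::real_normed_vector \<Rightarrow> 'a"
  assumes "compact K" "continuous_on K b" "\<And>x. x \<in> K \<Longrightarrow> consistent \<Psi> (b x) x" "\<epsilon> > 0"
  shows "eventually (\<lambda>h. \<forall>x\<in>K. norm (\<Psi> h x - x - h *\<^sub>R b x) \<le> \<epsilon> * h) (at_right 0)"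
proof -
  have "\<exists>W P. open W \<and> c \<in> W \<and> eventually P (at_right 0) \<and>
      (\<forall>h x. P h \<longrightarrow> x \<in> W \<inter> K \<longrightarrow> norm ((\<Psi> h x - x) /\<^sub>R h - b x) < \<epsilon>)" if c: "c \<in> K" for c
  proof -
    have "eventually (\<lambda>(h, x). dist ((\<Psi> h x - x) /\<^sub>R h) (b c) < \<epsilon> / 2) (at_right 0 \<times>\<^sub>F nhds c)"
      using tendstoD[OF assms(3)[OF c, unfolded consistent_def], of "\<epsilon> / 2"] \<open>\<epsilon> > 0\<close>
      by (simp add: case_prod_beta')
    then obtain P Q where P: "eventually P (at_right 0)" and Q: "eventually Q (nhds c)"
      and PQ: "\<And>h x. P h \<Longrightarrow> Q x \<Longrightarrow> dist ((\<Psi> h x - x) /\<^sub>R h) (b c) < \<epsilon> / 2"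
      by (auto simp: eventually_prod_filter)
    from Q obtain U where U: "open U" "c \<in> U" "\<And>x. x \<in> U \<Longrightarrow> Q x"
      by (auto simp: eventually_nhds)
    have "open (ball (b c) (\<epsilon> / 2))" "b c \<in> ball (b c) (\<epsilon> / 2)" using \<open>\<epsilon> > 0\<close> by auto
    with assms(2) c obtain V where V: "open V" "c \<in> V" "\<And>x. x \<in> K \<Longrightarrow> x \<in> V \<Longrightarrow> b x \<in> ball (b c) (\<epsilon> / 2)"
      unfolding continuous_on_topological by metis
    have "norm ((\<Psi> h x - x) /\<^sub>R h - b x) < \<epsilon>" if "P h" "x \<in> (U \<inter> V) \<inter> K" for h x
      using PQ[OF that(1), of x] U(3)[of x] V(3)[of x] that(2)
        dist_triangle_half_l[of "(\<Psi> h x - x) /\<^sub>R h" "b c" \<epsilon> "b x"]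
      by (auto simp: dist_norm norm_minus_commute)
    then show ?thesis using P U V by (intro exI[of _ "U \<inter> V"] exI[of _ P]) auto
  qed
  then obtain W P where W: "\<And>c. c \<in> K \<Longrightarrow> open (W c)" "\<And>c. c \<in> K \<Longrightarrow> c \<in> W c"
    and P: "\<And>c. c \<in> K \<Longrightarrow> eventually (P c) (at_right 0)"
    and WP: "\<And>c h x. c \<in> K \<Longrightarrow> P c h \<Longrightarrow> x \<in> W c \<inter> K \<Longrightarrow> norm ((\<Psi> h x - x) /\<^sub>R h - b x) < \<epsilon>"
    by metis
  have cover: "K \<subseteq> (\<Union>c\<in>K. W c)" using W(2) by auto
  obtain D where D: "D \<subseteq> K" "finite D" "K \<subseteq> (\<Union>c\<in>D. W c)"
    by (rule compactE_image[OF assms(1) W(1) cover])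
  have "eventually (\<lambda>h. \<forall>c\<in>D. P c h) (at_right 0)"
    using D P by (intro eventually_ball_finite) auto
  with eventually_at_right_less[of "0 :: real"] show ?thesis
  proof eventually_elim
    case (elim h)
    show ?case
    proof
      fix x assume x: "x \<in> K"
      then obtain c where "c \<in> D" "x \<in> W c" using D by blast
      then have *: "norm ((\<Psi> h x - x) /\<^sub>R h - b x) \<le> \<epsilon>"
        using elim D x by (intro less_imp_le WP) auto
      have "\<Psi> h x - x - h *\<^sub>R b x = h *\<^sub>R ((\<Psi> h x - x) /\<^sub>R h - b x)"
        using elim by (simp add: algebra_simps)
      then show "norm (\<Psi> h x - x - h *\<^sub>R b x) \<le> \<epsilon> * h"
        using mult_left_mono[OF *, of h] elim by (simp add: mult.commute)
    qed
  qed
qed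

text \<open>The additive noise cancels in the difference of scheme and path, so no regularity of
  \<open>w\<close> is assumed. There remains an Euler-type estimate: each step multiplies the error
  by at most \<open>1 + L * h\<close> and adds two local errors of size
  \<open>\<epsilon> * h\<close>.\<close>

lemma scheme_converges:
  fixes z w :: "real \<Rightarrow> 'a::euclidean_space" and S :: "nat \<Rightarrow> nat \<Rightarrow> 'a"
  assumes "T > 0" and z_cont: "continuous_on {0..T} z"
    and K: "compact K" "\<eta> > 0" "\<And>s. s \<in> {0..T} \<Longrightarrow> cball (z s) \<eta> \<subseteq> K"
    and b: "L-lipschitz_on K b"
    and z: "\<And>s. s \<in> {0..T} \<Longrightarrow> z s = z 0 + w s + integral {0..s} (\<lambda>r. b (z r))"
    and \<Psi>: "\<And>x. x \<in> K \<Longrightarrow> consistent \<Psi> (b x) x"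
    and S0: "\<And>m. S m 0 = z 0"
    and S: "\<And>m k. S m (Suc k) = \<Psi> (T / real m) (S m k)
        + (w (real (Suc k) * (T / real m)) - w (real k * (T / real m)))"
  shows "(\<lambda>m. S m m) \<longlonglongrightarrow> z T"
proof (rule LIMSEQ_I)
  fix r :: real assume "r > 0"
  have L: "L \<ge> 0" using b by (rule lipschitz_on_nonneg)
  define \<epsilon> where "\<epsilon> = min (r / 2) \<eta> / (2 * T * exp (L * T))"
  have \<epsilon>: "\<epsilon> > 0" "2 * \<epsilon> * T * exp (L * T) = min (r / 2) \<eta>"
    using \<open>T > 0\<close> \<open>r > 0\<close> K(2) by (auto simp: \<epsilon>_def)
  have zK: "z s \<in> K" if "s \<in> {0..T}" for s using K(2) K(3)[OF that] by auto
  have b_cont: "continuous_on K b" using b by (rule lipschitz_on_continuous_on)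
  have bz_cont: "continuous_on {0..T} (\<lambda>s. b (z s))"
    using zK by (intro continuous_on_compose2[OF b_cont z_cont]) auto
  obtain \<delta> where \<delta>: "\<delta> > 0"
    "\<And>s s'. s \<in> {0..T} \<Longrightarrow> s' \<in> {0..T} \<Longrightarrow> dist s' s < \<delta> \<Longrightarrow> dist (b (z s')) (b (z s)) < \<epsilon>"
    using compact_uniformly_continuous[OF bz_cont compact_Icc] \<epsilon>(1)
    unfolding uniformly_continuous_on_def by metis
  have "filterlim (\<lambda>m. T / real m) (at_right 0) sequentially"
    using \<open>T > 0\<close>
    by (intro tendsto_imp_filterlim_at_right lim_const_over_n)
      (auto intro!: eventually_mono[OF eventually_gt_at_top[of 0]])
  then have "eventually (\<lambda>m. (\<forall>x\<in>K. norm (\<Psi> (T / real m) x - x - (T / real m) *\<^sub>R b x) \<le> \<epsilon> * (T / real m))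
      \<and> T / real m \<in> {0<..<\<delta>}) sequentially"
    using \<delta>(1)
    by (intro eventually_conj eventually_compose_filterlim[OF uniform_consistency[OF K(1) b_cont \<Psi> \<epsilon>(1)]]
      eventually_compose_filterlim[OF eventually_at_right_real]) auto
  then have "eventually (\<lambda>m. norm (S m m - z T) < r) sequentially"
  proof eventually_elim
    case (elim m)
    define h where "h = T / real m"
    have h: "0 < h" "h < \<delta>" and cons: "\<And>x. x \<in> K \<Longrightarrow> norm (\<Psi> h x - x - h *\<^sub>R b x) \<le> \<epsilon> * h"
      using elim by (auto simp: h_def)
    have m: "m > 0" using h(1) by (cases m) (auto simp: h_def)
    have hm: "real m * h = T" using m by (simp add: h_def)
    define t where "t k = real k * h" for k
    have tk: "t k \<in> {0..T}" if "k \<le> m" for k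
      using that h(1) hm mult_right_mono[of "real k" "real m" h] by (auto simp: t_def)
    define C where "C k = 2 * \<epsilon> * t k * exp (L * t k)" for k
    have C_le: "C k \<le> min (r / 2) \<eta>" if "k \<le> m" for k
    proof -
      have "C k \<le> 2 * \<epsilon> * T * exp (L * T)"
        unfolding C_def using tk[OF that] \<epsilon>(1) L
        by (intro mult_mono mult_left_mono) (auto intro: mult_left_mono)
      then show ?thesis by (simp add: \<epsilon>(2))
    qed
    have step_error: "norm (z (t (Suc k)) - z (t k) - (w (t (Suc k)) - w (t k)) - h *\<^sub>R b (z (t k))) \<le> \<epsilon> * h"
      if k: "Suc k \<le> m" for k
    proof -
      have tt: "t k \<le> t (Suc k)" "t (Suc k) - t k = h" "t k \<in> {0..T}" "t (Suc k) \<in> {0..T}"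
        using h(1) tk[of k] tk[OF k] k by (simp_all add: t_def algebra_simps)
      have int: "(\<lambda>r. b (z r)) integrable_on {u..v}" if "u \<in> {0..T}" "v \<in> {0..T}" for u v
        using that by (intro integrable_continuous_real continuous_on_subset[OF bz_cont]) auto
      have "integral {0..t k} (\<lambda>r. b (z r)) + integral {t k..t (Suc k)} (\<lambda>r. b (z r))
          = integral {0..t (Suc k)} (\<lambda>r. b (z r))"
        using tt \<open>T > 0\<close> by (intro Henstock_Kurzweil_Integration.integral_combine int) auto
      then have "z (t (Suc k)) - z (t k) - (w (t (Suc k)) - w (t k)) = integral {t k..t (Suc k)} (\<lambda>r. b (z r))"
        using z[OF tt(3)] z[OF tt(4)] by (simp add: algebra_simps)
      also have "\<dots> - h *\<^sub>R b (z (t k)) = integral {t k..t (Suc k)} (\<lambda>r. b (z r) - b (z (t k)))"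
        using int[OF tt(3,4)] tt by (subst Henstock_Kurzweil_Integration.integral_diff) auto
      also have "norm \<dots> \<le> \<epsilon> * (t (Suc k) - t k)"
      proof (rule integral_bound)
        show "continuous_on {t k..t (Suc k)} (\<lambda>r. b (z r) - b (z (t k)))"
          using tt by (intro continuous_intros continuous_on_subset[OF bz_cont]) auto
        fix u assume "u \<in> {t k..t (Suc k)}"
        then have "dist u (t k) < \<delta>" "u \<in> {0..T}" using tt h(2) by (auto simp: dist_real_def)
        then show "norm (b (z u) - b (z (t k))) \<le> \<epsilon>"
          using \<delta>(2)[of "t k" u] tt by (simp add: dist_norm less_imp_le)
      qed (use tt in auto)
      finally show ?thesis using tt by simp
    qed
    \<comment> \<open>The induction also confines the scheme: the bound at step \<open>k\<close>
      puts \<open>S m k\<close> into \<open>K\<close>, where the estimates for the next step are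
      available.\<close>
    have "norm (S m k - z (t k)) \<le> C k" if "k \<le> m" for k
      using that
    proof (induction k)
      case 0
      then show ?case by (simp add: S0 t_def C_def)
    next
      case (Suc k)
      define e where "e = S m k - z (t k)"
      have e: "norm e \<le> C k" using Suc by (simp add: e_def)
      have "C k \<le> \<eta>" using C_le[of k] Suc by simp
      then have SK: "S m k \<in> K"
        using e K(3)[OF tk[of k]] Suc by (auto simp: e_def dist_norm norm_minus_commute)
      have tri: "norm (p + q + x - y) \<le> norm p + norm q + norm x + norm y" for p q x y :: 'a
        using norm_triangle_ineq4[of "p + q + x" y] norm_triangle_ineq[of "p + q" x] norm_triangle_ineq[of p q]
        by linarith
      have "S m (Suc k) - z (t (Suc k)) = e + (\<Psi> h (S m k) - S m k - h *\<^sub>R b (S m k))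
          + h *\<^sub>R (b (S m k) - b (z (t k)))
          - (z (t (Suc k)) - z (t k) - (w (t (Suc k)) - w (t k)) - h *\<^sub>R b (z (t k)))"
        by (simp add: S e_def t_def h_def algebra_simps)
      also have "norm \<dots> \<le> norm e + \<epsilon> * h + h * (L * norm e) + \<epsilon> * h"
      proof -
        have "norm (h *\<^sub>R (b (S m k) - b (z (t k)))) \<le> h * (L * norm e)"
          using lipschitz_onD[OF b SK zK[OF tk[of k]]] h(1) Suc by (simp add: e_def dist_norm)
        then show ?thesis
          using cons[OF SK] step_error[OF Suc.prems] by (intro order_trans[OF tri] add_mono order_refl)
      qed
      also have "\<dots> = (1 + L * h) * norm e + 2 * \<epsilon> * h" by (simp add: algebra_simps)
      also have "\<dots> \<le> exp (L * h) * C k + 2 * \<epsilon> * h * exp (L * t (Suc k))"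
      proof (rule add_mono)
        show "(1 + L * h) * norm e \<le> exp (L * h) * C k"
          by (intro mult_mono e exp_ge_add_one_self) auto
        have "1 \<le> exp (L * t (Suc k))" using L h(1) by (simp add: t_def)
        then show "2 * \<epsilon> * h \<le> 2 * \<epsilon> * h * exp (L * t (Suc k))"
          using \<epsilon>(1) h(1) by simp
      qed
      also have "exp (L * h) * C k = 2 * \<epsilon> * t k * exp (L * t (Suc k))"
        by (simp add: C_def t_def algebra_simps exp_add)
      also have "\<dots> + 2 * \<epsilon> * h * exp (L * t (Suc k)) = C (Suc k)"
        by (simp add: C_def t_def algebra_simps)
      finally show ?case .
    qed
    from this[of m] C_le[of m] have "norm (S m m - z T) \<le> r / 2"
      by (simp add: t_def hm)
    then show ?case using \<open>r > 0\<close> by simp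
  qed
  then show "\<exists>n0. \<forall>m\<ge>n0. norm (S m m - z T) < r"
    by (simp add: eventually_sequentially)
qed

section \<open>The vortex field\<close>

definition vortex_field :: "real \<Rightarrow> (real ^ 2) ^ 'n::finite \<Rightarrow> (real ^ 2) ^ 'n" where
  "vortex_field c z = (\<chi> i. vortex_drift (\<lambda>_. c) z i)"

text \<open>Up to the factor and the rotation \<open>perp\<close>, the kernel is the inversion
  \<open>x / |x|^2\<close>, for which \<open>|x / |x|^2 - y / |y|^2| = |x - y| / (|x| |y|)\<close>.\<close>

lemma biot_savart_lipschitz:
  assumes r: "r > 0" "r \<le> norm x" "r \<le> norm y"
  shows "norm (biot_savart x - biot_savart y) \<le> norm (x - y) / (2 * pi * r\<^sup>2)"
proof -
  interpret P: bounded_linear perp by (rule bounded_linear_perp)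
  define X where "X = x /\<^sub>R (norm x)\<^sup>2"
  define Y where "Y = y /\<^sub>R (norm y)\<^sup>2"
  have pos: "norm x > 0" "norm y > 0" using r by linarith+
  have "(norm (X - Y))\<^sup>2 = (norm X)\<^sup>2 - 2 * (X \<bullet> Y) + (norm Y)\<^sup>2"
    unfolding power2_norm_eq_inner by (simp add: inner_diff_left inner_diff_right inner_commute)
  also have "\<dots> = 1 / (norm x)\<^sup>2 - 2 * (x \<bullet> y) / ((norm x)\<^sup>2 * (norm y)\<^sup>2) + 1 / (norm y)\<^sup>2"
    using pos by (simp add: X_def Y_def power_mult_distrib power2_eq_square field_simps)
  also have "\<dots> = ((norm x)\<^sup>2 - 2 * (x \<bullet> y) + (norm y)\<^sup>2) / ((norm x)\<^sup>2 * (norm y)\<^sup>2)"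
    using pos by (simp add: field_simps)
  also have "(norm x)\<^sup>2 - 2 * (x \<bullet> y) + (norm y)\<^sup>2 = (norm (x - y))\<^sup>2"
    unfolding power2_norm_eq_inner by (simp add: inner_diff_left inner_diff_right inner_commute)
  also have "\<dots> / ((norm x)\<^sup>2 * (norm y)\<^sup>2) = (norm (x - y) / (norm x * norm y))\<^sup>2"
    by (simp add: power_divide power_mult_distrib)
  finally have "norm (X - Y) = norm (x - y) / (norm x * norm y)"
    by (rule power2_eq_imp_eq) auto
  also have "\<dots> \<le> norm (x - y) / r\<^sup>2"
    using r pos unfolding power2_eq_square by (intro divide_left_mono mult_mono) auto
  finally have *: "norm (X - Y) \<le> norm (x - y) / r\<^sup>2" .
  have "biot_savart x = (1 / (2 * pi)) *\<^sub>R perp X" "biot_savart y = (1 / (2 * pi)) *\<^sub>R perp Y"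
    unfolding biot_savart_def X_def Y_def P.scaleR scaleR_scaleR by (simp_all add: inverse_eq_divide)
  then have "biot_savart x - biot_savart y = (1 / (2 * pi)) *\<^sub>R perp (X - Y)"
    by (simp add: P.diff scaleR_diff_right)
  then have "norm (biot_savart x - biot_savart y) = norm (X - Y) / (2 * pi)"
    by simp
  also have "\<dots> \<le> norm (x - y) / r\<^sup>2 / (2 * pi)"
    using * by (intro divide_right_mono) auto
  finally show ?thesis by (simp add: mult.commute)
qed

lemma biot_savart_minus: "biot_savart (- x) = - biot_savart x"
  by (simp add: biot_savart_def perp_minus)

text \<open>The configurations with mutual distances at least \<open>r\<close> do not form a convex
  set, so a bound on the derivative would not be enough. The estimate for the kernel holds for any
  two points outside the ball.\<close>

lemma vortex_field_lipschitz:
  assumes "r > 0"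
  shows "\<exists>L. L-lipschitz_on {z :: (real ^ 2) ^ 'n::finite. \<forall>i j. i \<noteq> j \<longrightarrow> r \<le> norm (z $ i - z $ j)} (vortex_field c)"
proof -
  define D where "D = {z :: (real ^ 2) ^ 'n. \<forall>i j. i \<noteq> j \<longrightarrow> r \<le> norm (z $ i - z $ j)}"
  define L where "L = (\<Sum>i\<in>(UNIV :: 'n set). (\<Sum>j\<in>UNIV - {i}. \<bar>c\<bar> * (2 / (2 * pi * r\<^sup>2))) + 1 / 2)"
  have nth: "norm (x $ i - y $ i) \<le> norm (x - y)" for x y :: "(real ^ 2) ^ 'n" and i
    using Finite_Cartesian_Product.norm_nth_le[of "x - y" i] by simp
  have "norm (vortex_field c x - vortex_field c y) \<le> L * norm (x - y)" if x: "x \<in> D" and y: "y \<in> D" for x y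
  proof -
    have "norm (vortex_field c x - vortex_field c y)
        \<le> (\<Sum>i\<in>UNIV. norm ((vortex_field c x - vortex_field c y) $ i))"
      unfolding norm_vec_def by (rule L2_set_le_sum) simp
    also have "\<dots> \<le> (\<Sum>i\<in>(UNIV :: 'n set). ((\<Sum>j\<in>UNIV - {i}. \<bar>c\<bar> * (2 / (2 * pi * r\<^sup>2))) + 1 / 2) * norm (x - y))"
    proof (rule sum_mono)
      fix i :: 'n
      define E where "E j = c *\<^sub>R (biot_savart (x $ i - x $ j) - biot_savart (y $ i - y $ j))" for j
      have E: "norm (E j) \<le> \<bar>c\<bar> * (2 / (2 * pi * r\<^sup>2)) * norm (x - y)" if "j \<in> UNIV - {i}" for j
      proof -
        have "norm (biot_savart (x $ i - x $ j) - biot_savart (y $ i - y $ j))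
            \<le> norm ((x $ i - x $ j) - (y $ i - y $ j)) / (2 * pi * r\<^sup>2)"
          using x y that \<open>r > 0\<close> by (intro biot_savart_lipschitz) (auto simp: D_def)
        also have "(x $ i - x $ j) - (y $ i - y $ j) = (x $ i - y $ i) - (x $ j - y $ j)" by simp
        also have "norm \<dots> / (2 * pi * r\<^sup>2) \<le> (2 * norm (x - y)) / (2 * pi * r\<^sup>2)"
          using norm_triangle_ineq4[of "x $ i - y $ i" "x $ j - y $ j"] nth[of x i y] nth[of x j y]
          by (intro divide_right_mono) auto
        finally have "\<bar>c\<bar> * norm (biot_savart (x $ i - x $ j) - biot_savart (y $ i - y $ j))
            \<le> \<bar>c\<bar> * ((2 * norm (x - y)) / (2 * pi * r\<^sup>2))"
          by (rule mult_left_mono) simp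
        then show ?thesis by (simp add: E_def)
      qed
      have "(vortex_field c x - vortex_field c y) $ i = (\<Sum>j\<in>UNIV - {i}. E j) - (1 / 2) *\<^sub>R (x $ i - y $ i)"
        by (simp add: vortex_field_def vortex_drift_def E_def scaleR_diff_right sum_subtractf algebra_simps)
      also have "norm \<dots> \<le> norm (\<Sum>j\<in>UNIV - {i}. E j) + norm ((1 / 2) *\<^sub>R (x $ i - y $ i))"
        by (rule norm_triangle_ineq4)
      also have "\<dots> \<le> (\<Sum>j\<in>UNIV - {i}. \<bar>c\<bar> * (2 / (2 * pi * r\<^sup>2)) * norm (x - y)) + (1 / 2) * norm (x - y)"
        using nth[of x i y] by (intro add_mono sum_norm_le E) auto
      also have "\<dots> = ((\<Sum>j\<in>UNIV - {i}. \<bar>c\<bar> * (2 / (2 * pi * r\<^sup>2))) + 1 / 2) * norm (x - y)"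
        unfolding sum_distrib_right distrib_right ..
      finally show "norm ((vortex_field c x - vortex_field c y) $ i)
          \<le> ((\<Sum>j\<in>UNIV - {i}. \<bar>c\<bar> * (2 / (2 * pi * r\<^sup>2))) + 1 / 2) * norm (x - y)" .
    qed
    also have "\<dots> = L * norm (x - y)" unfolding L_def by (simp only: sum_distrib_right)
    finally show ?thesis .
  qed
  moreover have "L \<ge> 0" unfolding L_def by (intro sum_nonneg add_nonneg_nonneg mult_nonneg_nonneg) auto
  ultimately have "L-lipschitz_on D (vortex_field c)"
    by (intro lipschitz_onI) (auto simp: dist_norm)
  then show ?thesis unfolding D_def by blast
qed

text \<open>Rounding to multiples of \<open>h\<^sup>2\<close> displaces the angle by at most
  \<open>h\<^sup>2\<close>, hence the angular velocity by at most \<open>h\<close>, which disappears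
  in the limit.\<close>

lemma vortex_angle_error:
  assumes "h > 0"
  shows "\<bar>vortex_angle c h r / h - c / (2 * pi * r\<^sup>2)\<bar> \<le> h"
proof -
  define \<kappa> where "\<kappa> = c / (2 * pi * r\<^sup>2)"
  have *: "h * (\<kappa> / h) = \<kappa>" using assms by simp
  have "h * of_int \<lfloor>\<kappa> / h\<rfloor> \<le> h * (\<kappa> / h)"
    using assms by (intro mult_left_mono of_int_floor_le) simp
  moreover have "h * (\<kappa> / h) \<le> h * (of_int \<lfloor>\<kappa> / h\<rfloor> + 1)"
    using assms real_of_int_floor_add_one_ge by (intro mult_left_mono) simp_all
  ultimately have "h * of_int \<lfloor>\<kappa> / h\<rfloor> \<le> \<kappa>" "\<kappa> \<le> h * of_int \<lfloor>\<kappa> / h\<rfloor> + h"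
    unfolding * by (simp_all add: distrib_left)
  moreover have "vortex_angle c h r / h = h * of_int \<lfloor>\<kappa> / h\<rfloor>"
    using assms by (simp add: vortex_angle_def \<kappa>_def power2_eq_square)
  ultimately show ?thesis unfolding \<kappa>_def[symmetric] by linarith
qed

lemma bounded_linear_axis: "bounded_linear (axis k :: 'a::euclidean_space \<Rightarrow> 'a ^ 'n::finite)"
  unfolding linear_conv_bounded_linear[symmetric]
  by (rule linearI) (simp_all add: vec_eq_iff axis_def)

lemma consistent_pair_step:
  fixes z :: "(real ^ 2) ^ 'n::finite"
  assumes "z $ i \<noteq> z $ j"
  shows "consistent (\<lambda>h. pair_step c h (i, j))
    (let v = (c / 2) *\<^sub>R biot_savart (z $ i - z $ j) in axis i v - axis j v) z"
proof -
  let ?F = "at_right 0 \<times>\<^sub>F nhds z"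
  define d where "d p = snd p $ i - snd p $ j" for p :: "real \<times> ((real ^ 2) ^ 'n)"
  define \<beta> where "\<beta> p = vortex_angle c (fst p) (norm (d p))" for p
  define d0 where "d0 = z $ i - z $ j"
  define \<kappa> where "\<kappa> = c / (2 * pi * (norm d0)\<^sup>2)"
  have d0: "d0 \<noteq> 0" using assms by (simp add: d0_def)
  have d: "(d \<longlongrightarrow> d0) ?F"
    unfolding d_def[abs_def] d0_def by (intro tendsto_intros tendsto_snd_nhds)
  have "((\<lambda>p. c / (2 * pi * (norm (d p))\<^sup>2)) \<longlongrightarrow> \<kappa>) ?F"
    unfolding \<kappa>_def using d0 by (intro tendsto_intros d) auto
  moreover have "((\<lambda>p. \<beta> p / fst p - c / (2 * pi * (norm (d p))\<^sup>2)) \<longlongrightarrow> 0) ?F"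
  proof (rule Lim_null_comparison[OF _ tendsto_fst_at_right])
    show "eventually (\<lambda>p. norm (\<beta> p / fst p - c / (2 * pi * (norm (d p))\<^sup>2)) \<le> fst p) ?F"
      using eventually_fst_pos by eventually_elim (simp add: \<beta>_def vortex_angle_error)
  qed
  ultimately have "((\<lambda>p. \<beta> p / fst p - c / (2 * pi * (norm (d p))\<^sup>2) + c / (2 * pi * (norm (d p))\<^sup>2)) \<longlongrightarrow> 0 + \<kappa>) ?F"
    by (intro tendsto_add)
  then have \<beta>h: "((\<lambda>p. \<beta> p / fst p) \<longlongrightarrow> \<kappa>) ?F" by simp
  have "((\<lambda>p. fst p * (\<beta> p / fst p)) \<longlongrightarrow> 0 * \<kappa>) ?F"
    by (intro tendsto_mult tendsto_fst_at_right \<beta>h)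
  then have "((\<lambda>p. fst p * (\<beta> p / fst p)) \<longlongrightarrow> 0) ?F" by simp
  then have \<beta>: "(\<beta> \<longlongrightarrow> 0) ?F"
    by (rule Lim_transform_eventually) (use eventually_fst_pos in \<open>eventually_elim, auto\<close>)
  \<comment> \<open>\<open>sinc\<close> is continuous with value 1 at 0. Writing
    \<open>sin t\<close> and \<open>cos t - 1\<close> through it avoids a division by the angle,
    which may be 0 after rounding.\<close>
  define sc where "sc = (\<lambda>t :: real. sinc t)"
  have sc: "((\<lambda>p. sc (g p)) \<longlongrightarrow> 1) ?F" if "(g \<longlongrightarrow> 0) ?F" for g
    using isCont_tendsto_compose[OF isCont_sinc[of 0, folded sc_def] that] by (simp add: sc_def)
  have "((\<lambda>p. sc (\<beta> p) * (\<beta> p / fst p)) \<longlongrightarrow> 1 * \<kappa>) ?F"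
    by (intro tendsto_mult sc \<beta> \<beta>h)
  moreover have "sin t = sc t * t" for t :: real by (simp add: sc_def)
  ultimately have sin: "((\<lambda>p. sin (\<beta> p) / fst p) \<longlongrightarrow> \<kappa>) ?F" by simp
  have half: "((\<lambda>p. \<beta> p / 2) \<longlongrightarrow> 0) ?F" using tendsto_divide[OF \<beta> tendsto_const, of 2] by simp
  have "((\<lambda>p. - (1 / 2) * (sc (\<beta> p / 2))\<^sup>2 * \<beta> p * (\<beta> p / fst p)) \<longlongrightarrow> - (1 / 2) * 1\<^sup>2 * 0 * \<kappa>) ?F"
    by (intro tendsto_mult tendsto_const tendsto_power sc half \<beta> \<beta>h)
  moreover have "cos t - 1 = - (1 / 2) * (sc (t / 2))\<^sup>2 * t * t" for t :: real
    using cos_double_sin[of "t / 2"] by (simp add: sc_def power_divide power2_eq_square)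
  ultimately have cos: "((\<lambda>p. (cos (\<beta> p) - 1) / fst p) \<longlongrightarrow> 0) ?F" by simp
  define v where "v p = (1 / 2) *\<^sub>R (((cos (\<beta> p) - 1) / fst p) *\<^sub>R d p + (sin (\<beta> p) / fst p) *\<^sub>R perp (d p))" for p
  have "(v \<longlongrightarrow> (1 / 2) *\<^sub>R (0 *\<^sub>R d0 + \<kappa> *\<^sub>R perp d0)) ?F"
    unfolding v_def[abs_def]
    by (intro tendsto_scaleR tendsto_add tendsto_const sin cos d
        bounded_linear.tendsto[OF bounded_linear_perp])
  also have "(1 / 2) *\<^sub>R (0 *\<^sub>R d0 + \<kappa> *\<^sub>R perp d0) = (c / 2) *\<^sub>R biot_savart d0"
    by (simp add: biot_savart_def \<kappa>_def)
  finally have v: "(v \<longlongrightarrow> (c / 2) *\<^sub>R biot_savart d0) ?F" .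
  have axis: "((\<lambda>p. axis k (v p) :: (real ^ 2) ^ 'n) \<longlongrightarrow> axis k ((c / 2) *\<^sub>R biot_savart d0)) ?F" for k
    by (rule bounded_linear.tendsto[OF bounded_linear_axis v])
  have "(pair_step c h (i, j) x - x) /\<^sub>R h = axis i (v (h, x)) - axis j (v (h, x))" for h x
  proof -
    define u where "u = (1 / 2) *\<^sub>R (plane_rot (\<beta> (h, x)) (d (h, x)) - d (h, x))"
    have "pair_step c h (i, j) x - x = axis i u - axis j u"
      by (simp add: pair_step_def pair_rot_def Let_def u_def d_def \<beta>_def)
    then have "(pair_step c h (i, j) x - x) /\<^sub>R h = axis i (u /\<^sub>R h) - axis j (u /\<^sub>R h)"
      by (simp add: scaleR_diff_right linear_scale[OF bounded_linear.linear[OF bounded_linear_axis]])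
    also have "u /\<^sub>R h = v (h, x)"
    proof -
      have "inverse h * (1 / 2 * a) = 1 / 2 * (a / h)" for a
        by (cases "h = 0") (simp_all add: field_simps)
      moreover have "plane_rot t y - y = (cos t - 1) *\<^sub>R y + sin t *\<^sub>R perp y" for t y
        by (simp add: plane_rot_def scaleR_left_diff_distrib)
      ultimately show ?thesis
        by (simp only: u_def v_def scaleR_add_right scaleR_scaleR fst_conv)
    qed
    finally show ?thesis .
  qed
  then show ?thesis
    unfolding consistent_def Let_def d0_def[symmetric] using tendsto_diff[OF axis axis]
    by (simp add: case_prod_beta')
qed

text \<open>Particle \<open>k\<close> moves at the visits \<open>(k, j)\<close> and
  \<open>(j, k)\<close>. Because the kernel is odd and \<open>c\<close> is common to all particles,
  both contribute the same half of the interaction.\<close>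

lemma sum_pair_interactions:
  fixes z :: "(real ^ 2) ^ 'n::finite"
  shows "(\<Sum>(i, j)\<in>{(i, j). i \<noteq> j}. let v = (c / 2) *\<^sub>R biot_savart (z $ i - z $ j) in axis i v - axis j v)
    + - (1 / 2) *\<^sub>R z = vortex_field c z"
proof -
  define v where "v i j = (c / 2) *\<^sub>R biot_savart (z $ i - z $ j)" for i j
  have v_minus: "v j i = - v i j" for i j
    using biot_savart_minus[of "z $ i - z $ j"] by (simp add: v_def)
  have P: "{(i, j). i \<noteq> j} = Sigma (UNIV :: 'n set) (\<lambda>i. UNIV - {i})" by auto
  have "(\<Sum>(i, j)\<in>{(i, j). i \<noteq> j}. axis i (v i j) - axis j (v i j)) $ k = (\<Sum>j\<in>UNIV - {k}. 2 *\<^sub>R v k j)" for k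
  proof -
    have "(\<Sum>(i, j)\<in>{(i, j). i \<noteq> j}. axis i (v i j) - axis j (v i j)) $ k
        = (\<Sum>i\<in>UNIV. \<Sum>j\<in>UNIV - {i}. axis i (v i j) $ k) - (\<Sum>i\<in>UNIV. \<Sum>j\<in>UNIV - {i}. axis j (v i j) $ k)"
      unfolding P by (subst sum.Sigma[symmetric]) (auto simp: sum_subtractf)
    also have "(\<Sum>i\<in>UNIV. \<Sum>j\<in>UNIV - {i}. axis i (v i j) $ k) = (\<Sum>i\<in>UNIV. if i = k then \<Sum>j\<in>UNIV - {k}. v k j else 0)"
      by (intro sum.cong) (auto simp: axis_def)
    also have "\<dots> = (\<Sum>j\<in>UNIV - {k}. v k j)" by simp
    also have "(\<Sum>i\<in>UNIV. \<Sum>j\<in>UNIV - {i}. axis j (v i j) $ k) = (\<Sum>i\<in>UNIV. if i \<in> UNIV - {k} then v i k else 0)"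
      by (intro sum.cong) (auto simp: axis_def sum.delta if_distrib cong: if_cong)
    also have "\<dots> = (\<Sum>i\<in>UNIV - {k}. v i k)"
      by (subst sum.inter_filter[symmetric]) (auto intro: sum.cong)
    also have "(\<Sum>j\<in>UNIV - {k}. v k j) - (\<Sum>i\<in>UNIV - {k}. v i k) = (\<Sum>j\<in>UNIV - {k}. 2 *\<^sub>R v k j)"
      unfolding sum_subtractf[symmetric] using v_minus[of _ k] by (intro sum.cong) (auto simp: scaleR_2)
    finally show ?thesis .
  qed
  then show ?thesis
    unfolding Let_def v_def[symmetric]
    by (simp add: vec_eq_iff vortex_field_def vortex_drift_def v_def)
qed

definition vortex_step :: "real \<Rightarrow> ('n::finite \<times> 'n) list \<Rightarrow> real \<Rightarrow> (real ^ 2) ^ 'n \<Rightarrow> (real ^ 2) ^ 'n" where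
  "vortex_step c ps h x = sqrt (1 - h) *\<^sub>R fold (pair_step c h) ps x"

lemma consistent_vortex_step:
  fixes z :: "(real ^ 2) ^ 'n::finite"
  assumes ps: "distinct ps" "set ps = {(i, j). i \<noteq> j}" and z: "\<And>i j. i \<noteq> j \<Longrightarrow> z $ i \<noteq> z $ j"
  shows "consistent (vortex_step c ps) (vortex_field c z) z"
proof -
  let ?v = "\<lambda>(i, j). let v = (c / 2) *\<^sub>R biot_savart (z $ i - z $ j) in axis i v - axis j v"
  have "consistent (\<lambda>h. fold (pair_step c h) ps) (\<Sum>p\<leftarrow>ps. ?v p) z"
    using ps(2) z by (intro consistent_fold) (auto intro: consistent_pair_step)
  from consistent_compose[OF this consistent_sqrt_scale] show ?thesis
    using sum_pair_interactions[of c z] ps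
    by (simp add: sum_list_distinct_conv_sum_set vortex_step_def[abs_def])
qed

text \<open>The path over \<open>[0, T]\<close> is a compact subset of the open set of
  collision-free configurations, so a closed tube \<open>K\<close> around it stays in that set, and
  distances on \<open>K\<close> have a positive lower bound \<open>R\<close>. The tube and the
  Lipschitz constant depend on the path, which is harmless for pathwise convergence.\<close>

lemma vortex_scheme_converges:
  fixes z w :: "real \<Rightarrow> (real ^ 2) ^ 'n::finite" and S :: "nat \<Rightarrow> nat \<Rightarrow> (real ^ 2) ^ 'n"
  assumes "T > 0" and z_cont: "continuous_on {0..T} z"
    and free: "\<And>s i j. s \<in> {0..T} \<Longrightarrow> i \<noteq> j \<Longrightarrow> z s $ i \<noteq> z s $ j"
    and z: "\<And>s i. s \<in> {0..T} \<Longrightarrow> z s $ i = z 0 $ i + w s $ i + integral {0..s} (\<lambda>r. vortex_drift (\<lambda>_. c) (z r) i)"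
    and ps: "distinct ps" "set ps = {(i, j). i \<noteq> j}"
    and S0: "\<And>m. S m 0 = z 0"
    and S: "\<And>m k. S m (Suc k) = vortex_step c ps (T / real m) (S m k)
        + (w (real (Suc k) * (T / real m)) - w (real k * (T / real m)))"
  shows "(\<lambda>m. S m m) \<longlonglongrightarrow> z T"
proof -
  define \<Omega> where "\<Omega> = (\<Inter>(i, j)\<in>{(i, j). i \<noteq> j}. {x :: (real ^ 2) ^ 'n. x $ i \<noteq> x $ j})"
  have "open \<Omega>"
    unfolding \<Omega>_def by (intro open_INT) (auto intro!: open_Collect_neq continuous_intros)
  have comp: "compact (z ` {0..T})" using z_cont by (intro compact_continuous_image) auto
  moreover have "z ` {0..T} \<subseteq> \<Omega>" using free by (auto simp: \<Omega>_def)
  ultimately obtain \<eta> where \<eta>: "\<eta> > 0" "(\<Union>x\<in>z ` {0..T}. cball x \<eta>) \<subseteq> \<Omega>"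
    using compact_subset_open_imp_cball_epsilon_subset \<open>open \<Omega>\<close> by blast
  define K where "K = (\<Union>x\<in>z ` {0..T}. cball x \<eta>)"
  have K_free: "x $ i \<noteq> x $ j" if "x \<in> K" "i \<noteq> j" for x i j
  proof -
    have "x \<in> \<Omega>" using that(1) \<eta>(2) unfolding K_def by (rule subsetD[rotated])
    then show ?thesis using that(2) by (auto simp: \<Omega>_def)
  qed
  \<comment> \<open>A sum of two compact sets, hence compact.\<close>
  have K_sum: "K = (\<Union>x\<in>z ` {0..T}. \<Union>y\<in>cball 0 \<eta>. {x + y})"
  proof -
    have "cball x \<eta> = (\<Union>y\<in>cball 0 \<eta>. {x + y})" for x :: "(real ^ 2) ^ 'n"
    proof (intro set_eqI iffI)
      fix u assume "u \<in> cball x \<eta>"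
      then have "u - x \<in> cball 0 \<eta>" by (simp add: dist_norm norm_minus_commute)
      then show "u \<in> (\<Union>y\<in>cball 0 \<eta>. {x + y})" by (rule UN_I) simp
    qed (auto simp: dist_norm)
    then show ?thesis unfolding K_def by (intro SUP_cong refl)
  qed
  have "compact K" unfolding K_sum by (rule compact_sums'[OF comp compact_cball])
  have "\<exists>r>0. \<forall>x\<in>K. r \<le> norm (x $ i - x $ j)" if "i \<noteq> j" for i j
  proof -
    have "z 0 \<in> K" using \<open>T > 0\<close> \<eta>(1) by (auto simp: K_def intro!: bexI[of _ 0])
    then have "K \<noteq> {}" by auto
    moreover have "continuous_on K (\<lambda>x. norm (x $ i - x $ j))" by (intro continuous_intros)
    ultimately obtain x0 where "x0 \<in> K" "\<And>x. x \<in> K \<Longrightarrow> norm (x0 $ i - x0 $ j) \<le> norm (x $ i - x $ j)"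
      using continuous_attains_inf[OF \<open>compact K\<close>] by blast
    moreover have "x0 $ i \<noteq> x0 $ j" using \<open>x0 \<in> K\<close> that by (rule K_free)
    ultimately show ?thesis by (intro exI[of _ "norm (x0 $ i - x0 $ j)"]) auto
  qed
  then obtain r where r: "\<And>i j. i \<noteq> j \<Longrightarrow> 0 < r i j" "\<And>i j x. i \<noteq> j \<Longrightarrow> x \<in> K \<Longrightarrow> r i j \<le> norm (x $ i - x $ j)"
    by metis
  \<comment> \<open>The extra 1 keeps the set nonempty when there is a single particle.\<close>
  define R where "R = Min (insert 1 ((\<lambda>(i, j). r i j) ` {(i, j). i \<noteq> j}))"
  have "R > 0" unfolding R_def using r(1) by (subst Min_gr_iff) auto
  have R_le: "R \<le> r i j" if "i \<noteq> j" for i j unfolding R_def using that by (intro Min_le) auto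
  obtain L where "L-lipschitz_on {x :: (real ^ 2) ^ 'n. \<forall>i j. i \<noteq> j \<longrightarrow> R \<le> norm (x $ i - x $ j)} (vortex_field c)"
    using vortex_field_lipschitz[OF \<open>R > 0\<close>] by blast
  then have L: "L-lipschitz_on K (vortex_field c)"
    by (rule lipschitz_on_subset) (use r(2) R_le in \<open>force intro: order_trans\<close>)
  have zK: "z s \<in> K" if "s \<in> {0..T}" for s using that \<eta>(1) by (auto simp: K_def intro!: bexI[of _ s])
  show ?thesis
  proof (rule scheme_converges[OF \<open>T > 0\<close> z_cont \<open>compact K\<close> \<eta>(1) _ L _ _ S0 S])
    show "cball (z s) \<eta> \<subseteq> K" if "s \<in> {0..T}" for s using that by (auto simp: K_def)
    show "consistent (vortex_step c ps) (vortex_field c x) x" if "x \<in> K" for x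
      by (rule consistent_vortex_step[OF ps K_free[OF that]])
    fix s assume s: "s \<in> {0..T}"
    have "continuous_on {0..s} z"
      by (rule continuous_on_subset[OF z_cont]) (use s in auto)
    then have "continuous_on {0..s} (\<lambda>r. vortex_field c (z r))"
      by (rule continuous_on_compose2[OF lipschitz_on_continuous_on[OF L]]) (use s zK in auto)
    then have int: "(\<lambda>r. vortex_field c (z r)) integrable_on {0..s}"
      by (rule integrable_continuous_real)
    have "integral {0..s} (\<lambda>r. vortex_field c (z r)) $ i = integral {0..s} (\<lambda>r. vortex_drift (\<lambda>_. c) (z r) i)" for i
      using integral_linear[OF int bounded_linear_vec_nth[of i]] by (simp add: comp_def vortex_field_def)
    then show "z s = z 0 + w s + integral {0..s} (\<lambda>r. vortex_field c (z r))"
      using z[OF s] by (simp add: vec_eq_iff)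
  qed
qed

section \<open>Brownian increments\<close>

lemma in_generated_events:
  fixes W :: "'t \<Rightarrow> 'w \<Rightarrow> 'b::{second_countable_topology, real_normed_vector}"
  assumes W: "\<And>t. t \<in> T \<Longrightarrow> W t \<in> M \<rightarrow>\<^sub>M borel" and "s \<in> T" "t \<in> T" and "A \<in> sets borel"
  shows "(\<lambda>\<omega>. W t \<omega> - W s \<omega>) -` A \<inter> space M \<in> generated_events M T W"
proof -
  let ?G = "{W t -` A \<inter> space M | t A. t \<in> T \<and> A \<in> sets borel}"
  define N where "N = sigma (space M) ?G"
  have G: "?G \<subseteq> Pow (space M)" by auto
  have N: "space N = space M" "sets N = generated_events M T W"
    unfolding N_def generated_events_def using G by (auto simp: space_measure_of sets_measure_of)
  have [measurable]: "W u \<in> N \<rightarrow>\<^sub>M borel" if "u \<in> T" for u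
  proof (rule measurableI)
    fix A :: "'b set" assume "A \<in> sets borel"
    then have "W u -` A \<inter> space M \<in> ?G" using that by blast
    then show "W u -` A \<inter> space N \<in> sets N"
      unfolding N generated_events_def by (rule sigma_sets.Basic)
  qed simp
  have "(\<lambda>\<omega>. W t \<omega> - W s \<omega>) \<in> N \<rightarrow>\<^sub>M borel"
    using assms(2,3) by measurable
  from measurable_sets[OF this \<open>A \<in> sets borel\<close>] show ?thesis
    by (simp add: N)
qed

lemma generated_events_Int:
  assumes "finite K" "K \<noteq> {}" "\<And>k. k \<in> K \<Longrightarrow> A k \<in> generated_events M T W"
  shows "(\<Inter>k\<in>K. A k) \<in> generated_events M T W"
proof -
  let ?G = "{W t -` A \<inter> space M | t A. t \<in> T \<and> A \<in> sets borel}"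
  have "sets (sigma (space M) ?G) = generated_events M T W"
    unfolding generated_events_def by (intro sets_measure_of) auto
  then show ?thesis using sets.finite_INT[of K A "sigma (space M) ?G"] assms by auto
qed

definition increment :: "('n \<Rightarrow> real \<Rightarrow> 'w \<Rightarrow> real ^ 2) \<Rightarrow> real \<Rightarrow> 'n \<Rightarrow> nat \<Rightarrow> 'w \<Rightarrow> real ^ 2" where
  "increment B h i k \<omega> = B i (real (Suc k) * h) \<omega> - B i (real k * h) \<omega>"

definition increments :: "('n::finite \<Rightarrow> real \<Rightarrow> 'w \<Rightarrow> real ^ 2) \<Rightarrow> real \<Rightarrow> nat \<Rightarrow> 'w \<Rightarrow> (real ^ 2) ^ 'n" where
  "increments B h k \<omega> = (\<chi> i. increment B h i k \<omega>)"

text \<open>Grouping independent variables into blocks requires one family with values in one type;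
  hence the initial vector and the planar increments share an index type, and the increments are
  embedded by \<open>axis\<close>.\<close>

definition noise :: "('w \<Rightarrow> (real ^ 2) ^ 'n) \<Rightarrow> ('n::finite \<Rightarrow> real \<Rightarrow> 'w \<Rightarrow> real ^ 2) \<Rightarrow> real \<Rightarrow>
    ('n \<times> nat) option \<Rightarrow> 'w \<Rightarrow> (real ^ 2) ^ 'n" where
  "noise X0 B h j = (case j of None \<Rightarrow> X0 | Some (i, k) \<Rightarrow> (\<lambda>\<omega>. axis i (increment B h i k \<omega>)))"

context
  fixes M :: "'w measure" and X0 :: "'w \<Rightarrow> (real ^ 2) ^ 'n::finite" and B :: "'n \<Rightarrow> real \<Rightarrow> 'w \<Rightarrow> real ^ 2"
  assumes data: "driving_data M X0 B"
begin

interpretation prob_space M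
  using data by (simp add: driving_data_def)

lemma X0_measurable: "X0 \<in> borel_measurable M"
  using data by (simp add: driving_data_def)

lemma B_measurable: "0 \<le> t \<Longrightarrow> B i t \<in> borel_measurable M"
  using data by (simp add: driving_data_def standard_brownian_motion_def)

lemma prob_driving_data:
  assumes E0: "E0 \<in> generated_events M {()} (\<lambda>_. X0)" and E: "\<And>i. E i \<in> generated_events M {0..} (B i)"
  shows "prob (E0 \<inter> (\<Inter>i. E i)) = prob E0 * (\<Prod>i\<in>UNIV. prob (E i))"
proof -
  define A where "A j = (case j of None \<Rightarrow> E0 | Some i \<Rightarrow> E i)" for j
  have "prob (\<Inter>j\<in>UNIV. A j) = (\<Prod>j\<in>UNIV. prob (A j))"
  proof (rule indep_setsD)
    show "indep_sets (\<lambda>k. case k of None \<Rightarrow> generated_events M {()} (\<lambda>_. X0)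
                    | Some i \<Rightarrow> generated_events M {0..} (B i)) UNIV"
      using data by (simp add: driving_data_def)
    show "\<forall>j\<in>UNIV. A j \<in> (case j of None \<Rightarrow> generated_events M {()} (\<lambda>_. X0)
                    | Some i \<Rightarrow> generated_events M {0..} (B i))"
      using E0 E by (auto simp: A_def split: option.split)
  qed auto
  then show ?thesis
    by (simp add: A_def UNIV_option_conv prod.reindex)
qed

context
  fixes h :: real
  assumes h: "h > 0"
begin

lemma increment_measurable [measurable]: "increment B h i k \<in> borel_measurable M"
proof -
  have [measurable]: "B i (real (Suc k) * h) \<in> borel_measurable M" "B i (real k * h) \<in> borel_measurable M"
    using h by (auto intro!: B_measurable)
  show ?thesis unfolding increment_def by measurable
qed

lemma increment_event:
  assumes "A \<in> sets borel"
  shows "increment B h i k -` A \<inter> space M \<in> generated_events M {0..} (B i)"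
  unfolding increment_def using h assms by (intro in_generated_events B_measurable) auto

lemma distr_increment: "distr M borel (increment B h i k) = vec_measure (centered_normal (sqrt h))"
proof -
  have "standard_brownian_motion M (B i)" using data by (simp add: driving_data_def)
  then have "distributed M lborel (\<lambda>\<omega>. B i (real (Suc k) * h) \<omega> - B i (real k * h) \<omega>)
      (\<lambda>x. ennreal (\<Prod>l\<in>UNIV. normal_density 0 (sqrt (real (Suc k) * h - real k * h)) (x $ l)))"
    unfolding standard_brownian_motion_def using h by (auto simp del: of_nat_Suc)
  moreover have "real (Suc k) * h - real k * h = h" by (simp add: algebra_simps)
  ultimately have "distr M lborel (increment B h i k) = density lborel (\<lambda>x. ennreal (\<Prod>l\<in>UNIV. normal_density 0 (sqrt h) (x $ l)))"
    by (simp add: distributed_def increment_def[abs_def])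
  then show ?thesis using h by (simp add: vec_measure_centered_normal cong: distr_cong)
qed

lemma prob_increments:
  assumes "finite K" "K \<noteq> {}" "\<And>k. k \<in> K \<Longrightarrow> A k \<in> sets borel"
  shows "prob (\<Inter>k\<in>K. increment B h i k -` A k \<inter> space M) = (\<Prod>k\<in>K. prob (increment B h i k -` A k \<inter> space M))"
proof -
  define m where "m = Suc (Max K)"
  have "standard_brownian_motion M (B i)" using data by (simp add: driving_data_def)
  then have "indep_vars (\<lambda>_. borel) (\<lambda>k \<omega>. B i (real (Suc k) * h) \<omega> - B i (real k * h) \<omega>) {..<m}"
    unfolding standard_brownian_motion_def using h
    by (elim conjE allE[where x = m] allE[where x = "\<lambda>k. real k * h"]) (auto simp del: of_nat_Suc intro: mult_right_mono)
  then have "indep_sets (\<lambda>k. {increment B h i k -` A \<inter> space M | A. A \<in> sets borel}) {..<m}"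
    unfolding increment_def[symmetric] by (simp add: indep_vars_def2)
  then show ?thesis
    by (rule indep_setsD) (use assms Max_ge[of K] in \<open>auto simp: m_def less_Suc_eq_le\<close>)
qed

lemma axis_measurable [measurable]: "(axis i :: real ^ 2 \<Rightarrow> (real ^ 2) ^ 'n) \<in> borel_measurable borel"
  by (intro borel_measurable_continuous_onI linear_continuous_on bounded_linear_axis)

lemma noise_measurable: "noise X0 B h j \<in> borel_measurable M"
  unfolding noise_def by (auto split: option.split intro: X0_measurable)

text \<open>Two independences are combined: between the initial vector and the Brownian motions, and
  between the increments of each motion. The probability factors first over the particles and then
  over time.\<close>

lemma indep_noise: "indep_vars (\<lambda>_. borel) (noise X0 B h) (insert None (Some ` (UNIV \<times> {..m})))"
proof -
  define I where "I = insert None (Some ` ((UNIV :: 'n set) \<times> {..m}))"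
  have "indep_sets (\<lambda>j. {noise X0 B h j -` A \<inter> space M | A. A \<in> sets borel}) I"
  \<comment> \<open>Each family contains the whole space, so the product formula is needed for the
    full index set only.\<close>
  proof (subst indep_sets_finite)
    show "finite I" "I \<noteq> {}" by (auto simp: I_def)
    show "{noise X0 B h j -` A \<inter> space M |A. A \<in> sets borel} \<subseteq> events" for j
      using noise_measurable by auto
    show "space M \<in> {noise X0 B h j -` A \<inter> space M |A. A \<in> sets borel}" for j
      by (auto intro!: exI[of _ UNIV])
    show "\<forall>A\<in>Pi I (\<lambda>j. {noise X0 B h j -` A \<inter> space M | A. A \<in> sets borel}). prob (\<Inter>j\<in>I. A j) = (\<Prod>j\<in>I. prob (A j))"
    proof
      fix A assume A: "A \<in> Pi I (\<lambda>j. {noise X0 B h j -` A \<inter> space M | A. A \<in> sets borel})"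
      have "\<forall>j\<in>I. \<exists>S\<in>sets borel. A j = noise X0 B h j -` S \<inter> space M"
        using Pi_mem[OF A] by blast
      then obtain S where S: "\<And>j. j \<in> I \<Longrightarrow> S j \<in> sets borel" "\<And>j. j \<in> I \<Longrightarrow> A j = noise X0 B h j -` S j \<inter> space M"
        by metis
      define U where "U i k = axis i -` S (Some (i, k))" for i k
      have U: "U i k \<in> sets borel" if "k \<le> m" for i k
        using measurable_sets[OF axis_measurable S(1), of "Some (i, k)" i] that by (auto simp: U_def I_def)
      have A0: "A None = X0 -` S None \<inter> space M" using S(2)[of None] by (simp add: I_def noise_def)
      have Ai: "A (Some (i, k)) = increment B h i k -` U i k \<inter> space M" if "k \<le> m" for i k
        using S(2)[of "Some (i, k)"] that by (auto simp: I_def noise_def U_def)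
      have "A None \<in> generated_events M {()} (\<lambda>_. X0)"
        unfolding A0 generated_events_def using S(1)[of None] by (intro sigma_sets.Basic) (auto simp: I_def)
      moreover have "(\<Inter>k\<in>{..m}. A (Some (i, k))) \<in> generated_events M {0..} (B i)" for i
        using Ai U increment_event by (intro generated_events_Int) auto
      ultimately have "prob (A None \<inter> (\<Inter>i. \<Inter>k\<in>{..m}. A (Some (i, k))))
          = prob (A None) * (\<Prod>i\<in>UNIV. prob (\<Inter>k\<in>{..m}. A (Some (i, k))))"
        by (rule prob_driving_data)
      also have "A None \<inter> (\<Inter>i. \<Inter>k\<in>{..m}. A (Some (i, k))) = (\<Inter>j\<in>I. A j)"
        by (auto simp: I_def)
      also have "(\<Prod>i\<in>UNIV. prob (\<Inter>k\<in>{..m}. A (Some (i, k)))) = (\<Prod>i\<in>UNIV. \<Prod>k\<in>{..m}. prob (A (Some (i, k))))"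
      proof (rule prod.cong)
        fix i
        show "prob (\<Inter>k\<in>{..m}. A (Some (i, k))) = (\<Prod>k\<in>{..m}. prob (A (Some (i, k))))"
          using prob_increments[of "{..m}" "U i" i] U by (simp add: Ai cong: INF_cong_simp)
      qed simp
      also have "prob (A None) * \<dots> = (\<Prod>j\<in>I. prob (A j))"
        unfolding I_def by (subst prod.insert) (auto simp: prod.reindex prod.cartesian_product case_prod_beta')
      finally show "prob (\<Inter>j\<in>I. A j) = (\<Prod>j\<in>I. prob (A j))" .
    qed
  qed
  then show ?thesis
    unfolding indep_vars_def2 using noise_measurable by (simp add: I_def)
qed

lemma increments_measurable [measurable]: "increments B h k \<in> borel_measurable M"
proof -
  have "(\<lambda>\<omega>. \<lambda>i\<in>UNIV. increment B h i k \<omega>) \<in> M \<rightarrow>\<^sub>M Pi\<^sub>M UNIV (\<lambda>_. borel)"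
    by (intro measurable_restrict increment_measurable)
  from measurable_compose[OF this measurable_vec_lambda[OF refl]] show ?thesis
    by (simp add: increments_def[abs_def] restrict_def)
qed

lemma increments_eq_sum: "increments B h k \<omega> = (\<Sum>i\<in>UNIV. noise X0 B h (Some (i, k)) \<omega>)"
  by (simp add: vec_eq_iff increments_def noise_def axis_def)

lemma distr_increments:
  "distr M borel (increments B h k) = vec_measure (vec_measure (centered_normal (sqrt h)))"
proof -
  have "indep_vars (\<lambda>_. borel) (\<lambda>i. increment B h i k) UNIV"
    unfolding indep_vars_def2
  proof (intro conjI ballI increment_measurable, subst indep_sets_finite)
    show "\<forall>A\<in>Pi UNIV (\<lambda>i. {increment B h i k -` A \<inter> space M | A. A \<in> sets borel}).
        prob (\<Inter>i. A i) = (\<Prod>i\<in>UNIV. prob (A i))"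
    proof
      fix A assume A: "A \<in> Pi UNIV (\<lambda>i. {increment B h i k -` A \<inter> space M | A. A \<in> sets borel})"
      have Ai: "A i \<in> {increment B h i k -` A \<inter> space M | A. A \<in> sets borel}" for i
        using A by (rule Pi_mem) simp
      have gen: "A i \<in> generated_events M {0..} (B i)" and sub: "A i \<subseteq> space M" for i
      proof -
        obtain U where "U \<in> sets borel" "A i = increment B h i k -` U \<inter> space M"
          using Ai[of i] by auto
        then show "A i \<in> generated_events M {0..} (B i)" "A i \<subseteq> space M"
          using increment_event[of U i k] by auto
      qed
      have "space M \<in> generated_events M {()} (\<lambda>_. X0)"
        unfolding generated_events_def by (rule sigma_sets_top)
      from prob_driving_data[OF this gen] have "prob (space M \<inter> (\<Inter>i. A i)) = (\<Prod>i\<in>UNIV. prob (A i))"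
        by (simp add: prob_space)
      moreover have "space M \<inter> (\<Inter>i. A i) = (\<Inter>i. A i)"
        using sub by auto
      ultimately show "prob (\<Inter>i. A i) = (\<Prod>i\<in>UNIV. prob (A i))" by simp
    qed
  qed (auto intro!: exI[of _ UNIV])
  then have "distr M (Pi\<^sub>M UNIV (\<lambda>_. borel)) (\<lambda>\<omega>. \<lambda>i\<in>UNIV. increment B h i k \<omega>)
      = Pi\<^sub>M UNIV (\<lambda>i. distr M borel (increment B h i k))"
    by (subst (asm) indep_vars_iff_distr_eq_PiM') auto
  then have "vec_measure (vec_measure (centered_normal (sqrt h)))
      = distr (distr M (Pi\<^sub>M UNIV (\<lambda>_::'n. borel)) (\<lambda>\<omega>. \<lambda>i\<in>UNIV. increment B h i k \<omega>)) borel vec_lambda"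
    unfolding distr_increment by (simp add: vec_measure_def)
  also have "\<dots> = distr M borel (vec_lambda \<circ> (\<lambda>\<omega>. \<lambda>i\<in>UNIV. increment B h i k \<omega>))"
    by (intro distr_distr measurable_vec_lambda measurable_restrict) auto
  also have "\<dots> = distr M borel (increments B h k)"
    by (intro distr_cong) (auto simp: increments_def)
  finally show ?thesis ..
qed

text \<open>The scheme at step \<open>l\<close> is a measurable function of the block
  \<open>I\<close> of the initial vector and the increments before \<open>l\<close>; those of step
  \<open>l\<close> form the disjoint block \<open>J\<close>.\<close>

lemma indep_scheme_increments:
  assumes S0: "S 0 = X0" and S: "\<And>k \<omega>. S (Suc k) \<omega> = \<Psi> (S k \<omega>) + c *\<^sub>R increments B h k \<omega>"
    and [measurable]: "\<Psi> \<in> borel_measurable borel"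
  shows "indep_var borel (S l) borel (increments B h l)"
proof -
  define I where "I = insert None (Some ` ((UNIV :: 'n set) \<times> {..<l}))"
  define J where "J = Some ` ((UNIV :: 'n set) \<times> {l})"
  define R where "R K \<omega> = restrict (\<lambda>j. noise X0 B h j \<omega>) K" for K \<omega>
  have R: "R K \<omega> j = noise X0 B h j \<omega>" if "j \<in> K" for K \<omega> j
    using that by (simp add: R_def)
  have "indep_var (Pi\<^sub>M I (\<lambda>_. borel)) (R I)
      (Pi\<^sub>M J (\<lambda>_. borel)) (R J)"
    unfolding R_def by (rule indep_var_restrict[OF indep_noise[of l]]) (auto simp: I_def J_def)
  moreover have "\<exists>f\<in>borel_measurable (Pi\<^sub>M I (\<lambda>_. borel)). \<forall>\<omega>. S k \<omega> = f (R I \<omega>)" if "k \<le> l" for k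
    using that
  proof (induction k)
    case 0
    have "(\<lambda>v. v None) \<in> borel_measurable (Pi\<^sub>M I (\<lambda>_. borel))"
      by (rule measurable_component_singleton) (simp add: I_def)
    then show ?case by (intro bexI[of _ "\<lambda>v. v None"]) (auto simp: S0 I_def R noise_def)
  next
    case (Suc k)
    then obtain f where [measurable]: "f \<in> borel_measurable (Pi\<^sub>M I (\<lambda>_. borel))"
      and f: "\<And>\<omega>. S k \<omega> = f (R I \<omega>)" by auto
    have I: "Some (i, k) \<in> I" for i using Suc.prems by (simp add: I_def)
    then have [measurable]: "(\<lambda>v. v (Some (i, k))) \<in> borel_measurable (Pi\<^sub>M I (\<lambda>_. borel))" for i
      by (rule measurable_component_singleton)
    show ?case
    proof (intro bexI allI)
      show "(\<lambda>v. \<Psi> (f v) + c *\<^sub>R (\<Sum>i\<in>UNIV. v (Some (i, k)))) \<in> borel_measurable (Pi\<^sub>M I (\<lambda>_. borel))"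
        by measurable
    qed (simp add: S f increments_eq_sum R I)
  qed
  then obtain f where f: "f \<in> borel_measurable (Pi\<^sub>M I (\<lambda>_. borel))" "\<And>\<omega>. S l \<omega> = f (R I \<omega>)"
    by blast
  moreover have "(\<lambda>v. \<Sum>i\<in>UNIV. v (Some (i, l))) \<in> borel_measurable (Pi\<^sub>M J (\<lambda>_. borel :: ((real ^ 2) ^ 'n) measure))"
    by (intro borel_measurable_sum measurable_component_singleton) (simp add: J_def)
  ultimately have "indep_var borel (f \<circ> (R I)) borel
      ((\<lambda>v. \<Sum>i\<in>UNIV. v (Some (i, l))) \<circ> (R J))"
    by (intro indep_var_compose)
  moreover have "f \<circ> (R I) = S l"
    "(\<lambda>v. \<Sum>i\<in>UNIV. v (Some (i, l))) \<circ> (R J) = increments B h l"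
    by (auto simp: f(2) increments_eq_sum R J_def)
  ultimately show ?thesis by simp
qed

end

end

section \<open>The dual entropy bound\<close>

text \<open>By the Donsker--Varadhan formula, this says that the relative entropy of \<open>\<mu>\<close> with
  respect to \<open>M\<close> is at most \<open>H\<close>.\<close>

definition dv_bound :: "'a measure \<Rightarrow> 'a measure \<Rightarrow> real \<Rightarrow> bool" where
  "dv_bound M \<mu> H \<longleftrightarrow> (\<forall>\<phi>\<in>bdd_measurable M. (\<integral>x. \<phi> x \<partial>\<mu>) \<le> H + log_mgf M \<phi>)"

lemma dv_boundD: "dv_bound M \<mu> H \<Longrightarrow> \<phi> \<in> bdd_measurable M \<Longrightarrow> (\<integral>x. \<phi> x \<partial>\<mu>) \<le> H + log_mgf M \<phi>"
  by (simp add: dv_bound_def)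

lemma dv_bound_nonneg:
  assumes "prob_space M" "dv_bound M \<mu> H"
  shows "0 \<le> H"
proof -
  interpret prob_space M by fact
  have "(\<lambda>_. 0) \<in> bdd_measurable M" by (rule bdd_measurableI[where C = 0]) auto
  from dv_boundD[OF assms(2) this] show ?thesis by (simp add: log_mgf_def prob_space)
qed

lemma dv_bound_distr:
  assumes dv: "dv_bound M \<mu> H" and sets: "sets \<mu> = sets M"
    and T: "T \<in> M \<rightarrow>\<^sub>M M" "distr M M T = M"
  shows "dv_bound M (distr \<mu> M T) H"
  unfolding dv_bound_def
proof
  fix \<phi> assume \<phi>: "\<phi> \<in> bdd_measurable M"
  have "(\<integral>x. \<phi> x \<partial>distr \<mu> M T) = (\<integral>x. \<phi> (T x) \<partial>\<mu>)"
    using T(1) bdd_measurableD[OF \<phi>] sets by (intro integral_distr) (auto cong: measurable_cong_sets)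
  also have "\<dots> \<le> H + log_mgf M (\<lambda>x. \<phi> (T x))"
    using dv bdd_measurable_compose[OF \<phi> T(1)] by (rule dv_boundD)
  also have "log_mgf M (\<lambda>x. \<phi> (T x)) = log_mgf M \<phi>"
    using log_mgf_distr[OF T(1) bdd_measurableD[OF \<phi>]] by (simp add: T(2))
  finally show "(\<integral>x. \<phi> x \<partial>distr \<mu> M T) \<le> H + log_mgf M \<phi>" .
qed

text \<open>The bound for \<mu> is tested against the average over the noise divided by
  \<open>r\<close>; multiplying by \<open>r\<close> afterwards turns \<open>H\<close> into
  \<open>r * H\<close>.\<close>

lemma dv_bound_contracting:
  assumes EC: "entropy_contracting M N f r" "r > 0" and dv: "dv_bound M \<mu> H" and \<phi>: "\<phi> \<in> bdd_measurable M"
  shows "(\<integral>x. (\<integral>y. \<phi> (f x y) \<partial>N) \<partial>\<mu>) \<le> r * H + log_mgf M \<phi>"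
proof -
  interpret N: prob_space N using EC by (simp add: entropy_contracting_def)
  have "(\<lambda>z. \<phi> (case_prod f z)) \<in> bdd_measurable (M \<Otimes>\<^sub>M N)"
    using EC(1) by (intro bdd_measurable_compose[OF \<phi>]) (simp add: entropy_contracting_def)
  then have P: "(\<lambda>x. (\<integral>y. \<phi> (f x y) \<partial>N)) \<in> bdd_measurable M"
    by (intro N.bdd_measurable_integral) (simp add: case_prod_beta')
  have "(\<integral>x. (\<integral>y. \<phi> (f x y) \<partial>N) \<partial>\<mu>) = r * (\<integral>x. (\<integral>y. \<phi> (f x y) \<partial>N) / r \<partial>\<mu>)"
    using \<open>r > 0\<close> by simp
  also have "\<dots> \<le> r * (H + log_mgf M (\<lambda>x. (\<integral>y. \<phi> (f x y) \<partial>N) / r))"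
    using \<open>r > 0\<close> by (intro mult_left_mono dv_boundD[OF dv bdd_measurable_cdiv[OF P]]) simp
  also have "\<dots> \<le> r * H + log_mgf M \<phi>"
    using entropy_contractingD[OF EC(1) \<phi>] by (simp add: distrib_left)
  finally show ?thesis .
qed

section \<open>Relative entropy of densities and its dual form\<close>

lemma prob_density_integral:
  fixes r :: "'a::euclidean_space \<Rightarrow> real"
  assumes [measurable]: "r \<in> borel_measurable borel" and r: "\<And>x. 0 \<le> r x" "prob_space (density lborel r)"
  shows "integrable lborel r" "(\<integral>x. r x \<partial>lborel) = 1"
proof -
  have *: "(\<integral>\<^sup>+x. r x \<partial>lborel) = 1"
    using prob_space.emeasure_space_1[OF r(2)] by (simp add: emeasure_density)
  show i: "integrable lborel r"
    using r(1) * by (intro integrableI_nonneg) auto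
  show "(\<integral>x. r x \<partial>lborel) = 1"
    using r(1) * nn_integral_eq_integral[OF i] by simp
qed

text \<open>Gibbs' inequality: \<open>ln u \<le> u - 1\<close> for the ratio \<open>u\<close> of the
  tilted density exp(\<phi> - l) q to \<open>p\<close>. Both are probability densities, so the right
  side integrates to 0.\<close>

lemma dv_bound_density:
  fixes p q :: "'a::euclidean_space \<Rightarrow> real"
  assumes p: "p \<in> borel_measurable borel" "\<And>x. 0 \<le> p x" "prob_space (density lborel p)"
    and q: "q \<in> borel_measurable borel" "\<And>x. 0 < q x" "prob_space (density lborel q)"
    and fin: "finite_relative_entropy p q"
  shows "dv_bound (density lborel q) (density lborel p) (relative_entropy p q)"
  unfolding dv_bound_def
proof
  fix \<phi> assume \<phi>: "\<phi> \<in> bdd_measurable (density lborel q)"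
  interpret P: prob_space "density lborel p" by fact
  interpret Q: prob_space "density lborel q" by fact
  note [measurable] = p(1) q(1)
  have q_nonneg: "0 \<le> q x" for x using q(2)[of x] by simp
  have [measurable]: "\<phi> \<in> borel_measurable borel" using bdd_measurableD[OF \<phi>] by simp
  define l where "l = log_mgf (density lborel q) \<phi>"
  have \<phi>P: "\<phi> \<in> bdd_measurable (density lborel p)" using \<phi> by (simp add: bdd_measurable_def)
  have "integrable lborel (\<lambda>x. p x * \<phi> x)" and P\<phi>: "(\<integral>x. p x * \<phi> x \<partial>lborel) = (\<integral>x. \<phi> x \<partial>density lborel p)"
    using P.integrable_bdd_measurable[OF \<phi>P] p(2) by (simp_all add: integrable_density integral_density)
  moreover have "integrable lborel p" and P1: "(\<integral>x. p x \<partial>lborel) = 1"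
    using prob_density_integral[OF p] by auto
  moreover have "integrable lborel (\<lambda>x. q x * exp (\<phi> x))"
    and Q\<phi>: "(\<integral>x. q x * exp (\<phi> x) \<partial>lborel) = exp l"
    using Q.integrable_bdd_measurable[OF bdd_measurable_exp[OF \<phi>]] q_nonneg Q.exp_log_mgf[OF \<phi>]
    by (simp_all add: integrable_density integral_density l_def)
  moreover have E: "integrable lborel (entropy_integrand p q)" using fin by (simp add: finite_relative_entropy_def)
  ultimately have "(\<integral>x. p x * \<phi> x - l * p x - entropy_integrand p q x \<partial>lborel)
      \<le> (\<integral>x. exp (- l) * (q x * exp (\<phi> x)) - p x \<partial>lborel)"
  proof (intro integral_mono Bochner_Integration.integrable_diff integrable_mult_right)
    fix x
    show "p x * \<phi> x - l * p x - entropy_integrand p q x \<le> exp (- l) * (q x * exp (\<phi> x)) - p x"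
    proof (cases "p x = 0")
      case False
      then have px: "p x > 0" using p(2)[of x] by simp
      define u where "u = exp (\<phi> x - l) * q x / p x"
      have "u > 0" using px q(2) by (simp add: u_def)
      have "ln u = \<phi> x - l - ln (p x / q x)"
        using px q(2)[of x] by (simp add: u_def ln_mult ln_div)
      moreover have "ln u \<le> u - 1" using \<open>u > 0\<close> by (rule ln_le_minus_one)
      ultimately have "p x * (\<phi> x - l - ln (p x / q x)) \<le> p x * (u - 1)"
        using px by (intro mult_left_mono) auto
      also have "\<dots> = exp (\<phi> x - l) * q x - p x" using px by (simp add: u_def right_diff_distrib)
      finally show ?thesis
        by (simp add: entropy_integrand_def exp_diff exp_minus field_simps)
    qed (use q_nonneg in \<open>simp add: entropy_integrand_def\<close>)
  qed auto
  also have "\<dots> = 0"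
    using \<open>integrable lborel p\<close> \<open>integrable lborel (\<lambda>x. q x * exp (\<phi> x))\<close>
    by (simp add: P1 Q\<phi> exp_minus)
  also have "(\<integral>x. p x * \<phi> x - l * p x - entropy_integrand p q x \<partial>lborel)
      = (\<integral>x. \<phi> x \<partial>density lborel p) - l - relative_entropy p q"
    using \<open>integrable lborel p\<close> \<open>integrable lborel (\<lambda>x. p x * \<phi> x)\<close> E
    by (simp add: P1 P\<phi> relative_entropy_def)
  finally show "(\<integral>x. \<phi> x \<partial>density lborel p) \<le> relative_entropy p q + log_mgf (density lborel q) \<phi>"
    by (simp add: l_def)
qed

text \<open>Measurable functions are limits of continuous ones off a Lebesgue null set, and clipping
  at \<open>C\<close> keeps the bound. Lebesgue null sets are negligible for every measure with a
  density.\<close>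

lemma bounded_measurable_limit_of_continuous:
  fixes \<phi> :: "'a::euclidean_space \<Rightarrow> real"
  assumes "\<phi> \<in> borel_measurable borel" "\<And>x. \<bar>\<phi> x\<bar> \<le> C"
  obtains g where "\<And>n. continuous_on UNIV (g n)" "\<And>n x. \<bar>g n x\<bar> \<le> C"
    "AE x in lborel. (\<lambda>n. g n x) \<longlonglongrightarrow> \<phi> x"
proof -
  have C: "0 \<le> C" using assms(2)[of 0] by simp
  have "\<phi> \<in> borel_measurable lebesgue"
    using assms(1) by (simp add: measurable_completion)
  then have "\<phi> measurable_on UNIV"
    by (rule lebesgue_measurable_imp_measurable_on) simp
  then obtain N g where *: "negligible N \<and> (\<forall>n. continuous_on UNIV (g n)) \<and>
      (\<forall>x. x \<notin> N \<longrightarrow> (\<lambda>n. g n x) \<longlonglongrightarrow> (if x \<in> UNIV then \<phi> x else 0))"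
    unfolding measurable_on_def by blast
  then have N: "negligible N" and g: "\<And>n. continuous_on UNIV (g n)" by blast+
  have lim: "(\<lambda>n. g n x) \<longlonglongrightarrow> \<phi> x" if "x \<notin> N" for x
    using * that by simp
  have "AE x in lebesgue. x \<notin> N"
    using N by (intro AE_not_in) (simp add: negligible_iff_null_sets)
  then have "AE x in lborel. x \<notin> N"
    by (simp add: AE_completion_iff)
  then have "AE x in lborel. (\<lambda>n. max (- C) (min C (g n x))) \<longlonglongrightarrow> \<phi> x"
  proof eventually_elim
    case (elim x)
    have "(\<lambda>n. max (- C) (min C (g n x))) \<longlonglongrightarrow> max (- C) (min C (\<phi> x))"
      by (intro tendsto_max tendsto_min tendsto_const lim elim)
    then show ?case using assms(2)[of x] by (simp add: abs_le_iff min_absorb2 max_absorb2)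
  qed
  moreover have "continuous_on UNIV (\<lambda>x. max (- C) (min C (g n x)))" for n
    by (intro continuous_intros g)
  moreover have "\<bar>max (- C) (min C (g n x))\<bar> \<le> C" for n x
    using C by (auto simp: abs_le_iff)
  ultimately show ?thesis using that[of "\<lambda>n x. max (- C) (min C (g n x))"] by blast
qed

text \<open>The almost sure limit of the scheme delivers the bound for continuous test functions;
  dominated convergence under both densities extends it to all bounded measurable ones.\<close>

lemma dv_bound_of_continuous:
  fixes p q :: "'a::euclidean_space \<Rightarrow> real"
  assumes p: "p \<in> borel_measurable borel" "\<And>x. 0 \<le> p x" "prob_space (density lborel p)"
    and q: "q \<in> borel_measurable borel" "\<And>x. 0 \<le> q x" "prob_space (density lborel q)"
    and dv: "\<And>\<phi> C. continuous_on UNIV \<phi> \<Longrightarrow> (\<And>x. \<bar>\<phi> x\<bar> \<le> C) \<Longrightarrow>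
      (\<integral>x. \<phi> x \<partial>density lborel p) \<le> H + log_mgf (density lborel q) \<phi>"
  shows "dv_bound (density lborel q) (density lborel p) H"
  unfolding dv_bound_def
proof
  fix \<phi> assume \<phi>: "\<phi> \<in> bdd_measurable (density lborel q)"
  interpret P: prob_space "density lborel p" by fact
  interpret Q: prob_space "density lborel q" by fact
  have m [measurable]: "\<phi> \<in> borel_measurable borel" using bdd_measurableD[OF \<phi>] by simp
  obtain C where C: "\<And>x. \<bar>\<phi> x\<bar> \<le> C" using bdd_measurableE[OF \<phi>] by auto
  obtain g where g: "\<And>n. continuous_on UNIV (g n)" "\<And>n x. \<bar>g n x\<bar> \<le> C"
    "AE x in lborel. (\<lambda>n. g n x) \<longlonglongrightarrow> \<phi> x"
    using bounded_measurable_limit_of_continuous[OF m C] by blast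
  have [measurable]: "g n \<in> borel_measurable borel" for n
    using g(1) by (rule borel_measurable_continuous_onI)
  have ae: "AE x in density lborel r. (\<lambda>n. g n x) \<longlonglongrightarrow> \<phi> x" if "r \<in> borel_measurable borel" for r :: "'a \<Rightarrow> ennreal"
    using g(3) that by (subst AE_density) auto
  have "(\<lambda>n. \<integral>x. g n x \<partial>density lborel p) \<longlonglongrightarrow> (\<integral>x. \<phi> x \<partial>density lborel p)"
    by (rule integral_dominated_convergence[where w = "\<lambda>_. C"]) (use g(2) p ae in auto)
  moreover have "(\<lambda>n. \<integral>x. exp (g n x) \<partial>density lborel q) \<longlonglongrightarrow> (\<integral>x. exp (\<phi> x) \<partial>density lborel q)"
  proof (rule integral_dominated_convergence[where w = "\<lambda>_. exp C"])
    show "AE x in density lborel q. (\<lambda>n. exp (g n x)) \<longlonglongrightarrow> exp (\<phi> x)"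
      using ae[of q] q(1) by (auto intro: tendsto_exp elim!: eventually_mono)
    show "AE x in density lborel q. norm (exp (g n x)) \<le> exp C" for n
      using g(2) by (auto simp: abs_le_iff)
  qed auto
  then have "(\<lambda>n. H + log_mgf (density lborel q) (g n)) \<longlonglongrightarrow> H + log_mgf (density lborel q) \<phi>"
    unfolding log_mgf_def using Q.expectation_exp_pos[OF \<phi>] by (intro tendsto_intros) auto
  ultimately show "(\<integral>x. \<phi> x \<partial>density lborel p) \<le> H + log_mgf (density lborel q) \<phi>"
    by (rule LIMSEQ_le) (use dv g in blast)
qed

text \<open>The optimal test function \<open>ln (p / q)\<close> is unbounded, so it is truncated at
  levels \<open>k\<close> and Fatou's lemma removes the truncation. Integrability of the entropy
  integrand is obtained along the way.\<close>

lemma relative_entropy_le_of_dv_bound: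
  fixes p q :: "'a::euclidean_space \<Rightarrow> real"
  assumes p: "p \<in> borel_measurable borel" "\<And>x. 0 \<le> p x" "prob_space (density lborel p)"
    and q: "q \<in> borel_measurable borel" "\<And>x. 0 < q x" "prob_space (density lborel q)"
    and dv: "dv_bound (density lborel q) (density lborel p) H"
  shows "finite_relative_entropy p q \<and> relative_entropy p q \<le> H"
proof -
  interpret P: prob_space "density lborel p" by fact
  interpret Q: prob_space "density lborel q" by fact
  note [measurable] = p(1) q(1)
  have H: "0 \<le> H" using dv_bound_nonneg[OF q(3) dv] .
  have q_nonneg: "0 \<le> q x" for x using q(2)[of x] by simp
  note p1 = prob_density_integral[OF p] and q1 = prob_density_integral[OF q(1) q_nonneg q(3)]
  define L where "L x = ln (p x / q x)" for x
  \<comment> \<open>Where \<open>p\<close> vanishes, \<open>- real k\<close> stands for the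
    truncation of minus infinity; a fixed default value of the logarithm would leave there a share
    of the exponential moment that does not vanish as \<open>k\<close> grows.\<close>
  define \<phi> where "\<phi> k x = (if p x = 0 then - real k else max (- real k) (min (real k) (L x)))" for k x
  have [measurable]: "\<phi> k \<in> borel_measurable borel" for k
    unfolding \<phi>_def L_def by measurable
  have \<phi>_bound: "\<bar>\<phi> k x\<bar> \<le> real k" for k x
    by (auto simp: \<phi>_def abs_le_iff)
  then have \<phi>: "\<phi> k \<in> bdd_measurable (density lborel q)" "\<phi> k \<in> bdd_measurable (density lborel p)" for k
    by (auto intro!: bdd_measurableI)
  \<comment> \<open>Adding \<open>q\<close> makes the integrand nonnegative, by p ln(p/q) \<ge> p -
    q, as Fatou's lemma requires. It costs 1 in the integral, which is subtracted at the
    end.\<close>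
  define f where "f k x = p x * \<phi> k x + q x" for k x
  have f_nonneg: "0 \<le> f k x" for k x
  proof (cases "p x = 0 \<or> 0 \<le> \<phi> k x")
    case True
    then show ?thesis using p(2)[of x] q_nonneg[of x] by (auto simp: f_def)
  next
    case False
    then have px: "p x > 0" using p(2)[of x] by simp
    have "L x = - ln (q x / p x)" using px q(2)[of x] by (simp add: L_def ln_div)
    then have "1 - q x / p x \<le> L x" using ln_le_minus_one[of "q x / p x"] px q(2)[of x] by simp
    also have "L x \<le> \<phi> k x" using False by (auto simp: \<phi>_def)
    finally have "p x * (1 - q x / p x) \<le> p x * \<phi> k x" using px by (intro mult_left_mono) auto
    then show ?thesis using px by (simp add: f_def right_diff_distrib)
  qed
  have f_int: "integrable lborel (f k)" and f_le: "(\<integral>x. f k x \<partial>lborel) \<le> H + exp (- real k) + 1" for k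
  proof -
    have i: "integrable lborel (\<lambda>x. p x * \<phi> k x)"
      "(\<integral>x. p x * \<phi> k x \<partial>lborel) = (\<integral>x. \<phi> k x \<partial>density lborel p)"
      using P.integrable_bdd_measurable[OF \<phi>(2)] p(2) by (simp_all add: integrable_density integral_density)
    show "integrable lborel (f k)" unfolding f_def using i q1 by auto
    \<comment> \<open>The exponential of the test function is at most p/q or equals
      \<open>exp (- real k)\<close>, so truncation raises \<open>log_mgf\<close> above 0 by at most
      \<open>exp (- real k)\<close>.\<close>
    have "(\<integral>x. exp (\<phi> k x) \<partial>density lborel q) = (\<integral>x. q x * exp (\<phi> k x) \<partial>lborel)"
      using q_nonneg by (simp add: integral_density)
    also have "\<dots> \<le> (\<integral>x. p x + exp (- real k) * q x \<partial>lborel)"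
    proof (rule integral_mono)
      show "integrable lborel (\<lambda>x. q x * exp (\<phi> k x))"
        using Q.integrable_bdd_measurable[OF bdd_measurable_exp[OF \<phi>(1)]] q_nonneg by (simp add: integrable_density)
      fix x
      show "q x * exp (\<phi> k x) \<le> p x + exp (- real k) * q x"
      proof (cases "p x = 0 \<or> \<phi> k x = - real k")
        case True
        then show ?thesis using p(2)[of x] by (auto simp: \<phi>_def mult.commute)
      next
        case False
        then have px: "p x > 0" using p(2)[of x] by simp
        have "\<phi> k x \<le> L x" using False by (auto simp: \<phi>_def split: if_splits)
        then have "exp (\<phi> k x) \<le> p x / q x" using px q(2)[of x] by (simp add: L_def ln_ge_iff)
        then have "q x * exp (\<phi> k x) \<le> p x" using q(2)[of x] by (simp add: pos_le_divide_eq mult.commute)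
        also have "\<dots> \<le> p x + exp (- real k) * q x" using q_nonneg by simp
        finally show ?thesis .
      qed
    qed (use p1 q1 in auto)
    also have "\<dots> = 1 + exp (- real k)" using p1 q1 by simp
    finally have "log_mgf (density lborel q) (\<phi> k) \<le> ln (1 + exp (- real k))"
      unfolding log_mgf_def using Q.expectation_exp_pos[OF \<phi>(1)] by (subst ln_le_cancel_iff) (auto simp: add_pos_pos)
    also have "\<dots> \<le> exp (- real k)" by (rule ln_add_one_self_le_self) simp
    finally show "(\<integral>x. f k x \<partial>lborel) \<le> H + exp (- real k) + 1"
      unfolding f_def using dv_boundD[OF dv \<phi>(1), of k] i q1 by simp
  qed
  define F where "F x = entropy_integrand p q x + q x" for x
  have lim: "(\<lambda>k. f k x) \<longlonglongrightarrow> F x" for x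
  proof (cases "p x = 0")
    case True
    then show ?thesis by (simp add: f_def F_def entropy_integrand_def)
  next
    case False
    obtain n where n: "\<bar>L x\<bar> \<le> real n" using real_arch_simple by blast
    have "\<phi> k x = L x" if "n \<le> k" for k
    proof -
      have "\<bar>L x\<bar> \<le> real k" using n that by linarith
      then show ?thesis using False by (simp add: \<phi>_def abs_le_iff min_absorb2 max_absorb2)
    qed
    then have "eventually (\<lambda>k. f k x = F x) sequentially"
      by (intro eventually_sequentiallyI[of n]) (simp add: f_def F_def entropy_integrand_def L_def)
    then show ?thesis by (rule tendsto_eventually)
  qed
  have F_nonneg: "0 \<le> F x" for x
    by (rule LIMSEQ_le_const[OF lim]) (use f_nonneg in blast)
  have [measurable]: "entropy_integrand p q \<in> borel_measurable borel"
    unfolding entropy_integrand_def by measurable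
  have "(\<integral>\<^sup>+x. F x \<partial>lborel) = (\<integral>\<^sup>+x. liminf (\<lambda>k. ennreal (f k x)) \<partial>lborel)"
    using lim by (intro nn_integral_cong lim_imp_Liminf[symmetric] tendsto_ennrealI) auto
  also have "\<dots> \<le> liminf (\<lambda>k. \<integral>\<^sup>+x. f k x \<partial>lborel)"
    unfolding f_def by (rule nn_integral_liminf) measurable
  also have "\<dots> = liminf (\<lambda>k. ennreal (\<integral>x. f k x \<partial>lborel))"
    using f_int f_nonneg by (simp add: nn_integral_eq_integral)
  also have "\<dots> \<le> liminf (\<lambda>k. ennreal (H + exp (- real k) + 1))"
    by (intro Liminf_mono always_eventually allI ennreal_leI f_le)
  also have "\<dots> = ennreal (H + 1)"
  proof (intro lim_imp_Liminf tendsto_ennrealI)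
    have "(\<lambda>k. exp (- real k)) \<longlonglongrightarrow> 0"
      by (rule filterlim_compose[OF exp_at_bot])
        (simp add: filterlim_uminus_at_bot filterlim_real_sequentially)
    from tendsto_add[OF tendsto_add[OF tendsto_const this] tendsto_const]
    show "(\<lambda>k. H + exp (- real k) + 1) \<longlonglongrightarrow> H + 1" by simp
  qed simp
  finally have le: "(\<integral>\<^sup>+x. F x \<partial>lborel) \<le> ennreal (H + 1)" .
  have F_int: "integrable lborel F"
    using le F_nonneg unfolding F_def by (intro integrableI_nonneg) (auto simp: top_unique less_top[symmetric])
  have "ennreal (\<integral>x. F x \<partial>lborel) \<le> ennreal (H + 1)"
    using le F_nonneg by (simp only: nn_integral_eq_integral[OF F_int] always_eventually simp_thms)
  then have "(\<integral>x. F x \<partial>lborel) \<le> H + 1"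
    using H by (subst (asm) ennreal_le_iff) auto
  moreover have "entropy_integrand p q = (\<lambda>x. F x - q x)" by (simp add: F_def fun_eq_iff)
  ultimately show ?thesis
    unfolding finite_relative_entropy_def relative_entropy_def using F_int q1 by simp
qed

section \<open>The splitting scheme\<close>

lemma prob_measure_eqI_continuous:
  fixes \<mu> \<gamma> :: "'a::euclidean_space measure"
  assumes "prob_space \<mu>" "prob_space \<gamma>" and sets: "sets \<mu> = sets borel" "sets \<gamma> = sets borel"
    and eq: "\<And>(\<phi> :: 'a \<Rightarrow> real) C. continuous_on UNIV \<phi> \<Longrightarrow> (\<And>x. \<bar>\<phi> x\<bar> \<le> C) \<Longrightarrow> (\<integral>x. \<phi> x \<partial>\<mu>) = (\<integral>x. \<phi> x \<partial>\<gamma>)"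
  shows "\<mu> = \<gamma>"
proof -
  interpret \<mu>: prob_space \<mu> by fact
  interpret \<gamma>: prob_space \<gamma> by fact
  have closed: "emeasure \<mu> A = emeasure \<gamma> A" if A: "closed A" "A \<noteq> {}" for A
  proof -
    define g where "g k x = max 0 (1 - real k * infdist x A)" for k x
    have g_cont: "continuous_on UNIV (g k)" for k
      unfolding g_def by (intro continuous_intros)
    have g_bound: "\<bar>g k x\<bar> \<le> 1" for k x
      using infdist_nonneg[of x A] by (auto simp: g_def)
    have lim: "(\<lambda>k. g k x) \<longlonglongrightarrow> indicator A x" for x
    proof (cases "x \<in> A")
      case True
      then show ?thesis by (simp add: g_def)
    next
      case False
      then have pos: "infdist x A > 0"
        using A infdist_nonneg[of x A] in_closed_iff_infdist_zero[OF A] by (metis less_eq_real_def)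
      obtain n where n: "1 / infdist x A \<le> real n" using real_arch_simple by blast
      have "g k x = 0" if "n \<le> k" for k
      proof -
        have "1 / infdist x A \<le> real k" using n that by linarith
        then show ?thesis using pos by (simp add: g_def pos_divide_le_eq)
      qed
      then have "eventually (\<lambda>k. g k x = indicator A x) sequentially"
        using False by (intro eventually_sequentiallyI[of n]) simp
      then show ?thesis by (rule tendsto_eventually)
    qed
    have conv: "(\<lambda>k. \<integral>x. g k x \<partial>M) \<longlonglongrightarrow> measure M A" if "prob_space M" "sets M = sets borel" for M
    proof -
      interpret prob_space M by fact
      note [measurable_cong] = that(2)
      have AM: "A \<in> sets M" using A by (simp add: that(2))
      have [measurable]: "g k \<in> borel_measurable borel" for k
        using g_cont by (rule borel_measurable_continuous_onI)
      have "(\<lambda>k. \<integral>x. g k x \<partial>M) \<longlonglongrightarrow> (\<integral>x. indicator A x \<partial>M)"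
        by (rule integral_dominated_convergence[where w = "\<lambda>_. 1"]) (use g_bound lim AM in auto)
      then show ?thesis using AM by simp
    qed
    have "measure \<mu> A = measure \<gamma> A"
      using conv[OF assms(1) sets(1)] conv[OF assms(2) sets(2)] eq[OF g_cont g_bound]
      by (simp add: LIMSEQ_unique)
    then show ?thesis by (simp add: \<mu>.emeasure_eq_measure \<gamma>.emeasure_eq_measure)
  qed
  show ?thesis
  proof (rule measure_eqI_generator_eq[where E = "Collect closed" and \<Omega> = UNIV and A = "\<lambda>_. UNIV"])
    show "emeasure \<mu> X = emeasure \<gamma> X" if "X \<in> Collect closed" for X
      using closed[of X] that by (cases "X = {}") auto
    show "sets \<mu> = sigma_sets UNIV (Collect closed)" "sets \<gamma> = sigma_sets UNIV (Collect closed)"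
      unfolding sets borel_eq_closed by (simp_all add: sets_measure_of)
  qed (auto simp: Int_stable_def)
qed

lemma exp_le_quadratic:
  assumes "\<bar>x\<bar> \<le> (1 :: real)"
  shows "exp x \<le> 1 + x + x\<^sup>2"
proof (cases "0 \<le> x")
  case True
  then show ?thesis using assms by (intro exp_bound) auto
next
  case False
  define y where "y = - x"
  have y: "0 < y" using False by (simp add: y_def)
  have "(1 - y + y\<^sup>2) * (1 + y) = 1 + y ^ 3"
    by (simp add: algebra_simps power2_eq_square power3_eq_cube)
  then have "1 \<le> (1 - y + y\<^sup>2) * (1 + y)" using y by simp
  also have "\<dots> \<le> (1 - y + y\<^sup>2) * exp y"
  proof (rule mult_left_mono)
    have "1 - y + y\<^sup>2 = (y - 1 / 2)\<^sup>2 + 3 / 4" by (simp add: power2_eq_square algebra_simps)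
    also have "\<dots> \<ge> 0" by simp
    finally show "0 \<le> 1 - y + y\<^sup>2" .
  qed (rule exp_ge_add_one_self)
  finally have "exp (- y) \<le> 1 - y + y\<^sup>2" by (simp add: exp_minus field_simps)
  then show ?thesis by (simp add: y_def)
qed

text \<open>Testing the bound against \<open>s * \<phi>\<close> and letting \<open>s\<close> tend to 0 linearises \<open>log_mgf\<close>.\<close>

lemma dv_bound_zero_imp_eq:
  fixes \<mu> \<gamma> :: "'a::euclidean_space measure"
  assumes "prob_space \<mu>" "prob_space \<gamma>" and sets: "sets \<mu> = sets borel" "sets \<gamma> = sets borel"
    and dv: "\<And>\<phi> C. continuous_on UNIV \<phi> \<Longrightarrow> (\<And>x. \<bar>\<phi> x\<bar> \<le> C) \<Longrightarrow> (\<integral>x. \<phi> x \<partial>\<mu>) \<le> log_mgf \<gamma> \<phi>"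
  shows "\<mu> = \<gamma>"
proof (rule prob_measure_eqI_continuous[OF assms(1-4)])
  interpret \<mu>: prob_space \<mu> by fact
  interpret \<gamma>: prob_space \<gamma> by fact
  have le: "(\<integral>x. \<phi> x \<partial>\<mu>) \<le> (\<integral>x. \<phi> x \<partial>\<gamma>)" if cont: "continuous_on UNIV \<phi>" and C: "\<And>x. \<bar>\<phi> x\<bar> \<le> C" for \<phi> :: "'a \<Rightarrow> real" and C
  proof -
    have m: "\<phi> \<in> borel_measurable borel" using cont by (rule borel_measurable_continuous_onI)
    have C0: "C \<ge> 0" using C[of 0] by simp
    have i: "integrable \<gamma> \<phi>"
      using m C by (intro \<gamma>.integrable_const_bound[where B = C]) (auto simp: sets cong: measurable_cong_sets)
    have *: "(\<integral>x. \<phi> x \<partial>\<mu>) \<le> (\<integral>x. \<phi> x \<partial>\<gamma>) + s * C\<^sup>2" if s: "0 < s" "s * C \<le> 1" for s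
    proof -
      have sC: "\<bar>s * \<phi> x\<bar> \<le> s * C" for x using C[of x] s by (simp add: abs_mult)
      have b: "(\<lambda>x. s * \<phi> x) \<in> bdd_measurable \<gamma>"
        using m sC by (intro bdd_measurableI[where C = "s * C"]) (auto simp: sets cong: measurable_cong_sets)
      have "s * (\<integral>x. \<phi> x \<partial>\<mu>) \<le> log_mgf \<gamma> (\<lambda>x. s * \<phi> x)"
        using dv[of "\<lambda>x. s * \<phi> x" "s * C"] cont sC by (simp add: continuous_on_mult)
      also have "\<dots> \<le> (\<integral>x. exp (s * \<phi> x) \<partial>\<gamma>) - 1"
        unfolding log_mgf_def using \<gamma>.expectation_exp_pos[OF b] by (rule ln_le_minus_one)
      also have "(\<integral>x. exp (s * \<phi> x) \<partial>\<gamma>) \<le> (\<integral>x. 1 + s * \<phi> x + s\<^sup>2 * C\<^sup>2 \<partial>\<gamma>)"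
      proof (rule integral_mono)
        show "integrable \<gamma> (\<lambda>x. exp (s * \<phi> x))"
          using b by (intro \<gamma>.integrable_bdd_measurable bdd_measurable_exp)
        fix x
        have "\<bar>s * \<phi> x\<bar> \<le> 1" using sC[of x] s by linarith
        then have "exp (s * \<phi> x) \<le> 1 + s * \<phi> x + (s * \<phi> x)\<^sup>2"
          by (rule exp_le_quadratic)
        also have "(s * \<phi> x)\<^sup>2 \<le> (s * C)\<^sup>2" using sC[of x] by (simp add: abs_le_square_iff[symmetric] C0 s less_imp_le abs_mult)
        finally show "exp (s * \<phi> x) \<le> 1 + s * \<phi> x + s\<^sup>2 * C\<^sup>2" by (simp add: power_mult_distrib)
      qed (use i in auto)
      also have "\<dots> = 1 + s * (\<integral>x. \<phi> x \<partial>\<gamma>) + s\<^sup>2 * C\<^sup>2"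
        using i by (simp add: \<gamma>.prob_space)
      finally have "s * (\<integral>x. \<phi> x \<partial>\<mu>) \<le> s * ((\<integral>x. \<phi> x \<partial>\<gamma>) + s * C\<^sup>2)"
        by (simp add: algebra_simps power2_eq_square)
      then show ?thesis using s(1) by simp
    qed
    show ?thesis
    proof (rule field_le_epsilon)
      fix e :: real assume "e > 0"
      \<comment> \<open>The first term gives \<open>s * C \<le> 1\<close>, the range of the
        quadratic bound for \<open>exp\<close>; the second makes the remainder at most
        \<open>e\<close>. The added ones cover \<open>C = 0\<close>.\<close>
      define s where "s = min (1 / (C + 1)) (e / (C\<^sup>2 + 1))"
      have s: "s > 0" using \<open>e > 0\<close> C0 by (simp add: s_def add_nonneg_pos)
      have "s * C \<le> 1 / (C + 1) * C" using C0 by (intro mult_right_mono) (simp_all add: s_def)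
      also have "\<dots> \<le> 1" using C0 by (simp add: divide_simps)
      finally have "s * C \<le> 1" .
      have "s * C\<^sup>2 \<le> e / (C\<^sup>2 + 1) * C\<^sup>2" by (intro mult_right_mono) (simp_all add: s_def)
      also have "\<dots> \<le> e"
      proof -
        have "e * C\<^sup>2 \<le> e * (C\<^sup>2 + 1)" using \<open>e > 0\<close> by simp
        then show ?thesis by (simp add: pos_divide_le_eq add_nonneg_pos)
      qed
      finally show "(\<integral>x. \<phi> x \<partial>\<mu>) \<le> (\<integral>x. \<phi> x \<partial>\<gamma>) + e" using *[OF s \<open>s * C \<le> 1\<close>] by linarith
    qed
  qed
  fix \<phi> :: "'a \<Rightarrow> real" and C assume \<phi>: "continuous_on UNIV \<phi>" "\<And>x. \<bar>\<phi> x\<bar> \<le> C"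
  \<comment> \<open>The dual bound is one-sided; the opposite inequality comes from the negated test
    function.\<close>
  have "continuous_on UNIV (\<lambda>x. - \<phi> x)" "\<And>x. \<bar>- \<phi> x\<bar> \<le> C"
    using \<phi> by (auto intro: continuous_intros)
  from le[OF this] have "(\<integral>x. - \<phi> x \<partial>\<mu>) \<le> (\<integral>x. - \<phi> x \<partial>\<gamma>)" .
  then show "(\<integral>x. \<phi> x \<partial>\<mu>) = (\<integral>x. \<phi> x \<partial>\<gamma>)" using le[OF \<phi>] by simp
qed

section \<open>The entropy bound along the scheme\<close>

primrec vortex_scheme :: "real \<Rightarrow> ('n::finite \<times> 'n) list \<Rightarrow> real \<Rightarrow> ('w \<Rightarrow> (real ^ 2) ^ 'n) \<Rightarrow>
    ('n \<Rightarrow> real \<Rightarrow> 'w \<Rightarrow> real ^ 2) \<Rightarrow> real \<Rightarrow> nat \<Rightarrow> 'w \<Rightarrow> (real ^ 2) ^ 'n" where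
  "vortex_scheme c ps s X0 B h 0 = X0"
| "vortex_scheme c ps s X0 B h (Suc k) =
    (\<lambda>\<omega>. vortex_step c ps h (vortex_scheme c ps s X0 B h k \<omega>) + s *\<^sub>R increments B h k \<omega>)"

lemma p_infty_pos: "\<nu> > 0 \<Longrightarrow> 0 < p_infty \<nu> z"
  by (simp add: p_infty_def)

lemma p_infty_measurable [measurable]: "p_infty \<nu> \<in> borel_measurable borel"
  unfolding p_infty_radial[abs_def] by measurable

lemma prob_space_gauss_measure:
  assumes "\<nu> > 0"
  shows "prob_space (gauss_measure \<nu> :: ((real ^ 2) ^ 'n::finite) measure)"
proof -
  \<comment> \<open>Any point of the open unit circle quadrant would do in place of (4/5, 3/5): only
    the total mass of the first measure is read off.\<close>
  have "entropy_contracting (vec_measure (vec_measure (centered_normal (sqrt (2 * \<nu>)))) :: ((real ^ 2) ^ 'n) measure)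
    (vec_measure (vec_measure (centered_normal (3 / 5)))) (\<lambda>x y. (4 / 5) *\<^sub>R x + sqrt (2 * \<nu>) *\<^sub>R y) ((4 / 5)\<^sup>2)"
    using assms by (intro planar_normal_contraction) (auto simp: power2_eq_square)
  then show ?thesis by (simp add: gauss_measure_eq_vec_measure[OF assms] entropy_contracting_def)
qed

lemma gauss_measure_fold_pair_step:
  assumes "\<And>p. p \<in> set ps \<Longrightarrow> fst p \<noteq> snd p"
  shows "fold (pair_step c h) ps \<in> gauss_measure \<nu> \<rightarrow>\<^sub>M gauss_measure \<nu>"
    "distr (gauss_measure \<nu>) (gauss_measure \<nu>) (fold (pair_step c h) ps) = gauss_measure \<nu>"
proof -
  define F where "F r = ennreal (1 / (4 * pi * \<nu>) ^ CARD('a) * exp (- (1 / (4 * \<nu>)) * r\<^sup>2))" for r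
  have [measurable]: "F \<in> borel_measurable borel" unfolding F_def by measurable
  have G: "gauss_measure \<nu> = density lborel (\<lambda>z :: (real ^ 2) ^ 'a. F (norm z))"
    by (simp add: gauss_measure_def F_def p_infty_radial[abs_def])
  have "fold (pair_step c h) ps \<in> gauss_measure \<nu> \<rightarrow>\<^sub>M gauss_measure \<nu> \<and>
      distr (gauss_measure \<nu>) (gauss_measure \<nu>) (fold (pair_step c h) ps) = gauss_measure \<nu>"
  proof (rule distr_fold_invariant)
    fix p assume "p \<in> set ps"
    moreover obtain i j where "p = (i, j)" by (cases p)
    ultimately show "pair_step c h p \<in> gauss_measure \<nu> \<rightarrow>\<^sub>M gauss_measure \<nu>"
      "distr (gauss_measure \<nu>) (gauss_measure \<nu>) (pair_step c h p) = gauss_measure \<nu>"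
      using assms distr_pair_step[of i j F c h] by (force simp: G)+
  qed
  then show "fold (pair_step c h) ps \<in> gauss_measure \<nu> \<rightarrow>\<^sub>M gauss_measure \<nu>"
    "distr (gauss_measure \<nu>) (gauss_measure \<nu>) (fold (pair_step c h) ps) = gauss_measure \<nu>" by auto
qed

lemma sets_gauss_measure [simp, measurable_cong]: "sets (gauss_measure \<nu>) = sets borel"
  by (simp add: gauss_measure_def)

lemma space_gauss_measure [simp]: "space (gauss_measure \<nu>) = UNIV"
  by (simp add: gauss_measure_def)

lemma vortex_scheme_measurable:
  assumes data: "driving_data M X0 B" and h: "0 < h"
    and ps: "\<And>p. p \<in> set ps \<Longrightarrow> fst p \<noteq> snd p"
  shows "vortex_scheme c ps s X0 B h k \<in> borel_measurable M"
proof (induction k)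
  case 0
  show ?case using X0_measurable[OF data] by simp
next
  case (Suc k)
  note [measurable] = Suc.IH increments_measurable[OF data h]
  have [measurable]: "fold (pair_step c h) ps \<in> borel_measurable borel"
  proof -
    have "fold (pair_step c h) ps \<in> gauss_measure 1 \<rightarrow>\<^sub>M gauss_measure 1"
      using ps by (rule gauss_measure_fold_pair_step)
    then show ?thesis by (simp cong: measurable_cong_sets)
  qed
  show ?case by (simp add: vortex_step_def)
qed

text \<open>Each step composes a map preserving the Gaussian, which keeps the bound, with the
  contracting step. Independence of the next increment from the current state turns the expectation
  into the iterated integral that \<open>dv_bound_contracting\<close> estimates.\<close>

lemma vortex_scheme_dv_bound:
  fixes X0 :: "'w \<Rightarrow> (real ^ 2) ^ 'n::finite"
  assumes data: "driving_data M X0 B" and h: "0 < h" "h < 1" and \<nu>: "\<nu> > 0"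
    and ps: "\<And>p. p \<in> set ps \<Longrightarrow> fst p \<noteq> snd p"
    and dv: "dv_bound (gauss_measure \<nu>) (distr M borel X0) H"
  shows "dv_bound (gauss_measure \<nu>) (distr M borel (vortex_scheme c ps (sqrt (2 * \<nu>)) X0 B h k)) ((1 - h) ^ k * H)"
proof (induction k)
  case 0
  show ?case using dv by simp
next
  case (Suc k)
  interpret prob_space M using data by (simp add: driving_data_def)
  let ?S = "vortex_scheme c ps (sqrt (2 * \<nu>)) X0 B h"
  let ?\<Phi> = "fold (pair_step c h) ps"
  define \<kappa> :: "((real ^ 2) ^ 'n) measure" where "\<kappa> = vec_measure (vec_measure (centered_normal (sqrt h)))"
  note [measurable] = increments_measurable[OF data h(1)] vortex_scheme_measurable[OF data h(1) ps]
  have \<Phi>: "?\<Phi> \<in> gauss_measure \<nu> \<rightarrow>\<^sub>M gauss_measure \<nu>"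
    "distr (gauss_measure \<nu>) (gauss_measure \<nu>) ?\<Phi> = gauss_measure \<nu>"
    using gauss_measure_fold_pair_step[OF ps] by blast+
  then have [measurable]: "?\<Phi> \<in> borel_measurable borel" by (simp cong: measurable_cong_sets)
  \<comment> \<open>The increment has variance \<open>h\<close> in each coordinate, so scaling by
    \<open>sqrt (1 - h)\<close> keeps the Gaussian exactly invariant, with rate \<rho>^2 = 1 -
    h.\<close>
  have EC: "entropy_contracting (gauss_measure \<nu>) \<kappa>
      (\<lambda>x y. sqrt (1 - h) *\<^sub>R x + sqrt (2 * \<nu>) *\<^sub>R y) (1 - h)"
    using planar_normal_contraction[of "sqrt (1 - h)" "sqrt h" "sqrt (2 * \<nu>)"] h \<nu>
    by (simp add: gauss_measure_eq_vec_measure \<kappa>_def)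
  define \<mu> where "\<mu> = distr (distr M borel (?S k)) (gauss_measure \<nu>) ?\<Phi>"
  have \<mu>: "dv_bound (gauss_measure \<nu>) \<mu> ((1 - h) ^ k * H)"
    unfolding \<mu>_def using Suc.IH by (rule dv_bound_distr[OF _ _ \<Phi>]) simp
  have indep: "indep_var borel (?S k) borel (increments B h k)"
    by (rule indep_scheme_increments[OF data h(1), where \<Psi> = "vortex_step c ps h" and c = "sqrt (2 * \<nu>)"])
      (auto simp: vortex_step_def[abs_def])
  have joint: "distr M borel (?S k) \<Otimes>\<^sub>M \<kappa> = distr M (borel \<Otimes>\<^sub>M borel) (\<lambda>\<omega>. (?S k \<omega>, increments B h k \<omega>))"
    using indep distr_increments[OF data h(1), of k] unfolding indep_var_distribution_eq \<kappa>_def by simp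
  interpret S: prob_space "distr M borel (?S k)" by (rule prob_space_distr) measurable
  interpret \<kappa>: prob_space \<kappa> using EC by (simp add: entropy_contracting_def)
  interpret S\<kappa>: pair_prob_space "distr M borel (?S k)" \<kappa> ..
  have [measurable_cong]: "sets \<kappa> = sets borel" by (simp add: \<kappa>_def)
  show ?case
    unfolding dv_bound_def
  proof
    fix \<phi> :: "(real ^ 2) ^ 'n \<Rightarrow> real" assume \<phi>: "\<phi> \<in> bdd_measurable (gauss_measure \<nu>)"
    have [measurable]: "\<phi> \<in> borel_measurable borel" using bdd_measurableD[OF \<phi>] by simp
    obtain C where C: "\<And>x. \<bar>\<phi> x\<bar> \<le> C" using bdd_measurableE[OF \<phi>] by auto
    let ?f = "\<lambda>x y. sqrt (1 - h) *\<^sub>R x + sqrt (2 * \<nu>) *\<^sub>R y"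
    have "(\<integral>x. \<phi> x \<partial>distr M borel (?S (Suc k))) = (\<integral>\<omega>. \<phi> (?f (?\<Phi> (?S k \<omega>)) (increments B h k \<omega>)) \<partial>M)"
      using vortex_scheme_measurable[OF data h(1) ps, where c = c and s = "sqrt (2 * \<nu>)" and k = "Suc k"]
      by (subst integral_distr) (auto simp: vortex_step_def)
    also have "\<dots> = (\<integral>z. \<phi> (?f (?\<Phi> (fst z)) (snd z)) \<partial>distr M (borel \<Otimes>\<^sub>M borel) (\<lambda>\<omega>. (?S k \<omega>, increments B h k \<omega>)))"
      by (subst integral_distr) auto
    also have "\<dots> = (\<integral>x. (\<integral>y. \<phi> (?f (?\<Phi> x) y) \<partial>\<kappa>) \<partial>distr M borel (?S k))"
      unfolding joint[symmetric]
      by (subst S\<kappa>.integral_fst'[symmetric]) (auto intro!: S\<kappa>.integrable_const_bound[where B = C] simp: C)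
    also have "\<dots> = (\<integral>x. (\<integral>y. \<phi> (?f x y) \<partial>\<kappa>) \<partial>\<mu>)"
      unfolding \<mu>_def by (subst integral_distr) auto
    also have "\<dots> \<le> (1 - h) * ((1 - h) ^ k * H) + log_mgf (gauss_measure \<nu>) \<phi>"
      using h by (intro dv_bound_contracting[OF EC _ \<mu> \<phi>]) simp
    finally show "(\<integral>x. \<phi> x \<partial>distr M borel (?S (Suc k))) \<le> (1 - h) ^ Suc k * H + log_mgf (gauss_measure \<nu>) \<phi>"
      by (simp add: mult.assoc)
  qed
qed

section \<open>From the scheme to the solution\<close>

lemma vortex_solution_initial:
  assumes sol: "vortex_solution \<nu> a M X0 B Z"
  shows "AE \<omega> in M. Z 0 \<omega> = X0 \<omega>"
proof -
  have "AE \<omega> in M. B i 0 \<omega> = 0" for i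
    using sol by (simp add: vortex_solution_def driving_data_def standard_brownian_motion_def)
  then have "AE \<omega> in M. \<forall>i. B i 0 \<omega> = 0" by (simp add: AE_all_countable)
  moreover have "AE \<omega> in M. \<forall>t\<ge>0. \<forall>i.
        Z t \<omega> $ i = X0 \<omega> $ i + sqrt (2 * \<nu>) *\<^sub>R B i t \<omega>
          + integral {0..t} (\<lambda>s. vortex_drift a (Z s \<omega>) i)"
    using sol by (simp add: vortex_solution_def)
  ultimately show ?thesis
    by eventually_elim (auto simp: vec_eq_iff)
qed

lemma vortex_scheme_limit:
  assumes sol: "vortex_solution \<nu> (\<lambda>_. c) M X0 B Z" and "t > 0"
    and ps: "distinct ps" "set ps = {(i, j). i \<noteq> j}"
  shows "AE \<omega> in M. (\<lambda>m. vortex_scheme c ps (sqrt (2 * \<nu>)) X0 B (t / real m) m \<omega>) \<longlonglongrightarrow> Z t \<omega>"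
proof -
  have "AE \<omega> in M. continuous_on {0..} (\<lambda>t. Z t \<omega>)"
    and "AE \<omega> in M. \<forall>t\<ge>0. \<forall>i j. i \<noteq> j \<longrightarrow> Z t \<omega> $ i \<noteq> Z t \<omega> $ j"
    and "AE \<omega> in M. \<forall>t\<ge>0. \<forall>i.
        Z t \<omega> $ i = X0 \<omega> $ i + sqrt (2 * \<nu>) *\<^sub>R B i t \<omega>
          + integral {0..t} (\<lambda>s. vortex_drift (\<lambda>_. c) (Z s \<omega>) i)"
    using sol by (simp_all add: vortex_solution_def)
  with vortex_solution_initial[OF sol] show ?thesis
  proof eventually_elim
    case (elim \<omega>)
    let ?w = "\<lambda>s. sqrt (2 * \<nu>) *\<^sub>R (\<chi> i. B i s \<omega>)"
    show ?case
    proof (rule vortex_scheme_converges[OF \<open>t > 0\<close> _ _ _ ps, where w = ?w and z = "\<lambda>s. Z s \<omega>"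
        and S = "\<lambda>m k. vortex_scheme c ps (sqrt (2 * \<nu>)) X0 B (t / real m) k \<omega>"])
      show "continuous_on {0..t} (\<lambda>s. Z s \<omega>)"
        using elim(2) by (rule continuous_on_subset) auto
      show "vortex_scheme c ps (sqrt (2 * \<nu>)) X0 B (t / real m) (Suc k) \<omega>
          = vortex_step c ps (t / real m) (vortex_scheme c ps (sqrt (2 * \<nu>)) X0 B (t / real m) k \<omega>)
            + (?w (real (Suc k) * (t / real m)) - ?w (real k * (t / real m)))" for m k
        by (simp add: increments_def increment_def vec_eq_iff scaleR_diff_right)
      show "Z s \<omega> $ i = Z 0 \<omega> $ i + ?w s $ i + integral {0..s} (\<lambda>r. vortex_drift (\<lambda>_. c) (Z r \<omega>) i)"
        if "s \<in> {0..t}" for s i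
        using elim that by simp
    qed (use elim in auto)
  qed
qed

text \<open>The bound concerns the random variable and not a density of it, since in the invariance
  claim the density of \<open>Z t\<close> is a conclusion.\<close>

lemma vortex_solution_dv_bound:
  fixes Z :: "real \<Rightarrow> 'w \<Rightarrow> (real ^ 2) ^ 'n::finite"
  assumes sol: "vortex_solution \<nu> (\<lambda>_. c) M X0 B Z" and "\<nu> > 0" "t \<ge> 0"
    and dv: "dv_bound (gauss_measure \<nu>) (distr M borel X0) H"
    and \<phi>: "continuous_on UNIV \<phi>" "\<And>x. \<bar>\<phi> x\<bar> \<le> C"
  shows "(\<integral>\<omega>. \<phi> (Z t \<omega>) \<partial>M) \<le> exp (- t) * H + log_mgf (gauss_measure \<nu>) \<phi>"
proof -
  have data: "driving_data M X0 B" and [measurable]: "Z t \<in> borel_measurable M"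
    using sol \<open>t \<ge> 0\<close> by (auto simp: vortex_solution_def)
  interpret prob_space M using data by (simp add: driving_data_def)
  have [measurable]: "\<phi> \<in> borel_measurable borel" using \<phi>(1) by (rule borel_measurable_continuous_onI)
  have \<phi>_bdd: "\<phi> \<in> bdd_measurable (gauss_measure \<nu>)"
    using \<phi>(2) by (intro bdd_measurableI) auto
  have H: "0 \<le> H"
    using dv_bound_nonneg[OF prob_space_gauss_measure[OF \<open>\<nu> > 0\<close>] dv] .
  show ?thesis
  proof (cases "t = 0")
    case True
    have [measurable]: "X0 \<in> borel_measurable M" "Z 0 \<in> borel_measurable M"
      using X0_measurable[OF data] \<open>Z t \<in> borel_measurable M\<close> True by auto
    have "(\<integral>\<omega>. \<phi> (Z t \<omega>) \<partial>M) = (\<integral>\<omega>. \<phi> (X0 \<omega>) \<partial>M)"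
      using vortex_solution_initial[OF sol] True by (intro integral_cong_AE) auto
    also have "\<dots> = (\<integral>x. \<phi> x \<partial>distr M borel X0)" by (simp add: integral_distr)
    also have "\<dots> \<le> H + log_mgf (gauss_measure \<nu>) \<phi>" using dv \<phi>_bdd by (rule dv_boundD)
    finally show ?thesis using True by simp
  next
    case False
    then have "t > 0" using \<open>t \<ge> 0\<close> by simp
    obtain ps :: "('n \<times> 'n) list" where ps: "set ps = {(i, j). i \<noteq> j}" "distinct ps"
      using finite_distinct_list[of "{(i :: 'n, j). i \<noteq> j}"] by auto
    have ps': "\<And>p. p \<in> set ps \<Longrightarrow> fst p \<noteq> snd p" using ps by auto
    let ?S = "\<lambda>m. vortex_scheme c ps (sqrt (2 * \<nu>)) X0 B (t / real m) m"
    have S_meas: "?S (Suc m) \<in> borel_measurable M" for m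
      using \<open>t > 0\<close> by (intro vortex_scheme_measurable[OF data _ ps']) auto
    \<comment> \<open>The shifted index keeps the step size positive: for \<open>m = 0\<close> it
      would be \<open>t / 0 = 0\<close>.\<close>
    have "(\<lambda>m. \<integral>\<omega>. \<phi> (?S (Suc m) \<omega>) \<partial>M) \<longlonglongrightarrow> (\<integral>\<omega>. \<phi> (Z t \<omega>) \<partial>M)"
    proof (rule integral_dominated_convergence[where w = "\<lambda>_. C"])
      show "AE \<omega> in M. (\<lambda>m. \<phi> (?S (Suc m) \<omega>)) \<longlonglongrightarrow> \<phi> (Z t \<omega>)"
        using vortex_scheme_limit[OF sol \<open>t > 0\<close> ps(2,1)]
      proof eventually_elim
        case (elim \<omega>)
        have "isCont \<phi> (Z t \<omega>)" using \<phi>(1) by (simp add: continuous_on_eq_continuous_at)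
        then show ?case using LIMSEQ_Suc[OF elim] by (rule isCont_tendsto_compose)
      qed
      show "(\<lambda>\<omega>. \<phi> (?S (Suc m) \<omega>)) \<in> borel_measurable M" for m
        using S_meas by (rule measurable_compose) measurable
    qed (use \<phi>(2) in auto)
    moreover have "eventually (\<lambda>m. (\<integral>\<omega>. \<phi> (?S (Suc m) \<omega>) \<partial>M) \<le> exp (- t) * H + log_mgf (gauss_measure \<nu>) \<phi>) sequentially"
    proof -
      \<comment> \<open>From \<open>m = n\<close> on, the step \<open>t / real (Suc m)\<close> is
        below 1, as the contraction factor requires.\<close>
      obtain n where n: "t \<le> real n" using real_arch_simple by blast
      show ?thesis
      proof (rule eventually_sequentiallyI[of n])
        fix m assume "n \<le> m"
        define h where "h = t / real (Suc m)"
        have h: "0 < h" "h < 1" "real (Suc m) * h = t"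
          using \<open>t > 0\<close> n \<open>n \<le> m\<close> by (auto simp: h_def divide_simps)
        have "(\<integral>\<omega>. \<phi> (?S (Suc m) \<omega>) \<partial>M) = (\<integral>x. \<phi> x \<partial>distr M borel (?S (Suc m)))"
          by (rule integral_distr[symmetric, OF S_meas]) measurable
        also have "\<dots> \<le> (1 - h) ^ Suc m * H + log_mgf (gauss_measure \<nu>) \<phi>"
          using vortex_scheme_dv_bound[OF data h(1,2) \<open>\<nu> > 0\<close> ps' dv, where c = c and k = "Suc m"] \<phi>_bdd
          unfolding h_def by (rule dv_boundD)
        also have "(1 - h) ^ Suc m \<le> exp (- h) ^ Suc m"
          using h exp_ge_add_one_self[of "- h"] by (intro power_mono) auto
        also have "exp (- h) ^ Suc m = exp (- t)"
          using h(3) by (simp only: exp_of_nat_mult[symmetric]) simp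
        finally show "(\<integral>\<omega>. \<phi> (?S (Suc m) \<omega>) \<partial>M) \<le> exp (- t) * H + log_mgf (gauss_measure \<nu>) \<phi>"
          using H by (simp add: mult_right_mono)
      qed
    qed
    ultimately show ?thesis
      by (rule tendsto_upperbound) simp
  qed
qed

lemma has_densityD:
  fixes X :: "'w \<Rightarrow> 'b::euclidean_space"
  assumes "has_density M X p" "prob_space M"
  shows "p \<in> borel_measurable borel" "\<And>z. 0 \<le> p z" "prob_space (density lborel p)"
    "distr M borel X = density lborel p"
proof -
  have d: "distr M lborel X = density lborel (\<lambda>z. ennreal (p z))" "X \<in> M \<rightarrow>\<^sub>M lborel"
    "(\<lambda>z. ennreal (p z)) \<in> borel_measurable lborel" and nonneg: "\<And>z. 0 \<le> p z"
    using assms by (auto simp: has_density_def distributed_def)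
  show "0 \<le> p z" for z by (rule nonneg)
  have "(\<lambda>z. enn2real (ennreal (p z))) \<in> borel_measurable lborel"
    using d(3) by measurable
  then show "p \<in> borel_measurable borel" using nonneg by simp
  show eq: "distr M borel X = density lborel p" using d(1) by (simp cong: distr_cong)
  show "prob_space (density lborel p)"
    unfolding eq[symmetric] using d(2) by (intro prob_space.prob_space_distr[OF assms(2)]) simp
qed

theorem proposition2p4:
  fixes \<nu> :: real and a :: "'n::finite \<Rightarrow> real"
  assumes "\<nu> > 0"
    and "\<exists>c. c \<noteq> 0 \<and> (\<forall>i. a i = c)"
  shows "invariant_density TYPE('w) \<nu> a (p_infty \<nu>) \<and>
    (\<forall>(M :: 'w measure) X0 B Z p0.
       vortex_solution \<nu> a M X0 B Z \<longrightarrow> has_density M X0 p0 \<longrightarrow>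
       finite_relative_entropy p0 (p_infty \<nu>) \<longrightarrow>
       (\<forall>t\<ge>0. \<forall>pt. has_density M (Z t) pt \<longrightarrow>
          finite_relative_entropy pt (p_infty \<nu>) \<and>
          relative_entropy pt (p_infty \<nu>) \<le> exp (- t) * relative_entropy p0 (p_infty \<nu>)))"
proof (intro conjI allI impI)
  obtain c where a: "a = (\<lambda>_. c)" using assms(2) by auto
  let ?q = "p_infty \<nu> :: (real ^ 2) ^ 'n \<Rightarrow> real"
  have q: "?q \<in> borel_measurable borel" "\<And>z. 0 < ?q z" "\<And>z. 0 \<le> ?q z" "prob_space (density lborel ?q)"
    using p_infty_pos[OF assms(1)] prob_space_gauss_measure[OF assms(1)]
    by (auto simp: gauss_measure_def intro: less_imp_le)
  have initial: "dv_bound (gauss_measure \<nu>) (distr M borel X0) (relative_entropy p0 ?q)"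
    if "prob_space M" "has_density M X0 p0" "finite_relative_entropy p0 ?q" for M :: "'w measure" and X0 p0
    unfolding gauss_measure_def has_densityD(4)[OF that(2,1)]
    by (rule dv_bound_density[OF has_densityD(1-3)[OF that(2,1)] q(1,2,4) that(3)])
  have prob: "prob_space M" and Z_meas: "t \<ge> 0 \<Longrightarrow> Z t \<in> borel_measurable M"
    if "vortex_solution \<nu> a M X0 B Z" for M :: "'w measure" and X0 B Z t
    using that by (auto simp: vortex_solution_def driving_data_def)
  have "entropy_integrand ?q ?q = (\<lambda>_. 0)"
    using q(2) by (auto simp: entropy_integrand_def fun_eq_iff less_imp_neq[symmetric])
  then have fin0: "finite_relative_entropy ?q ?q" and ent0: "relative_entropy ?q ?q = 0"
    by (simp_all add: finite_relative_entropy_def relative_entropy_def)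
  show "invariant_density TYPE('w) \<nu> a ?q"
    unfolding invariant_density_def
  proof (intro allI impI)
    fix M :: "'w measure" and X0 B Z and t :: real
    assume sol: "vortex_solution \<nu> a M X0 B Z" and X0: "has_density M X0 ?q" and t: "0 \<le> t"
    interpret prob_space M using sol by (rule prob)
    note [measurable] = Z_meas[OF sol t]
    \<comment> \<open>The initial entropy is 0, so the dual bound holds with \<open>H = 0\<close> at
      every time and identifies the law.\<close>
    have "distr M borel (Z t) = gauss_measure \<nu>"
    proof (rule dv_bound_zero_imp_eq)
      fix \<phi> :: "(real ^ 2) ^ 'n \<Rightarrow> real" and C assume \<phi>: "continuous_on UNIV \<phi>" "\<And>x. \<bar>\<phi> x\<bar> \<le> C"
      have [measurable]: "\<phi> \<in> borel_measurable borel" using \<phi>(1) by (rule borel_measurable_continuous_onI)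
      show "(\<integral>x. \<phi> x \<partial>distr M borel (Z t)) \<le> log_mgf (gauss_measure \<nu>) \<phi>"
        using vortex_solution_dv_bound[OF sol[unfolded a] assms(1) t initial[OF prob_space_axioms X0 fin0] \<phi>] ent0
        by (simp add: integral_distr)
    qed (auto intro: prob_space_distr prob_space_gauss_measure assms(1))
    then show "has_density M (Z t) ?q"
      using q(1,3) by (auto simp: has_density_def distributed_def gauss_measure_def cong: distr_cong)
  qed
  fix M :: "'w measure" and X0 B Z p0 and t :: real and pt
  assume sol: "vortex_solution \<nu> a M X0 B Z" and X0: "has_density M X0 p0"
    and fin: "finite_relative_entropy p0 ?q" and t: "0 \<le> t" and pt: "has_density M (Z t) pt"
  interpret prob_space M using sol by (rule prob)
  note [measurable] = Z_meas[OF sol t]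
  note pt' = has_densityD[OF pt prob_space_axioms]
  \<comment> \<open>Here \<open>pt\<close> is an arbitrary version of the density; the dual bound
    for it yields both the finiteness of its entropy and the estimate.\<close>
  have "dv_bound (density lborel ?q) (density lborel pt) (exp (- t) * relative_entropy p0 ?q)"
  proof (rule dv_bound_of_continuous[OF pt'(1-3) q(1,3,4)])
    fix \<phi> :: "(real ^ 2) ^ 'n \<Rightarrow> real" and C assume \<phi>: "continuous_on UNIV \<phi>" "\<And>x. \<bar>\<phi> x\<bar> \<le> C"
    have [measurable]: "\<phi> \<in> borel_measurable borel" using \<phi>(1) by (rule borel_measurable_continuous_onI)
    show "(\<integral>x. \<phi> x \<partial>density lborel pt) \<le> exp (- t) * relative_entropy p0 ?q + log_mgf (density lborel ?q) \<phi>"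
      using vortex_solution_dv_bound[OF sol[unfolded a] assms(1) t initial[OF prob_space_axioms X0 fin] \<phi>]
      unfolding pt'(4)[symmetric] by (simp add: integral_distr gauss_measure_def)
  qed
  from relative_entropy_le_of_dv_bound[OF pt'(1-3) q(1,2,4) this]
  show "finite_relative_entropy pt ?q"
    "relative_entropy pt ?q \<le> exp (- t) * relative_entropy p0 ?q" by auto
qed

end
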